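(* Let $p$ be a prime, $a\in\{1,2,3,\dots\}\cup\{\infty\}$, $q=p^a$, $n\ge1$ an integer with $\gcd(n,p)=1$, and $\mathcal R=\mathbb Z_q[X]/(X^n-1)$. Let $\mathcal A$ be an ideal of $\mathcal R$ different from $(0)$ and $(1)$. If $q$ is finite, then $\mathcal A$ is prime if and only if $\mathcal A=(\pi_a,p)$ for some monic irreducible divisor $\pi_a$ of $X^n-1$ over $\mathbb Z_q$. If $q=p^\infty$, then $\mathcal A$ is prime if and only if $\mathcal A=(\pi_a,p)$ or $\mathcal A=(\pi_a)$ for some monic irreducible divisor $\pi_a$ of $X^n-1$ over $\mathbb Z_q$; the ideals $(\pi_a)$ are prime but not maximal.
   Context: $\mathbb Z_{p^a}$ denotes $\mathbb Z/p^a\mathbb Z$ for finite $a$, and $\mathbb Z_{p^\infty}$ denotes the ring of $p$-adic integers. For $f_1,\dots,f_k\in\mathbb Z_q[X]$, $(f_1,\dots,f_k)$ denotes the ideal of $\mathcal R$ generated by their images. *)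

theory Defs
  imports
    "HOL-Number_Theory.Residues"
    "HOL-Algebra.UnivPoly"
    "HOL-Algebra.QuotRing"
    "HOL-Algebra.Ring_Divisibility"
begin

(* Both the commutative-algebra library and the type-class library have constants
   prime and irreducible; here the bare names refer to the type-class ones. *)
hide_const (open) Divisibility.prime Divisibility.irreducible

text \<open>
  The \<open>p\<close>-adic integers as the inverse limit of the rings of integers modulo \<open>p ^ k\<close>:
  an element is the sequence of its least nonnegative residues modulo \<open>p ^ k\<close>.
\<close>

definition padic_int_ring :: "nat \<Rightarrow> (nat \<Rightarrow> int) ring" where
  "padic_int_ring p =
     \<lparr>carrier = {x. \<forall>k. x k \<in> {0..<int p ^ k} \<and> x (Suc k) mod int p ^ k = x k},
      monoid.mult = (\<lambda>x y k. (x k * y k) mod int p ^ k),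
      one = (\<lambda>k. 1 mod int p ^ k),
      zero = (\<lambda>k. 0),
      add = (\<lambda>x y k. (x k + y k) mod int p ^ k)\<rparr>"

lemma padic_int_ring_cring:
  assumes "p > 0"
  shows "cring (padic_int_ring p)"
proof -
  have dv: "int p ^ k dvd int p ^ Suc k" for k
    by simp
  have mm: "(z mod int p ^ Suc k) mod int p ^ k = z mod int p ^ k" for z k
    using dv mod_mod_cancel by blast
  have pos: "int p ^ k > 0" for k
    using assms by simp
  have in_carrier: "x \<in> carrier (padic_int_ring p) \<longleftrightarrow>
      (\<forall>k. 0 \<le> x k \<and> x k < int p ^ k \<and> x (Suc k) mod int p ^ k = x k)" for x
    by (auto simp: padic_int_ring_def)
  have red: "(\<lambda>k. f k mod int p ^ k) \<in> carrier (padic_int_ring p)"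
    if "\<And>k. f (Suc k) mod int p ^ k = f k mod int p ^ k" for f
    unfolding in_carrier using pos that by (simp add: mm del: power_Suc)
  have mod_id: "x k mod int p ^ k = x k" if "x \<in> carrier (padic_int_ring p)" for x k
    using that by (simp add: in_carrier)
  have coh: "x (Suc k) mod int p ^ k = x k" if "x \<in> carrier (padic_int_ring p)" for x k
    using that by (simp add: in_carrier)
  note sel = padic_int_ring_def
  have add_cl: "x \<oplus>\<^bsub>padic_int_ring p\<^esub> y \<in> carrier (padic_int_ring p)"
    if "x \<in> carrier (padic_int_ring p)" "y \<in> carrier (padic_int_ring p)" for x y
  proof -
    have "(\<lambda>k. (x k + y k) mod int p ^ k) \<in> carrier (padic_int_ring p)"
      by (rule red, subst mod_add_eq[symmetric]) (simp add: coh that)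
    then show ?thesis by (simp add: sel)
  qed
  have mult_cl: "x \<otimes>\<^bsub>padic_int_ring p\<^esub> y \<in> carrier (padic_int_ring p)"
    if "x \<in> carrier (padic_int_ring p)" "y \<in> carrier (padic_int_ring p)" for x y
  proof -
    have "(\<lambda>k. (x k * y k) mod int p ^ k) \<in> carrier (padic_int_ring p)"
      by (rule red, subst mod_mult_eq[symmetric]) (simp add: coh that)
    then show ?thesis by (simp add: sel)
  qed
  have one_cl: "\<one>\<^bsub>padic_int_ring p\<^esub> \<in> carrier (padic_int_ring p)"
    using red[of "\<lambda>_. 1"] by (simp add: sel)
  have zero_cl: "\<zero>\<^bsub>padic_int_ring p\<^esub> \<in> carrier (padic_int_ring p)"
    using pos by (simp add: sel)
  have neg: "\<exists>y\<in>carrier (padic_int_ring p). y \<oplus>\<^bsub>padic_int_ring p\<^esub> x = \<zero>\<^bsub>padic_int_ring p\<^esub>"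
    if "x \<in> carrier (padic_int_ring p)" for x
  proof
    show "(\<lambda>k. (- x k) mod int p ^ k) \<in> carrier (padic_int_ring p)"
      by (rule red, subst mod_minus_eq[symmetric]) (simp add: coh that)
    show "(\<lambda>k. (- x k) mod int p ^ k) \<oplus>\<^bsub>padic_int_ring p\<^esub> x = \<zero>\<^bsub>padic_int_ring p\<^esub>"
      by (simp add: sel mod_simps)
  qed
  show ?thesis
  proof (rule cringI)
    show "abelian_group (padic_int_ring p)"
      by (rule abelian_groupI)
        (use add_cl zero_cl neg mod_id in \<open>auto simp: sel mod_simps add_ac\<close>)
    show "comm_monoid (padic_int_ring p)"
      by (rule comm_monoidI)
        (use mult_cl one_cl mod_id in \<open>auto simp: sel mod_simps mult_ac\<close>)
  qed (auto simp: sel mod_simps algebra_simps)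
qed

definition xn_minus_1 :: "('a, 'b) ring_scheme \<Rightarrow> nat \<Rightarrow> (nat \<Rightarrow> 'a)" where
  "xn_minus_1 S n = monom (UP S) \<one>\<^bsub>S\<^esub> n \<ominus>\<^bsub>UP S\<^esub> \<one>\<^bsub>UP S\<^esub>"

definition cyclic_quot :: "('a, 'b) ring_scheme \<Rightarrow> nat \<Rightarrow> (nat \<Rightarrow> 'a) set ring" where
  "cyclic_quot S n = UP S Quot (Idl\<^bsub>UP S\<^esub> {xn_minus_1 S n})"

definition cyclic_class :: "('a, 'b) ring_scheme \<Rightarrow> nat \<Rightarrow> (nat \<Rightarrow> 'a) \<Rightarrow> (nat \<Rightarrow> 'a) set" where
  "cyclic_class S n f = (Idl\<^bsub>UP S\<^esub> {xn_minus_1 S n}) +>\<^bsub>UP S\<^esub> f"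

definition image_ideal ::
  "('a, 'b) ring_scheme \<Rightarrow> nat \<Rightarrow> (nat \<Rightarrow> 'a) set \<Rightarrow> (nat \<Rightarrow> 'a) set set" where
  "image_ideal S n F = Idl\<^bsub>cyclic_quot S n\<^esub> (cyclic_class S n ` F)"

definition const_nat :: "('a, 'b) ring_scheme \<Rightarrow> nat \<Rightarrow> (nat \<Rightarrow> 'a)" where
  "const_nat S m = [m] \<cdot>\<^bsub>UP S\<^esub> \<one>\<^bsub>UP S\<^esub>"

text \<open>
  Irreducibility is divisibility-theoretic irreducibility in the polynomial ring over \<open>S\<close>,
  which need not be a domain. A monic polynomial is not a zero divisor, so for it this
  means: not a unit, and in every factorization into two polynomials one factor is a unit.
\<close>

definition monic_irred_divisor :: "('a, 'b) ring_scheme \<Rightarrow> nat \<Rightarrow> (nat \<Rightarrow> 'a) \<Rightarrow> bool" where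
  "monic_irred_divisor S n f \<longleftrightarrow>
     f \<in> carrier (UP S) \<and>
     coeff (UP S) f (deg S f) = \<one>\<^bsub>S\<^esub> \<and>
     ring_irreducible\<^bsub>UP S\<^esub> f \<and>
     f divides\<^bsub>UP S\<^esub> xn_minus_1 S n"

end

(*
  Both coefficient rings are local rings S whose maximal ideal is generated by one element c = p,
  and S is c-adically complete and separated (trivially so when c is nilpotent).  Over such an S:

  - an ideal of S[X] that contains c but is not contained in (c) has the form (g, c) with g monic;
  - the Euler operator X d/dX shows that two factors of X^n - 1 modulo c generate the unit ideal
    together with c, because n is a unit; so by Hensel's lemma a factorization of a monic divisor of
    X^n - 1 modulo c lifts to S[X].  Hence (f, c) is maximal whenever the monic divisor f has no
    monic factorization into factors of positive degree;
  - by Nakayama's lemma for the S-finite ring S[X]/(f), such an f is irreducible in S[X], although S[X]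
    need not be a domain.

  A prime ideal Q containing X^n - 1 contains a monic divisor f of minimal degree, which is then
  irreducible.  If c lies in Q, then Q = (f, c) by maximality.  Otherwise a remainder modulo f in Q
  could be divided by powers of c inside Q, and Nakayama's lemma forces it to vanish: Q = (f).
*)
theory Submission
  imports Defs
begin

section \<open>Polynomials with a prescribed degree bound\<close>

text \<open>The obstacle is that for finite a > 1 the coefficient ring has zero divisors: degrees do
  not add, factorizations are not unique, and units such as 1 + cX have positive degree. The
  argument therefore leans on monic polynomials, by which one can divide and which can be cancelled,
  even modulo any constant. Work modulo \<open>c\<close> is expressed by divisibility inside S[X].
  The operator X d/dX is preferred to d/dX because it sends X^n - 1 to n X^n: an ideal that contains
  both contains X^n and X^n - 1, which differ by 1. For p^infinity, the primeness of (f) calls for a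
  substitute for Gauss's lemma: powers of \<open>c\<close> are split off the remainders of two
  factors and cancelled in the domain S, and what is left is decided modulo the maximal ideal (f,
  c). The ideal (f) is not maximal because (f) < (f, c) < (1) is a strict chain. That the p-adic
  integers form a domain comes from the same local and complete setting: a nonzero element is a unit
  times a power of \<open>c\<close>, so zero divisors could only arise from a nilpotent
  \<open>c\<close>.\<close>

context UP_cring
begin

text \<open>A bound replaces the degree: with zero divisors degrees of products are not additive,
  while bounds still are. The bound is strict, so that 0 singles out the zero polynomial, which
  \<open>deg\<close> cannot tell from a constant.\<close>

definition deg_below :: "(nat \<Rightarrow> 'a) \<Rightarrow> nat \<Rightarrow> bool" where
  "deg_below f m \<longleftrightarrow> f \<in> carrier P \<and> (\<forall>i\<ge>m. coeff P f i = \<zero>)"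

text \<open>The degree is a parameter that can be read off a construction directly; it is determined
  by \<open>f\<close> only once one differs from zero (\<open>monic_unique\<close>).\<close>

definition monic :: "(nat \<Rightarrow> 'a) \<Rightarrow> nat \<Rightarrow> bool" where
  "monic f m \<longleftrightarrow> deg_below f (Suc m) \<and> coeff P f m = \<one>"

abbreviation const :: "'a \<Rightarrow> nat \<Rightarrow> 'a" where
  "const z \<equiv> monom P z 0"

lemma deg_below_closed [dest]: "deg_below f m \<Longrightarrow> f \<in> carrier P"
  by (simp add: deg_below_def)

lemma monic_closed [dest]: "monic f m \<Longrightarrow> f \<in> carrier P"
  by (auto simp: monic_def)

lemma deg_below_ex: "f \<in> carrier P \<Longrightarrow> \<exists>m. deg_below f m"
  unfolding deg_below_def using deg_aboveD by (metis Suc_le_lessD)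

lemma deg_below_mono: "deg_below f m \<Longrightarrow> m \<le> k \<Longrightarrow> deg_below f k"
  unfolding deg_below_def by auto

lemma deg_below_add: "deg_below f m \<Longrightarrow> deg_below g m \<Longrightarrow> deg_below (f \<oplus>\<^bsub>P\<^esub> g) m"
  by (simp add: deg_below_def)

lemma deg_below_minus: "deg_below f m \<Longrightarrow> deg_below g m \<Longrightarrow> deg_below (f \<ominus>\<^bsub>P\<^esub> g) m"
  by (simp add: deg_below_def coeff_minus a_minus_def)

lemma deg_below_0_iff: "deg_below f 0 \<longleftrightarrow> f = \<zero>\<^bsub>P\<^esub>"
  unfolding deg_below_def by (auto intro!: up_eqI)

lemma deg_below_monom: "a \<in> carrier R \<Longrightarrow> n < m \<Longrightarrow> deg_below (monom P a n) m"
  by (simp add: deg_below_def)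

lemma coeff_const_mult [simp]:
  "\<lbrakk>z \<in> carrier R; f \<in> carrier P\<rbrakk> \<Longrightarrow> coeff P (const z \<otimes>\<^bsub>P\<^esub> f) i = z \<otimes> coeff P f i"
  by (simp only: monom_mult_is_smult coeff_smult)

text \<open>Polynomials are functions in \<open>up R\<close>, so an eventually vanishing coefficient
  function already is one. Truncations, coefficientwise quotients and limits are all built this
  way.\<close>

lemma poly_with_coeffs:
  assumes "\<And>i. a i \<in> carrier R" "\<And>i. i \<ge> m \<Longrightarrow> a i = \<zero>"
  obtains f where "deg_below f m" "\<And>i. coeff P f i = a i"
proof
  have "a \<in> up R"
    using assms by (intro mem_upI exI[of _ m] bound.intro) auto
  then show "coeff P a i = a i" for i
    by (simp add: P_def UP_def)
  with \<open>a \<in> up R\<close> show "deg_below a m"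
    using assms(2) by (simp add: deg_below_def P_def UP_def)
qed

lemma truncation:
  assumes "f \<in> carrier P"
  obtains g where "deg_below g m" "\<And>i. coeff P g i = (if i < m then coeff P f i else \<zero>)"
  by (rule poly_with_coeffs[of "\<lambda>i. if i < m then coeff P f i else \<zero>" m]) (use assms in auto)

text \<open>The bounds are asymmetric, degree at most \<open>m\<close> and degree below
  \<open>l\<close>, so that they add without a correction term, including for
  \<open>l = 0\<close>.\<close>

lemma deg_below_mult:
  assumes f: "deg_below f (Suc m)" and g: "deg_below g l"
  shows "deg_below (f \<otimes>\<^bsub>P\<^esub> g) (m + l)"
proof -
  have [simp]: "f \<in> carrier P" "g \<in> carrier P" using f g by auto
  have "coeff P (f \<otimes>\<^bsub>P\<^esub> g) k = \<zero>" if k: "m + l \<le> k" for k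
  proof -
    have "coeff P f i \<otimes> coeff P g (k - i) = \<zero>" for i
    proof (cases "i \<le> m")
      case True
      then have "coeff P g (k - i) = \<zero>" using g k by (simp add: deg_below_def)
      then show ?thesis using f by simp
    next
      case False
      then have "coeff P f i = \<zero>" using f by (simp add: deg_below_def)
      then show ?thesis using g by simp
    qed
    then show ?thesis by simp
  qed
  then show ?thesis by (simp add: deg_below_def del: coeff_mult)
qed

lemma coeff_mult_top:
  assumes f: "deg_below f (Suc m)" and g: "deg_below g (Suc l)"
  shows "coeff P (f \<otimes>\<^bsub>P\<^esub> g) (m + l) = coeff P f m \<otimes> coeff P g l"
proof -
  have [simp]: "f \<in> carrier P" "g \<in> carrier P" using f g by auto
  have "coeff P f i \<otimes> coeff P g (m + l - i) = (if m = i then coeff P f i \<otimes> coeff P g l else \<zero>)" for i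
  proof -
    consider "i < m" | "i = m" | "i > m" by linarith
    then show ?thesis
    proof cases
      case 1
      then have "coeff P g (m + l - i) = \<zero>" using g by (simp add: deg_below_def)
      then show ?thesis using 1 by simp
    next
      case 3
      then have "coeff P f i = \<zero>" using f by (simp add: deg_below_def)
      then show ?thesis using 3 by simp
    qed simp
  qed
  then have "coeff P (f \<otimes>\<^bsub>P\<^esub> g) (m + l)
      = (\<Oplus>i\<in>{..m + l}. if m = i then coeff P f i \<otimes> coeff P g l else \<zero>)"
    by simp
  also have "\<dots> = coeff P f m \<otimes> coeff P g l"
    using R.finsum_singleton[of m "{..m + l}" "\<lambda>i. coeff P f i \<otimes> coeff P g l"] by simp
  finally show ?thesis .
qed

lemma monic_mult: "monic f m \<Longrightarrow> monic g l \<Longrightarrow> monic (f \<otimes>\<^bsub>P\<^esub> g) (m + l)"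
  using deg_below_mult[of f m g "Suc l"] coeff_mult_top[of f m g l] by (simp add: monic_def)

lemma monic_one: "monic \<one>\<^bsub>P\<^esub> 0"
  by (simp add: monic_def deg_below_def)

lemma monic_0_iff: "monic f 0 \<longleftrightarrow> f = \<one>\<^bsub>P\<^esub>"
proof
  assume f: "monic f 0"
  have "coeff P f i = coeff P \<one>\<^bsub>P\<^esub> i" for i
  proof (cases "i = 0")
    case True
    then show ?thesis using f by (simp add: monic_def)
  next
    case False
    then have "Suc 0 \<le> i" by simp
    then have "coeff P f i = \<zero>" using f unfolding monic_def deg_below_def by blast
    then show ?thesis using False by simp
  qed
  then show "f = \<one>\<^bsub>P\<^esub>"
    using f by (auto intro: up_eqI)
next
  assume "f = \<one>\<^bsub>P\<^esub>"
  then show "monic f 0" using monic_one by metis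
qed

lemma monic_unique: "monic f m \<Longrightarrow> monic f l \<Longrightarrow> \<one> \<noteq> \<zero> \<Longrightarrow> m = l"
  unfolding monic_def deg_below_def by (metis Suc_leI linorder_neqE_nat)

lemma monic_add: "monic f m \<Longrightarrow> deg_below g m \<Longrightarrow> monic (f \<oplus>\<^bsub>P\<^esub> g) m"
  by (simp add: monic_def deg_below_def)

lemma deg_below_monic_minus:
  assumes f: "monic f m" and g: "monic g m"
  shows "deg_below (f \<ominus>\<^bsub>P\<^esub> g) m"
  unfolding deg_below_def
proof (intro conjI allI impI)
  show "f \<ominus>\<^bsub>P\<^esub> g \<in> carrier P" using f g by auto
  fix i assume "m \<le> i"
  then consider "i = m" | "Suc m \<le> i" by linarith
  then show "coeff P (f \<ominus>\<^bsub>P\<^esub> g) i = \<zero>"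
    using f g by cases (auto simp: monic_def deg_below_def coeff_minus a_minus_def R.r_neg)
qed

lemma monic_division:
  assumes g: "monic g m" and f: "f \<in> carrier P"
  obtains q where "q \<in> carrier P" "deg_below (f \<ominus>\<^bsub>P\<^esub> q \<otimes>\<^bsub>P\<^esub> g) m"
proof -
  have [simp]: "g \<in> carrier P" using g by auto
  have zero_quotient: "\<exists>q\<in>carrier P. deg_below (f \<ominus>\<^bsub>P\<^esub> q \<otimes>\<^bsub>P\<^esub> g) m" if "deg_below f m" for f
  proof -
    have "f \<in> carrier P" using that by auto
    with that show ?thesis
      by (intro bexI[of _ "\<zero>\<^bsub>P\<^esub>"]) (simp_all add: P.minus_eq)
  qed
  have "\<exists>q\<in>carrier P. deg_below (f \<ominus>\<^bsub>P\<^esub> q \<otimes>\<^bsub>P\<^esub> g) m" if "deg_below f N" for N f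
    using that
  proof (induction N arbitrary: f)
    case 0
    then have "deg_below f m" by (rule deg_below_mono) simp
    then show ?case by (rule zero_quotient)
  next
    case (Suc k)
    show ?case
    proof (cases "m \<le> k")
      case False
      then have "deg_below f m" using Suc.prems by (auto intro: deg_below_mono)
      then show ?thesis by (rule zero_quotient)
    next
      case True
      have [simp]: "f \<in> carrier P" using Suc.prems by auto
      \<comment> \<open>As \<open>g\<close> is monic, \<open>t\<close> times \<open>g\<close> has
        the same coefficient at \<open>k\<close> as \<open>f\<close>; subtracting it lowers the
        bound by one without inverting anything.\<close>
      define t where "t = monom P (coeff P f k) (k - m)"
      have t: "deg_below t (Suc (k - m))" by (simp add: t_def deg_below_monom)
      then have [simp]: "t \<in> carrier P" by auto
      have "deg_below (t \<otimes>\<^bsub>P\<^esub> g) (Suc k)" "coeff P (t \<otimes>\<^bsub>P\<^esub> g) k = coeff P f k"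
        using deg_below_mult[OF t, of g "Suc m"] coeff_mult_top[OF t, of g m] g True
        by (simp_all add: monic_def t_def)
      then have *: "coeff P (f \<ominus>\<^bsub>P\<^esub> t \<otimes>\<^bsub>P\<^esub> g) k = \<zero>" "deg_below (f \<ominus>\<^bsub>P\<^esub> t \<otimes>\<^bsub>P\<^esub> g) (Suc k)"
        using Suc.prems
        by (simp_all add: coeff_minus R.r_neg R.minus_eq deg_below_minus del: coeff_mult)
      have "deg_below (f \<ominus>\<^bsub>P\<^esub> t \<otimes>\<^bsub>P\<^esub> g) k"
        using * unfolding deg_below_def by (metis Suc_leI le_neq_implies_less)
      from Suc.IH[OF this] obtain q where
        "q \<in> carrier P" "deg_below (f \<ominus>\<^bsub>P\<^esub> t \<otimes>\<^bsub>P\<^esub> g \<ominus>\<^bsub>P\<^esub> q \<otimes>\<^bsub>P\<^esub> g) m" by blast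
      moreover from \<open>q \<in> carrier P\<close>
      have "f \<ominus>\<^bsub>P\<^esub> t \<otimes>\<^bsub>P\<^esub> g \<ominus>\<^bsub>P\<^esub> q \<otimes>\<^bsub>P\<^esub> g = f \<ominus>\<^bsub>P\<^esub> (t \<oplus>\<^bsub>P\<^esub> q) \<otimes>\<^bsub>P\<^esub> g"
        using \<open>f \<in> carrier P\<close> \<open>g \<in> carrier P\<close> \<open>t \<in> carrier P\<close> by algebra
      ultimately show ?thesis by (intro bexI[of _ "t \<oplus>\<^bsub>P\<^esub> q"]) simp_all
    qed
  qed
  then show ?thesis using deg_below_ex[OF f] that by blast
qed

lemma divides_diff:
  assumes "z \<in> carrier R" "x \<in> carrier R" "y \<in> carrier R" "z divides (x \<oplus> y)" "z divides y"
  shows "z divides x"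
proof -
  obtain u v where uv: "u \<in> carrier R" "v \<in> carrier R" "x \<oplus> y = z \<otimes> u" "y = z \<otimes> v"
    using assms(4,5) unfolding factor_def by blast
  have "x = (x \<oplus> y) \<ominus> y" using assms(2,3) by algebra
  also have "\<dots> = z \<otimes> (u \<ominus> v)"
    unfolding uv(3) unfolding uv(4) using assms(1) uv(1,2) by algebra
  finally show ?thesis using uv unfolding factor_def by blast
qed

lemma const_divides_coeff:
  assumes "z \<in> carrier R" "const z divides\<^bsub>P\<^esub> f"
  shows "z divides coeff P f i"
  using assms unfolding factor_def by (auto simp del: coeff_mult intro!: bexI coeff_closed)

text \<open>If \<open>z\<close> is a zero divisor, the quotient is not unique and need not inherit
  the degree bound. Choosing it coefficientwise, with 0 from \<open>m\<close> on, enforces the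
  bound.\<close>

lemma const_divides_deg_below:
  assumes z: "z \<in> carrier R" and f: "deg_below f m" and d: "\<And>i. z divides coeff P f i"
  obtains w where "deg_below w m" "f = const z \<otimes>\<^bsub>P\<^esub> w"
proof -
  have "\<exists>x\<in>carrier R. coeff P f i = z \<otimes> x \<and> (i \<ge> m \<longrightarrow> x = \<zero>)" for i
  proof (cases "i \<ge> m")
    case True
    then show ?thesis using z f by (intro bexI[of _ \<zero>]) (simp_all add: deg_below_def)
  next
    case False
    then show ?thesis using d[of i] by (auto simp: factor_def)
  qed
  then obtain a where a: "\<And>i. a i \<in> carrier R" "\<And>i. coeff P f i = z \<otimes> a i" "\<And>i. i \<ge> m \<Longrightarrow> a i = \<zero>"
    by metis
  obtain w where w: "deg_below w m" "\<And>i. coeff P w i = a i"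
    by (rule poly_with_coeffs[OF a(1,3)]) auto
  then have "f = const z \<otimes>\<^bsub>P\<^esub> w"
    using a z f deg_below_closed[OF f] deg_below_closed[OF w(1)]
    by (intro up_eqI) (simp_all del: coeff_mult)
  with w that show ?thesis by blast
qed

lemma const_divides_iff:
  assumes "z \<in> carrier R" "f \<in> carrier P"
  shows "const z divides\<^bsub>P\<^esub> f \<longleftrightarrow> (\<forall>i. z divides coeff P f i)"
proof
  assume *: "\<forall>i. z divides coeff P f i"
  obtain m where "deg_below f m" using deg_below_ex assms by blast
  then obtain w where "deg_below w m" "f = const z \<otimes>\<^bsub>P\<^esub> w"
    using const_divides_deg_below assms(1) * by metis
  then show "const z divides\<^bsub>P\<^esub> f" unfolding factor_def by auto
qed (use const_divides_coeff assms in blast)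

text \<open>Reads the coefficients of \<open>q\<close> off the top of the product, modulo
  \<open>z\<close>, from the highest downwards: once those above \<open>i\<close> vanish modulo
  \<open>z\<close>, the product has coefficient \<open>coeff P q i\<close> at \<open>i + m\<close>.
  With \<open>l = 0\<close> this cancels \<open>g\<close> modulo \<open>z\<close>; with
  \<open>z\<close> zero it bounds the degree of \<open>q\<close>.\<close>

lemma monic_mult_divides_coeff:
  assumes g: "monic g m" and q: "q \<in> carrier P" and z: "z \<in> carrier R"
    and d: "\<And>i. i \<ge> l \<Longrightarrow> z divides coeff P (q \<otimes>\<^bsub>P\<^esub> g) (i + m)"
    and "l \<le> i"
  shows "z divides coeff P q i"
proof -
  have [simp]: "g \<in> carrier P" using g by auto
  obtain N where N: "deg_below q N" using deg_below_ex q by blast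
  have z0: "z divides \<zero>" using z unfolding factor_def by (intro bexI[of _ \<zero>]) simp_all
  have "\<forall>i\<ge>l. i \<ge> N - k \<longrightarrow> z divides coeff P q i" for k
  \<comment> \<open>Natural subtraction truncates at 0, so the instance \<open>k = N\<close> covers
    every \<open>i\<close> from \<open>l\<close> on.\<close>
  proof (induction k)
    case 0
    then show ?case using N z0 by (simp add: deg_below_def)
  next
    case (Suc k)
    show ?case
    proof (intro allI impI)
      fix i assume i: "l \<le> i" "N - Suc k \<le> i"
      obtain q1 where q1: "deg_below q1 (Suc i)"
        "\<And>j. coeff P q1 j = (if j < Suc i then coeff P q j else \<zero>)"
        using truncation[OF q] by blast
      then have [simp]: "q1 \<in> carrier P" by auto
      \<comment> \<open>\<open>q2\<close> collects the coefficients above \<open>i\<close>, all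
        divisible by \<open>z\<close> by the induction hypothesis; only \<open>q1\<close>, of degree
        at most \<open>i\<close>, matters modulo \<open>z\<close>.\<close>
      define q2 where "q2 = q \<ominus>\<^bsub>P\<^esub> q1"
      have [simp]: "q2 \<in> carrier P" using q by (simp add: q2_def)
      have c2: "coeff P q2 j = (if j < Suc i then \<zero> else coeff P q j)" for j
        using q by (simp add: q2_def coeff_minus q1 R.minus_eq R.r_neg)
      have "z divides coeff P q2 j" for j
        using Suc i z0 by (auto simp: c2)
      then obtain w where w: "w \<in> carrier P" "q2 = const z \<otimes>\<^bsub>P\<^esub> w"
        using const_divides_iff[OF z \<open>q2 \<in> carrier P\<close>] unfolding factor_def by blast
      have "coeff P (q2 \<otimes>\<^bsub>P\<^esub> g) (i + m) = z \<otimes> coeff P (w \<otimes>\<^bsub>P\<^esub> g) (i + m)"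
        using w z by (simp add: P.m_assoc del: coeff_mult)
      then have d2: "z divides coeff P (q2 \<otimes>\<^bsub>P\<^esub> g) (i + m)"
        using w by (auto simp: factor_def simp del: coeff_mult intro!: bexI coeff_closed)
      have "q = q1 \<oplus>\<^bsub>P\<^esub> q2" unfolding q2_def using q \<open>q1 \<in> carrier P\<close> by algebra
      then have "q \<otimes>\<^bsub>P\<^esub> g = q1 \<otimes>\<^bsub>P\<^esub> g \<oplus>\<^bsub>P\<^esub> q2 \<otimes>\<^bsub>P\<^esub> g"
        by (simp add: P.l_distr)
      then have "z divides (coeff P (q1 \<otimes>\<^bsub>P\<^esub> g) (i + m) \<oplus> coeff P (q2 \<otimes>\<^bsub>P\<^esub> g) (i + m))"
        using d[OF i(1)] by (simp del: coeff_mult)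
      then have "z divides coeff P (q1 \<otimes>\<^bsub>P\<^esub> g) (i + m)"
        by (rule divides_diff[OF z _ _ _ d2, rotated 2]) (simp_all del: coeff_mult)
      moreover have "coeff P (q1 \<otimes>\<^bsub>P\<^esub> g) (i + m) = coeff P q i"
        using coeff_mult_top[OF q1(1), of g m] g q by (simp add: monic_def q1(2) del: coeff_mult)
      ultimately show "z divides coeff P q i" by simp
    qed
  qed
  from this[of N] show ?thesis using \<open>l \<le> i\<close> by simp
qed

text \<open>Only coefficients from \<open>m\<close> on are tested, so that a summand of degree below
  \<open>m\<close> may be present without harm.\<close>

lemma monic_mult_divides:
  assumes "monic g m" "q \<in> carrier P" "z \<in> carrier R"
    and "\<And>i. i \<ge> m \<Longrightarrow> z divides coeff P (q \<otimes>\<^bsub>P\<^esub> g) i"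
  shows "const z divides\<^bsub>P\<^esub> q"
  unfolding const_divides_iff[OF assms(3,2)]
  using monic_mult_divides_coeff[of g m q z 0] assms by auto

lemma zero_divides_iff: "x \<in> carrier R \<Longrightarrow> \<zero> divides x \<longleftrightarrow> x = \<zero>"
  unfolding factor_def by auto

text \<open>The case of zero \<open>z\<close> in \<open>monic_mult_divides_coeff\<close>, where
  divisibility means vanishing.\<close>

lemma monic_mult_deg_below:
  assumes "monic g m" "q \<in> carrier P" "deg_below (q \<otimes>\<^bsub>P\<^esub> g) (m + l)"
  shows "deg_below q l"
proof -
  have "\<zero> divides coeff P q i" if "i \<ge> l" for i
    using that assms
    by (intro monic_mult_divides_coeff[of g m q \<zero> l i])
      (auto simp: zero_divides_iff deg_below_def simp del: coeff_mult)
  then show ?thesis using assms by (auto simp: deg_below_def zero_divides_iff)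
qed

lemma monic_mult_zero:
  assumes "monic g m" "q \<in> carrier P" "deg_below (q \<otimes>\<^bsub>P\<^esub> g) m"
  shows "q = \<zero>\<^bsub>P\<^esub>"
  using monic_mult_deg_below[of g m q 0] assms by (simp add: deg_below_0_iff)

text \<open>The remainder has degree below \<open>e\<close>, hence does not reach the coefficient at
  \<open>d\<close>, and \<open>q\<close> inherits its leading coefficient from \<open>f\<close>.
  This makes an approximate factorization one into monic factors of matching degrees, as Hensel
  lifting requires.\<close>

lemma monic_quotient:
  assumes f: "monic f d" and g: "monic g e" and q: "q \<in> carrier P" and "e \<le> d"
    and r: "deg_below (f \<ominus>\<^bsub>P\<^esub> q \<otimes>\<^bsub>P\<^esub> g) e"
  shows "monic q (d - e)"
proof -
  have [simp]: "f \<in> carrier P" "g \<in> carrier P" using f g by auto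
  have eq: "q \<otimes>\<^bsub>P\<^esub> g = f \<ominus>\<^bsub>P\<^esub> (f \<ominus>\<^bsub>P\<^esub> q \<otimes>\<^bsub>P\<^esub> g)"
    using q \<open>f \<in> carrier P\<close> \<open>g \<in> carrier P\<close> by algebra
  have "deg_below (q \<otimes>\<^bsub>P\<^esub> g) (e + Suc (d - e))"
  proof (subst eq, rule deg_below_minus)
    show "deg_below f (e + Suc (d - e))" using f \<open>e \<le> d\<close> by (simp add: monic_def)
    show "deg_below (f \<ominus>\<^bsub>P\<^esub> q \<otimes>\<^bsub>P\<^esub> g) (e + Suc (d - e))"
      by (rule deg_below_mono[OF r]) simp
  qed
  then have dq: "deg_below q (Suc (d - e))"
    using monic_mult_deg_below g q by blast
  have "coeff P q (d - e) = coeff P (q \<otimes>\<^bsub>P\<^esub> g) d"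
    using coeff_mult_top[OF dq, of g e] g q \<open>e \<le> d\<close> by (simp add: monic_def del: coeff_mult)
  also have "\<dots> = coeff P f d \<ominus> coeff P (f \<ominus>\<^bsub>P\<^esub> q \<otimes>\<^bsub>P\<^esub> g) d"
    using q by (subst eq, intro coeff_minus P.minus_closed P.m_closed) simp_all
  also have "coeff P (f \<ominus>\<^bsub>P\<^esub> q \<otimes>\<^bsub>P\<^esub> g) d = \<zero>"
    using r \<open>e \<le> d\<close> unfolding deg_below_def by blast
  also have "coeff P f d \<ominus> \<zero> = \<one>"
    using f by (simp add: monic_def R.minus_eq)
  finally show ?thesis
    using dq by (simp only: monic_def)
qed

end

section \<open>Ideals and Nakayama's lemma over a local ring\<close>

context cring
begin

text \<open>\<open>Idl\<close> is an intersection of ideals; explicit combinations come from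
  comparing it with the sum of a principal ideal and \<open>Idl S\<close>, which is an ideal
  containing the generators.\<close>

lemma mem_Idl_insert:
  assumes a: "a \<in> carrier R" and S: "S \<subseteq> carrier R"
  shows "x \<in> Idl (insert a S) \<longleftrightarrow> (\<exists>r\<in>carrier R. \<exists>s\<in>Idl S. x = r \<otimes> a \<oplus> s)"
proof -
  have iS: "ideal (Idl S) R" and iP: "ideal (PIdl a) R"
    using genideal_ideal[OF S] cgenideal_ideal[OF a] by auto
  have "ideal (PIdl a <+> Idl S) R" by (rule add_ideals[OF iP iS])
  moreover have "insert a S \<subseteq> PIdl a <+> Idl S"
  proof -
    have "\<zero> \<in> PIdl a" "\<zero> \<in> Idl S"
      using iS iP additive_subgroup.zero_closed ideal.axioms(1) by blast+
    moreover have "a \<in> PIdl a" by (rule cgenideal_self[OF a])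
    moreover have "S \<subseteq> Idl S" by (rule genideal_self[OF S])
    ultimately have "a \<oplus> \<zero> \<in> PIdl a <+> Idl S" "\<And>s. s \<in> S \<Longrightarrow> \<zero> \<oplus> s \<in> PIdl a <+> Idl S"
      unfolding set_add_def' by blast+
    then show ?thesis using a S by (auto simp: subset_iff)
  qed
  ultimately have "Idl (insert a S) \<subseteq> PIdl a <+> Idl S" by (rule genideal_minimal)
  then have 1: "\<exists>r\<in>carrier R. \<exists>s\<in>Idl S. x = r \<otimes> a \<oplus> s" if "x \<in> Idl (insert a S)"
    using that unfolding set_add_def' cgenideal_def by blast
  have "insert a S \<subseteq> carrier R" using a S by simp
  then interpret I: ideal "Idl (insert a S)" R by (rule genideal_ideal)
  have "a \<in> Idl (insert a S)" "Idl S \<subseteq> Idl (insert a S)"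
    using a S genideal_self[of "insert a S"] subset_Idl_subset[of "insert a S" S] by auto
  then have 2: "x \<in> Idl (insert a S)" if "r \<in> carrier R" "s \<in> Idl S" "x = r \<otimes> a \<oplus> s" for r s
    using that by (auto intro!: I.I_l_closed)
  from 1 2 show ?thesis by blast
qed

lemma Idl_empty: "Idl {} = {\<zero>}"
  using genideal_minimal[OF zeroideal, of "{}"] genideal_ideal[of "{}"]
    additive_subgroup.zero_closed ideal.axioms(1) by fastforce

lemma Idl_singletonE:
  assumes "x \<in> Idl {a}" "a \<in> carrier R"
  obtains r where "r \<in> carrier R" "x = r \<otimes> a"
  using assms mem_Idl_insert[of a "{}" x] by (auto simp: Idl_empty)

lemma Idl_pairE:
  assumes x: "x \<in> Idl {a, b}" and cl: "a \<in> carrier R" "b \<in> carrier R"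
  obtains r s where "r \<in> carrier R" "s \<in> carrier R" "x = r \<otimes> a \<oplus> s \<otimes> b"
proof -
  obtain r y where r: "r \<in> carrier R" "y \<in> Idl {b}" "x = r \<otimes> a \<oplus> y"
    using x mem_Idl_insert[of a "{b}" x] cl by auto
  from r(2) obtain s where "s \<in> carrier R" "y = s \<otimes> b"
    by (rule Idl_singletonE[OF _ cl(2)])
  with r that show ?thesis by simp
qed

lemma Idl_tripleE:
  assumes x: "x \<in> Idl {a, b, d}" and cl: "a \<in> carrier R" "b \<in> carrier R" "d \<in> carrier R"
  obtains r s t where "r \<in> carrier R" "s \<in> carrier R" "t \<in> carrier R"
    "x = r \<otimes> a \<oplus> (s \<otimes> b \<oplus> t \<otimes> d)"
proof -
  obtain r y where r: "r \<in> carrier R" "y \<in> Idl {b, d}" "x = r \<otimes> a \<oplus> y"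
    using x mem_Idl_insert[of a "{b, d}" x] cl by auto
  from r(2) obtain s t where "s \<in> carrier R" "t \<in> carrier R" "y = s \<otimes> b \<oplus> t \<otimes> d"
    by (rule Idl_pairE[OF _ cl(2,3)])
  with r that show ?thesis by simp
qed

end

context ideal
begin

lemma minus_mem: "a \<in> I \<Longrightarrow> b \<in> I \<Longrightarrow> a \<ominus> b \<in> I"
  by (simp add: a_minus_def a_inv_closed)

lemma mem_diffD:
  assumes x: "x \<in> carrier R" and "x \<ominus> a \<in> I" and a: "a \<in> I"
  shows "x \<in> I"
proof -
  have "(x \<ominus> a) \<oplus> a \<in> I" using assms by simp
  moreover have "(x \<ominus> a) \<oplus> a = x" using x Icarr[OF a] by algebra
  ultimately show ?thesis by simp
qed

end

section \<open>The Euler operator and coprime factors of X^n - 1\<close>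

context UP_cring
begin

lemma const_mult_const:
  "\<lbrakk>a \<in> carrier R; b \<in> carrier R\<rbrakk> \<Longrightarrow> const a \<otimes>\<^bsub>P\<^esub> const b = const (a \<otimes> b)"
  using monom_mult[of a b 0 0] by simp

text \<open>Unlike the derivative, the operator \<open>X d/dX\<close> multiplies coefficients in place, without an index shift.\<close>

definition euler :: "(nat \<Rightarrow> 'a) \<Rightarrow> nat \<Rightarrow> 'a" where
  "euler f = (\<lambda>i. [i] \<cdot> coeff P f i)"

lemma
  assumes "f \<in> carrier P"
  shows euler_closed [simp]: "euler f \<in> carrier P"
    and coeff_euler [simp]: "coeff P (euler f) i = [i] \<cdot> coeff P f i"
proof -
  obtain m where m: "deg_below f m" using deg_below_ex assms by blast
  obtain t where t: "deg_below t m" "\<And>i. coeff P t i = [i] \<cdot> coeff P f i"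
    by (rule poly_with_coeffs[of "\<lambda>i. [i] \<cdot> coeff P f i" m])
      (use assms m in \<open>auto simp: deg_below_def\<close>)
  have "t \<in> carrier P" using t(1) by auto
  then have "coeff P t i = t i" for i by (simp add: P_def UP_def)
  with t(2) have "t = euler f" by (auto simp: euler_def)
  with t \<open>t \<in> carrier P\<close> show "euler f \<in> carrier P" "coeff P (euler f) i = [i] \<cdot> coeff P f i"
    by auto
qed

text \<open>In each summand of the convolution the weight splits as n = i + (n - i). The weight is
  written as a ring element \<open>[n] \<cdot> \<one>\<close>, so that distributivity moves it
  through the sum.\<close>

lemma euler_mult:
  assumes f: "f \<in> carrier P" and g: "g \<in> carrier P"
  shows "euler (f \<otimes>\<^bsub>P\<^esub> g) = euler f \<otimes>\<^bsub>P\<^esub> g \<oplus>\<^bsub>P\<^esub> f \<otimes>\<^bsub>P\<^esub> euler g"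
proof (rule up_eqI)
  fix n
  have [simp]: "f \<in> carrier P" "g \<in> carrier P" using f g by auto
  let ?t = "\<lambda>i. coeff P f i \<otimes> coeff P g (n - i)"
  have summand: "([n] \<cdot> \<one>) \<otimes> ?t i
      = ([i] \<cdot> coeff P f i) \<otimes> coeff P g (n - i) \<oplus> coeff P f i \<otimes> ([(n - i)] \<cdot> coeff P g (n - i))"
    if "i \<le> n" for i
  proof -
    have "([n] \<cdot> \<one>) \<otimes> ?t i = [(i + (n - i))] \<cdot> ?t i"
      using that by (simp add: R.add_pow_ldistr)
    also have "\<dots> = [i] \<cdot> ?t i \<oplus> [(n - i)] \<cdot> ?t i"
      by (rule R.add.nat_pow_mult[symmetric]) simp
    finally show ?thesis by (simp add: R.add_pow_ldistr R.add_pow_rdistr)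
  qed
  have "coeff P (euler (f \<otimes>\<^bsub>P\<^esub> g)) n = ([n] \<cdot> \<one>) \<otimes> (\<Oplus>i\<in>{..n}. ?t i)"
    by (simp add: R.add_pow_ldistr)
  also have "\<dots> = (\<Oplus>i\<in>{..n}. ([n] \<cdot> \<one>) \<otimes> ?t i)"
    by (rule R.finsum_rdistr) auto
  also have "\<dots> = (\<Oplus>i\<in>{..n}. ([i] \<cdot> coeff P f i) \<otimes> coeff P g (n - i)
      \<oplus> coeff P f i \<otimes> ([(n - i)] \<cdot> coeff P g (n - i)))"
    by (rule R.finsum_cong') (auto simp: summand)
  also have "\<dots> = coeff P (euler f \<otimes>\<^bsub>P\<^esub> g \<oplus>\<^bsub>P\<^esub> f \<otimes>\<^bsub>P\<^esub> euler g) n"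
    by (simp add: R.finsum_addf Pi_def)
  finally show "coeff P (euler (f \<otimes>\<^bsub>P\<^esub> g)) n
    = coeff P (euler f \<otimes>\<^bsub>P\<^esub> g \<oplus>\<^bsub>P\<^esub> f \<otimes>\<^bsub>P\<^esub> euler g) n" .
qed (use f g in simp_all)

lemma euler_add:
  assumes "f \<in> carrier P" "g \<in> carrier P"
  shows "euler (f \<oplus>\<^bsub>P\<^esub> g) = euler f \<oplus>\<^bsub>P\<^esub> euler g"
  using assms by (intro up_eqI) (simp_all add: R.add.nat_pow_distrib R.a_comm)

lemma euler_const:
  "z \<in> carrier R \<Longrightarrow> euler (const z) = \<zero>\<^bsub>P\<^esub>"
  by (intro up_eqI) simp_all

abbreviation xn_minus_one :: "nat \<Rightarrow> nat \<Rightarrow> 'a" where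
  "xn_minus_one n \<equiv> monom P \<one> n \<ominus>\<^bsub>P\<^esub> \<one>\<^bsub>P\<^esub>"

lemma xn_minus_1_eq: "xn_minus_1 R n = xn_minus_one n"
  by (simp add: xn_minus_1_def P_def)

lemma monic_xn_minus_one: "n \<ge> 1 \<Longrightarrow> monic (xn_minus_one n) n"
  by (simp add: monic_def deg_below_def coeff_minus R.minus_eq)

lemma euler_xn_minus_one:
  "euler (xn_minus_one n) = const ([n] \<cdot> \<one>) \<otimes>\<^bsub>P\<^esub> monom P \<one> n"
  by (intro up_eqI) (auto simp: coeff_minus R.minus_eq simp del: coeff_mult)

text \<open>By the Leibniz rule every term of the Euler image of \<open>g h k\<close> still contains
  \<open>g\<close> or \<open>h\<close>, and the rest is a multiple of \<open>const z\<close>; so n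
  X^n lies in \<open>J\<close>. Since n is a unit, X^n lies in \<open>J\<close>, and so does X^n -
  1. The factor \<open>k\<close> allows \<open>g h\<close> to be a proper divisor, and
  \<open>w\<close> allows a congruence modulo \<open>z\<close> instead of an equality.\<close>

lemma xn_minus_one_coprime_factors:
  assumes J: "ideal J P" and mem: "g \<in> J" "h \<in> J" "const z \<in> J"
    and k: "k \<in> carrier P" and w: "w \<in> carrier P" and z: "z \<in> carrier R"
    and eq: "xn_minus_one n = g \<otimes>\<^bsub>P\<^esub> h \<otimes>\<^bsub>P\<^esub> k \<oplus>\<^bsub>P\<^esub> const z \<otimes>\<^bsub>P\<^esub> w"
    and n: "[n] \<cdot> \<one> \<in> Units R"
  shows "\<one>\<^bsub>P\<^esub> \<in> J"
proof -
  interpret J: ideal J P by (rule J)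
  note [simp] = J.Icarr[OF mem(1)] J.Icarr[OF mem(2)] k w z
  have "euler (xn_minus_one n) = (euler g \<otimes>\<^bsub>P\<^esub> h \<oplus>\<^bsub>P\<^esub> g \<otimes>\<^bsub>P\<^esub> euler h) \<otimes>\<^bsub>P\<^esub> k
      \<oplus>\<^bsub>P\<^esub> g \<otimes>\<^bsub>P\<^esub> h \<otimes>\<^bsub>P\<^esub> euler k \<oplus>\<^bsub>P\<^esub> (\<zero>\<^bsub>P\<^esub> \<otimes>\<^bsub>P\<^esub> w \<oplus>\<^bsub>P\<^esub> const z \<otimes>\<^bsub>P\<^esub> euler w)"
    unfolding eq by (simp add: euler_add euler_mult euler_const)
  also have "\<dots> \<in> J"
    using mem by (simp add: J.I_l_closed J.I_r_closed)
  finally have 1: "const ([n] \<cdot> \<one>) \<otimes>\<^bsub>P\<^esub> monom P \<one> n \<in> J"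
    by (simp only: euler_xn_minus_one)
  have 2: "xn_minus_one n \<in> J"
    unfolding eq using mem by (simp add: J.I_l_closed J.I_r_closed)
  let ?u = "const (inv ([n] \<cdot> \<one>))" and ?v = "const ([n] \<cdot> \<one>)"
  have uv: "?u \<otimes>\<^bsub>P\<^esub> ?v = \<one>\<^bsub>P\<^esub>"
    using n by (simp add: const_mult_const)
  have cl: "?u \<in> carrier P" "?v \<in> carrier P" "monom P \<one> n \<in> carrier P"
    using n by simp_all
  have "?u \<otimes>\<^bsub>P\<^esub> (?v \<otimes>\<^bsub>P\<^esub> monom P \<one> n) \<ominus>\<^bsub>P\<^esub> xn_minus_one n
      = (?u \<otimes>\<^bsub>P\<^esub> ?v) \<otimes>\<^bsub>P\<^esub> monom P \<one> n \<ominus>\<^bsub>P\<^esub> xn_minus_one n"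
    using cl by (simp only: P.m_assoc)
  also have "\<dots> = monom P \<one> n \<ominus>\<^bsub>P\<^esub> xn_minus_one n"
    unfolding uv using cl by simp
  also have "\<dots> = \<one>\<^bsub>P\<^esub>"
    using cl(3) by algebra
  finally show ?thesis
    using J.minus_mem[OF J.I_l_closed[OF 1 cl(1)] 2] by simp
qed

end

text \<open>Locality with maximal ideal \<open>(c)\<close> is stated by divisibility, so reduction
  modulo \<open>c\<close> takes place inside \<open>R\<close> and \<open>P\<close>. The element
  \<open>c\<close> may be nilpotent; over the prime field it is 0.\<close>

locale local_UP = UP_cring +
  fixes c
  assumes c_closed [simp]: "c \<in> carrier R"
    and c_not_unit: "c \<notin> Units R"
    and local: "x \<in> carrier R \<Longrightarrow> \<not> c divides x \<Longrightarrow> x \<in> Units R"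
begin

lemma c_not_dvd_one: "\<not> c divides \<one>"
  using c_not_unit unfolding factor_def Units_def by (auto simp: R.m_comm)

lemma one_not_zero: "\<one> \<noteq> \<zero>"
  using c_not_dvd_one R.r_null[of c] unfolding factor_def by (metis R.zero_closed c_closed)

text \<open>\<open>c\<close> lies in the Jacobson radical; this is the form in which locality enters
  \<open>nakayama\<close>.\<close>

lemma one_minus_c_mult_unit:
  assumes "a \<in> carrier R"
  shows "\<one> \<ominus> c \<otimes> a \<in> Units R"
proof (rule local)
  show "\<not> c divides (\<one> \<ominus> c \<otimes> a)"
  proof
    assume "c divides (\<one> \<ominus> c \<otimes> a)"
    then have "c divides \<one>"
      using assms divides_diff[of c \<one> "\<ominus> (c \<otimes> a)"]
      by (auto simp: R.minus_eq factor_def R.r_minus[symmetric])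
    then show False using c_not_dvd_one by simp
  qed
qed (use assms in simp)

text \<open>The last coefficient not divisible by \<open>c\<close> is a unit. Everything above it is
  a multiple of \<open>c\<close> and is dropped, and the rest is divided by that unit. The final
  clause, that no degree bound of \<open>f\<close> is lost, drives the minimality argument of
  \<open>ideal_monic_generator\<close>.\<close>

lemma monic_representative:
  assumes f: "f \<in> carrier P" and nd: "\<not> const c divides\<^bsub>P\<^esub> f"
  obtains a w g m where "a \<in> carrier R" "w \<in> carrier P" "monic g m"
    "g = const a \<otimes>\<^bsub>P\<^esub> f \<oplus>\<^bsub>P\<^esub> const c \<otimes>\<^bsub>P\<^esub> w" "\<forall>N. deg_below f N \<longrightarrow> m < N"
proof -
  define D where "D = {i. \<not> c divides coeff P f i}"
  have c0: "c divides \<zero>" unfolding factor_def by (intro bexI[of _ \<zero>]) simp_all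
  have below: "D \<subseteq> {..<N}" if "deg_below f N" for N
    using that c0 by (force simp: D_def deg_below_def not_le[symmetric])
  obtain N where "deg_below f N" using deg_below_ex f by blast
  then have "finite D" using below finite_subset by blast
  have "D \<noteq> {}" using nd const_divides_iff f by (auto simp: D_def)
  define m where "m = Max D"
  have m: "m \<in> D" unfolding m_def using \<open>finite D\<close> \<open>D \<noteq> {}\<close> by (rule Max_in)
  have above: "c divides coeff P f i" if "i > m" for i
    using that Max_ge[OF \<open>finite D\<close>, of i] by (auto simp: m_def D_def)
  have u: "coeff P f m \<in> Units R" using m f local by (simp add: D_def)
  define a where "a = inv (coeff P f m)"
  have a: "a \<in> carrier R" "a \<otimes> coeff P f m = \<one>" using u by (simp_all add: a_def)
  obtain f1 where f1: "deg_below f1 (Suc m)"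
    "\<And>i. coeff P f1 i = (if i < Suc m then coeff P f i else \<zero>)"
    using truncation[OF f] by blast
  have f1P: "f1 \<in> carrier P" using f1(1) by auto
  have "const c divides\<^bsub>P\<^esub> (f1 \<ominus>\<^bsub>P\<^esub> f)"
  proof -
    have "c divides coeff P (f1 \<ominus>\<^bsub>P\<^esub> f) i" for i
    proof (cases "i < Suc m")
      case True
      then show ?thesis using f f1P c0 by (simp add: coeff_minus f1(2) R.minus_eq R.r_neg)
    next
      case False
      then obtain x where "x \<in> carrier R" "coeff P f i = c \<otimes> x"
        using above[of i] unfolding factor_def by auto
      then show ?thesis using f f1P False
        by (auto simp: coeff_minus f1(2) R.minus_eq factor_def R.r_minus[symmetric])
    qed
    then show ?thesis using const_divides_iff f f1P by simp
  qed
  then obtain w where w: "w \<in> carrier P" "f1 \<ominus>\<^bsub>P\<^esub> f = const c \<otimes>\<^bsub>P\<^esub> w"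
    unfolding factor_def by blast
  have f1_eq: "f1 = f \<oplus>\<^bsub>P\<^esub> const c \<otimes>\<^bsub>P\<^esub> w"
    unfolding w(2)[symmetric] using f f1P by algebra
  have "monic (const a \<otimes>\<^bsub>P\<^esub> f1) m"
    using f1 f1P a by (simp add: monic_def deg_below_def del: coeff_mult)
  moreover have "const a \<in> carrier P" "const c \<in> carrier P" using a by simp_all
  then have "const a \<otimes>\<^bsub>P\<^esub> f1 = const a \<otimes>\<^bsub>P\<^esub> f \<oplus>\<^bsub>P\<^esub> const c \<otimes>\<^bsub>P\<^esub> (const a \<otimes>\<^bsub>P\<^esub> w)"
    unfolding f1_eq using f w(1) by algebra
  moreover have "\<forall>N. deg_below f N \<longrightarrow> m < N" using below m by auto
  ultimately show ?thesis using that[of a "const a \<otimes>\<^bsub>P\<^esub> w"] a w(1) by simp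
qed

text \<open>Mimics the principal ideal argument over the residue field: take a monic member of least
  degree and divide by it. A remainder not divisible by \<open>c\<close> would yield, by
  \<open>monic_representative\<close>, a monic member of smaller degree.\<close>

lemma ideal_monic_generator:
  assumes I: "ideal I P" and cI: "const c \<in> I" and f: "f \<in> I" "\<not> const c divides\<^bsub>P\<^esub> f"
  obtains g m where "monic g m" "g \<in> I" "I = Idl\<^bsub>P\<^esub> {g, const c}"
    "\<And>h k. h \<in> I \<Longrightarrow> monic h k \<Longrightarrow> m \<le> k"
proof -
  interpret I: ideal I P by (rule I)
  have lower: "\<exists>g\<in>I. \<exists>m. monic g m \<and> (\<forall>N. deg_below h N \<longrightarrow> m < N)"
    if h: "h \<in> I" "\<not> const c divides\<^bsub>P\<^esub> h" for h
  proof -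
    obtain a w g m where g: "a \<in> carrier R" "w \<in> carrier P" "monic g m"
      "g = const a \<otimes>\<^bsub>P\<^esub> h \<oplus>\<^bsub>P\<^esub> const c \<otimes>\<^bsub>P\<^esub> w" "\<forall>N. deg_below h N \<longrightarrow> m < N"
      by (rule monic_representative[OF I.Icarr[OF h(1)] h(2)])
    have "g \<in> I" unfolding g(4) using g(1,2) cI h(1) by (simp add: I.I_l_closed I.I_r_closed)
    then show ?thesis using g(3,5) by blast
  qed
  define m where "m = (LEAST m. \<exists>g\<in>I. monic g m)"
  have "\<exists>m. \<exists>g\<in>I. monic g m" using lower[OF f] by blast
  then have "\<exists>g\<in>I. monic g m" unfolding m_def by (rule LeastI_ex)
  then obtain g where g: "g \<in> I" "monic g m" by blast
  have min: "m \<le> k" if "h \<in> I" "monic h k" for h k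
    unfolding m_def using that by (intro Least_le) blast
  have gP: "g \<in> carrier P" and cP: "const c \<in> carrier P" using I.Icarr g(1) by simp_all
  have "h \<in> Idl\<^bsub>P\<^esub> {g, const c}" if h: "h \<in> I" for h
  proof -
    have hP: "h \<in> carrier P" using I.Icarr h by simp
    obtain q where q: "q \<in> carrier P" "deg_below (h \<ominus>\<^bsub>P\<^esub> q \<otimes>\<^bsub>P\<^esub> g) m"
      using monic_division[OF g(2) hP] by blast
    have rI: "h \<ominus>\<^bsub>P\<^esub> q \<otimes>\<^bsub>P\<^esub> g \<in> I"
      using h g(1) q(1) by (intro I.minus_mem I.I_l_closed)
    have "const c divides\<^bsub>P\<^esub> (h \<ominus>\<^bsub>P\<^esub> q \<otimes>\<^bsub>P\<^esub> g)"
    proof (rule ccontr)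
      assume "\<not> ?thesis"
      from lower[OF rI this] obtain g' k where "g' \<in> I" "monic g' k" "k < m"
        using q(2) by auto
      then show False using min[of g' k] by simp
    qed
    then obtain w where w: "w \<in> carrier P" "h \<ominus>\<^bsub>P\<^esub> q \<otimes>\<^bsub>P\<^esub> g = const c \<otimes>\<^bsub>P\<^esub> w"
      unfolding factor_def by blast
    interpret K: ideal "Idl\<^bsub>P\<^esub> {g, const c}" P using gP cP by (intro P.genideal_ideal) simp
    have "g \<in> Idl\<^bsub>P\<^esub> {g, const c}" "const c \<in> Idl\<^bsub>P\<^esub> {g, const c}"
      using P.genideal_self[of "{g, const c}"] gP cP by auto
    then show ?thesis
      using K.mem_diffD[OF hP, of "q \<otimes>\<^bsub>P\<^esub> g"] w q(1)
      by (simp add: K.I_l_closed K.I_r_closed)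
  qed
  moreover have "Idl\<^bsub>P\<^esub> {g, const c} \<subseteq> I"
    using g(1) cI by (intro P.genideal_minimal I) simp
  ultimately have "I = Idl\<^bsub>P\<^esub> {g, const c}" by blast
  then show ?thesis using that g min by blast
qed

text \<open>Division by \<open>f\<close> shows that \<open>P\<close> modulo \<open>J\<close> is
  generated over \<open>R\<close> by 1, ..., X^(d-1), and 1 in J + (c) makes this module equal to
  \<open>c\<close> times itself. The usual determinant is replaced by an elimination of
  generators.\<close>

lemma nakayama:
  assumes f: "monic f d" and J: "ideal J P" and fJ: "f \<in> J"
    and one: "j \<in> J" "w \<in> carrier P" "\<one>\<^bsub>P\<^esub> = j \<oplus>\<^bsub>P\<^esub> const c \<otimes>\<^bsub>P\<^esub> w"
  shows "J = carrier P"
proof -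
  interpret J: ideal J P by (rule J)
  have peel: "deg_below (s \<ominus>\<^bsub>P\<^esub> const (coeff P s e) \<otimes>\<^bsub>P\<^esub> monom P \<one> e) e"
    if s: "deg_below s (Suc e)" for s e
  proof -
    have sP: "s \<in> carrier P" using s by auto
    have "coeff P s i = \<zero>" if "i > e" for i using s that by (simp add: deg_below_def)
    then show ?thesis
      using sP by (auto simp: deg_below_def coeff_minus R.minus_eq R.r_neg simp del: coeff_mult)
  qed
  \<comment> \<open>The monomials \<open>X^(d-1), ..., X, 1\<close>, which generate the quotient by \<open>J\<close>, are eliminated one by one.\<close>
  have "\<exists>j\<in>J. deg_below (h \<ominus>\<^bsub>P\<^esub> j) (d - k)" if "k \<le> d" "h \<in> carrier P" for k h
    using that
  proof (induction k arbitrary: h)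
    case 0
    then obtain q where q: "q \<in> carrier P" "deg_below (h \<ominus>\<^bsub>P\<^esub> q \<otimes>\<^bsub>P\<^esub> f) d"
      using monic_division[OF f] by blast
    then show ?case using fJ J.I_l_closed by auto
  next
    case (Suc k)
    define e where "e = d - Suc k"
    have e: "d - k = Suc e" using Suc.prems by (simp add: e_def)
    let ?x = "monom P \<one> e"
    have xP: "?x \<in> carrier P" and cP: "const c \<in> carrier P" by simp_all
    have jP: "j \<in> carrier P" using one(1) J.Icarr by simp
    \<comment> \<open>The hypothesis reduces X^e w modulo \<open>J\<close> to degree at most
      \<open>e\<close>. With 1 = j + c w, the monomial X^e is then congruent modulo \<open>J\<close>
      to \<open>c\<close> times a polynomial of degree at most \<open>e\<close>.\<close>
    obtain j1 where j1: "j1 \<in> J" "deg_below (?x \<otimes>\<^bsub>P\<^esub> w \<ominus>\<^bsub>P\<^esub> j1) (Suc e)"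
      using Suc.IH[of "?x \<otimes>\<^bsub>P\<^esub> w"] Suc.prems one(2) e by auto
    have j1P: "j1 \<in> carrier P" using j1(1) J.Icarr by simp
    define s where "s = ?x \<otimes>\<^bsub>P\<^esub> w \<ominus>\<^bsub>P\<^esub> j1"
    define a where "a = coeff P s e"
    have sP: "s \<in> carrier P" using xP one(2) j1P by (simp add: s_def)
    have aR: "a \<in> carrier R" using sP by (simp add: a_def)
    define s' where "s' = s \<ominus>\<^bsub>P\<^esub> const a \<otimes>\<^bsub>P\<^esub> ?x"
    have s': "deg_below s' e" unfolding s'_def a_def
      using j1(2) by (intro peel) (simp add: s_def)
    have s'P: "s' \<in> carrier P" using s' by auto
    \<comment> \<open>Collecting the X^e terms on one side leaves the factor 1 - c a. It is
      invertible, so X^e becomes congruent to the polynomial \<open>s3\<close> of degree below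
      \<open>e\<close>.\<close>
    define u where "u = \<one> \<ominus> c \<otimes> a"
    have u: "u \<in> Units R" unfolding u_def by (rule one_minus_c_mult_unit[OF aR])
    have aP: "const a \<in> carrier P" using aR by simp
    have const_u: "const u = \<one>\<^bsub>P\<^esub> \<ominus>\<^bsub>P\<^esub> const c \<otimes>\<^bsub>P\<^esub> const a"
      using aR by (simp add: u_def const_mult_const R.minus_eq P.minus_eq)
    have "?x = ?x \<otimes>\<^bsub>P\<^esub> (j \<oplus>\<^bsub>P\<^esub> const c \<otimes>\<^bsub>P\<^esub> w)"
      using xP by (simp flip: one(3))
    also have "\<dots> = (?x \<otimes>\<^bsub>P\<^esub> j \<oplus>\<^bsub>P\<^esub> const c \<otimes>\<^bsub>P\<^esub> j1)
        \<oplus>\<^bsub>P\<^esub> const c \<otimes>\<^bsub>P\<^esub> (?x \<otimes>\<^bsub>P\<^esub> w \<ominus>\<^bsub>P\<^esub> j1)"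
      using xP jP cP one(2) j1P by algebra
    finally have x_eq: "?x = (?x \<otimes>\<^bsub>P\<^esub> j \<oplus>\<^bsub>P\<^esub> const c \<otimes>\<^bsub>P\<^esub> j1) \<oplus>\<^bsub>P\<^esub> const c \<otimes>\<^bsub>P\<^esub> s"
      by (simp only: s_def)
    define j2 where "j2 = ?x \<otimes>\<^bsub>P\<^esub> j \<oplus>\<^bsub>P\<^esub> const c \<otimes>\<^bsub>P\<^esub> j1"
    have j2: "j2 \<in> J" using one(1) j1(1) xP cP by (simp add: j2_def J.I_l_closed)
    have j2P: "j2 \<in> carrier P" using j2 J.Icarr by simp
    have "const u \<otimes>\<^bsub>P\<^esub> ?x = ?x \<ominus>\<^bsub>P\<^esub> const c \<otimes>\<^bsub>P\<^esub> (const a \<otimes>\<^bsub>P\<^esub> ?x)"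
      unfolding const_u using xP cP aP by algebra
    also have "\<dots> = (j2 \<oplus>\<^bsub>P\<^esub> const c \<otimes>\<^bsub>P\<^esub> s) \<ominus>\<^bsub>P\<^esub> const c \<otimes>\<^bsub>P\<^esub> (const a \<otimes>\<^bsub>P\<^esub> ?x)"
      using x_eq by (simp only: j2_def)
    also have "\<dots> = j2 \<oplus>\<^bsub>P\<^esub> const c \<otimes>\<^bsub>P\<^esub> s'"
      unfolding s'_def using j2P cP sP aP xP by algebra
    finally have ux: "const u \<otimes>\<^bsub>P\<^esub> ?x = j2 \<oplus>\<^bsub>P\<^esub> const c \<otimes>\<^bsub>P\<^esub> s'" .
    define v where "v = const (inv u)"
    have vP: "v \<in> carrier P" using u by (simp add: v_def)
    have uP: "const u \<in> carrier P" using u by (simp add: R.Units_closed)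
    have "v \<otimes>\<^bsub>P\<^esub> const u = \<one>\<^bsub>P\<^esub>" using u by (simp add: v_def const_mult_const R.Units_closed)
    then have "?x = v \<otimes>\<^bsub>P\<^esub> (const u \<otimes>\<^bsub>P\<^esub> ?x)"
      using vP uP xP by (simp flip: P.m_assoc)
    then have x: "?x = v \<otimes>\<^bsub>P\<^esub> j2 \<oplus>\<^bsub>P\<^esub> v \<otimes>\<^bsub>P\<^esub> (const c \<otimes>\<^bsub>P\<^esub> s')"
      unfolding ux using vP j2P cP s'P by (simp add: P.r_distr)
    define j3 where "j3 = v \<otimes>\<^bsub>P\<^esub> j2"
    have j3: "j3 \<in> J" using vP j2 by (simp add: j3_def J.I_l_closed)
    have j3P: "j3 \<in> carrier P" using j3 J.Icarr by simp
    define s3 where "s3 = v \<otimes>\<^bsub>P\<^esub> (const c \<otimes>\<^bsub>P\<^esub> s')"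
    have s3: "deg_below s3 e"
      using s' s'P u by (simp add: s3_def v_def deg_below_def del: coeff_mult)
    have s3P: "s3 \<in> carrier P" using s3 by auto
    \<comment> \<open>An arbitrary \<open>h\<close> is first reduced to degree at most
      \<open>e\<close>; then its X^e term is rewritten with X^e = j3 + s3, and the multiple of
      \<open>j3\<close> is absorbed by \<open>J\<close>.\<close>
    obtain j4 where j4: "j4 \<in> J" "deg_below (h \<ominus>\<^bsub>P\<^esub> j4) (Suc e)"
      using Suc.IH[of h] Suc.prems e by auto
    have j4P: "j4 \<in> carrier P" using j4(1) J.Icarr by simp
    define b where "b = coeff P (h \<ominus>\<^bsub>P\<^esub> j4) e"
    have bP: "const b \<in> carrier P" using j4P Suc.prems by (simp add: b_def)
    have hP: "h \<in> carrier P" by (rule Suc.prems)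
    have b: "deg_below (h \<ominus>\<^bsub>P\<^esub> j4 \<ominus>\<^bsub>P\<^esub> const b \<otimes>\<^bsub>P\<^esub> ?x) e"
      unfolding b_def by (rule peel[OF j4(2)])
    have "h \<ominus>\<^bsub>P\<^esub> (j4 \<oplus>\<^bsub>P\<^esub> const b \<otimes>\<^bsub>P\<^esub> j3)
        = (h \<ominus>\<^bsub>P\<^esub> j4 \<ominus>\<^bsub>P\<^esub> const b \<otimes>\<^bsub>P\<^esub> (j3 \<oplus>\<^bsub>P\<^esub> s3)) \<oplus>\<^bsub>P\<^esub> const b \<otimes>\<^bsub>P\<^esub> s3"
      using hP j4P bP j3P s3P by algebra
    also have "j3 \<oplus>\<^bsub>P\<^esub> s3 = ?x" using x by (simp only: j3_def s3_def)
    finally have eq: "h \<ominus>\<^bsub>P\<^esub> (j4 \<oplus>\<^bsub>P\<^esub> const b \<otimes>\<^bsub>P\<^esub> j3)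
        = (h \<ominus>\<^bsub>P\<^esub> j4 \<ominus>\<^bsub>P\<^esub> const b \<otimes>\<^bsub>P\<^esub> ?x) \<oplus>\<^bsub>P\<^esub> const b \<otimes>\<^bsub>P\<^esub> s3" .
    have bR: "b \<in> carrier R" using hP j4P by (simp add: b_def)
    have "deg_below (const b \<otimes>\<^bsub>P\<^esub> s3) e"
      using s3 s3P bR by (simp add: deg_below_def del: coeff_mult)
    then have "deg_below (h \<ominus>\<^bsub>P\<^esub> (j4 \<oplus>\<^bsub>P\<^esub> const b \<otimes>\<^bsub>P\<^esub> j3)) e"
      unfolding eq using b by (rule deg_below_add[rotated])
    moreover have "j4 \<oplus>\<^bsub>P\<^esub> const b \<otimes>\<^bsub>P\<^esub> j3 \<in> J"
      using j4(1) j3 bP by (simp add: J.I_l_closed)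
    ultimately show ?case by (auto simp: e_def)
  qed
  from this[of d "\<one>\<^bsub>P\<^esub>"] obtain i where i: "i \<in> J" "deg_below (\<one>\<^bsub>P\<^esub> \<ominus>\<^bsub>P\<^esub> i) 0" by auto
  then have "\<one>\<^bsub>P\<^esub> \<ominus>\<^bsub>P\<^esub> i = \<zero>\<^bsub>P\<^esub>" by (simp add: deg_below_0_iff)
  then have "\<one>\<^bsub>P\<^esub> \<in> J" using J.mem_diffD[of "\<one>\<^bsub>P\<^esub>" i] i(1) by simp
  then show ?thesis by (rule J.one_imp_carrier)
qed

end

section \<open>Hensel lifting\<close>

context cring
begin

lemma divides_add:
  "\<lbrakk>z divides x; z divides y; z \<in> carrier R\<rbrakk> \<Longrightarrow> z divides (x \<oplus> y)"
  unfolding factor_def by (metis r_distr a_closed)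

lemma divides_minus:
  "\<lbrakk>z divides x; z divides y; z \<in> carrier R\<rbrakk> \<Longrightarrow> z divides (x \<ominus> y)"
  unfolding factor_def a_minus_def by (metis r_distr r_minus a_closed a_inv_closed)

lemma divides_mult_r:
  "\<lbrakk>z divides x; z \<in> carrier R; y \<in> carrier R\<rbrakk> \<Longrightarrow> z divides (x \<otimes> y)"
  unfolding factor_def by (metis m_assoc m_closed)

lemma divides_mult_self: "\<lbrakk>z \<in> carrier R; y \<in> carrier R\<rbrakk> \<Longrightarrow> z divides (z \<otimes> y)"
  unfolding factor_def by blast

lemma divides_zero: "z \<in> carrier R \<Longrightarrow> z divides \<zero>"
  unfolding factor_def by (metis r_null zero_closed)

lemma divides_pow_Suc:
  assumes "z \<in> carrier R" "z [^] Suc k divides x"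
  shows "z [^] k divides x"
proof -
  obtain y where "y \<in> carrier R" "x = z [^] Suc k \<otimes> y"
    using assms(2) unfolding factor_def by blast
  then have "x = z [^] k \<otimes> (z \<otimes> y)" using assms(1) by (simp add: m_assoc)
  then show ?thesis using assms(1) \<open>y \<in> carrier R\<close> unfolding factor_def by blast
qed

end

lemma (in UP_cring) const_divides_pow_Suc:
  assumes "z \<in> carrier R" "f \<in> carrier P" "const (z [^] Suc k) divides\<^bsub>P\<^esub> f"
  shows "const (z [^] k) divides\<^bsub>P\<^esub> f"
  using assms R.divides_pow_Suc[OF assms(1)] by (simp only: const_divides_iff R.nat_pow_closed) blast

context local_UP
begin

lemma const_c_closed [simp]: "const c \<in> carrier P"
  by simp

lemma monic_not_const_c_divides: "monic f d \<Longrightarrow> \<not> const c divides\<^bsub>P\<^esub> f"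
  using const_divides_coeff[of c f d] c_not_dvd_one by (auto simp: monic_def)

text \<open>One linear step: if \<open>f - g h = b e\<close>, then g + b t and h + b s have error b
  (e - g s - t h) - b^2 s t. The first part is divisible by \<open>b c\<close> once g s + t h agrees
  with \<open>e\<close> modulo \<open>c\<close>, the second because \<open>b\<close> is a multiple
  of \<open>c\<close>. The cofactors \<open>u\<close> and \<open>v\<close> stay fixed through all
  steps; only \<open>w\<close> changes.\<close>

lemma hensel_step:
  assumes f: "monic f (m + l)" and g: "monic g m" and h: "monic h l"
    and d: "d \<in> carrier R" "b = c \<otimes> d" and dvd: "const b divides\<^bsub>P\<^esub> (f \<ominus>\<^bsub>P\<^esub> g \<otimes>\<^bsub>P\<^esub> h)"
    and uvw: "u \<in> carrier P" "v \<in> carrier P" "w \<in> carrier P"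
      "u \<otimes>\<^bsub>P\<^esub> g \<oplus>\<^bsub>P\<^esub> (v \<otimes>\<^bsub>P\<^esub> h \<oplus>\<^bsub>P\<^esub> w \<otimes>\<^bsub>P\<^esub> const c) = \<one>\<^bsub>P\<^esub>"
  obtains g' h' w' where "monic g' m" "monic h' l"
    "const b divides\<^bsub>P\<^esub> (g' \<ominus>\<^bsub>P\<^esub> g)" "const b divides\<^bsub>P\<^esub> (h' \<ominus>\<^bsub>P\<^esub> h)"
    "const (b \<otimes> c) divides\<^bsub>P\<^esub> (f \<ominus>\<^bsub>P\<^esub> g' \<otimes>\<^bsub>P\<^esub> h')" "w' \<in> carrier P"
    "u \<otimes>\<^bsub>P\<^esub> g' \<oplus>\<^bsub>P\<^esub> (v \<otimes>\<^bsub>P\<^esub> h' \<oplus>\<^bsub>P\<^esub> w' \<otimes>\<^bsub>P\<^esub> const c) = \<one>\<^bsub>P\<^esub>"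
proof -
  have bR: "b \<in> carrier R" using d by simp
  have fP: "f \<in> carrier P" and gP: "g \<in> carrier P" and hP: "h \<in> carrier P"
    using f g h by auto
  let ?C = "const c" and ?B = "const b" and ?D = "const d"
  have CP: "?C \<in> carrier P" and BP: "?B \<in> carrier P" and DP: "?D \<in> carrier P"
    using bR d by simp_all
  have B_eq: "?B = ?C \<otimes>\<^bsub>P\<^esub> ?D" using d by (simp add: const_mult_const)
  have "deg_below (f \<ominus>\<^bsub>P\<^esub> g \<otimes>\<^bsub>P\<^esub> h) (m + l)"
    by (rule deg_below_monic_minus[OF f monic_mult[OF g h]])
  then obtain e where e: "deg_below e (m + l)" "f \<ominus>\<^bsub>P\<^esub> g \<otimes>\<^bsub>P\<^esub> h = ?B \<otimes>\<^bsub>P\<^esub> e"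
    using const_divides_deg_below[OF bR] const_divides_coeff[OF bR dvd] by metis
  have eP: "e \<in> carrier P" using e by auto
  obtain q where q: "q \<in> carrier P" "deg_below (e \<otimes>\<^bsub>P\<^esub> v \<ominus>\<^bsub>P\<^esub> q \<otimes>\<^bsub>P\<^esub> g) m"
    using monic_division[OF g, of "e \<otimes>\<^bsub>P\<^esub> v"] eP uvw by auto
  \<comment> \<open>\<open>t\<close> is \<open>e v\<close> reduced modulo \<open>g\<close>, and
    \<open>s0\<close> takes the compensating multiple of \<open>h\<close>. Thus s0 g + t h = e (u g
    + v h), which is \<open>e\<close> up to a multiple of \<open>c\<close>.\<close>
  define t where "t = e \<otimes>\<^bsub>P\<^esub> v \<ominus>\<^bsub>P\<^esub> q \<otimes>\<^bsub>P\<^esub> g"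
  define s0 where "s0 = e \<otimes>\<^bsub>P\<^esub> u \<oplus>\<^bsub>P\<^esub> q \<otimes>\<^bsub>P\<^esub> h"
  have t: "deg_below t m" using q by (simp add: t_def)
  have tP: "t \<in> carrier P" using t by auto
  have s0P: "s0 \<in> carrier P" using eP uvw q hP by (simp add: s0_def)
  have "s0 \<otimes>\<^bsub>P\<^esub> g = e \<otimes>\<^bsub>P\<^esub> (u \<otimes>\<^bsub>P\<^esub> g \<oplus>\<^bsub>P\<^esub> (v \<otimes>\<^bsub>P\<^esub> h \<oplus>\<^bsub>P\<^esub> w \<otimes>\<^bsub>P\<^esub> ?C))
      \<ominus>\<^bsub>P\<^esub> t \<otimes>\<^bsub>P\<^esub> h \<ominus>\<^bsub>P\<^esub> ?C \<otimes>\<^bsub>P\<^esub> (e \<otimes>\<^bsub>P\<^esub> w)"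
    unfolding s0_def t_def using eP uvw(1-3) q(1) hP gP CP by algebra
  then have s0g: "s0 \<otimes>\<^bsub>P\<^esub> g = (e \<ominus>\<^bsub>P\<^esub> t \<otimes>\<^bsub>P\<^esub> h) \<ominus>\<^bsub>P\<^esub> ?C \<otimes>\<^bsub>P\<^esub> (e \<otimes>\<^bsub>P\<^esub> w)"
    unfolding uvw(4) using eP by simp
  have th: "deg_below (e \<ominus>\<^bsub>P\<^esub> t \<otimes>\<^bsub>P\<^esub> h) (m + l)"
  proof (rule deg_below_minus[OF e(1)])
    have "deg_below (h \<otimes>\<^bsub>P\<^esub> t) (l + m)"
      by (rule deg_below_mult) (use h t in \<open>auto simp: monic_def\<close>)
    then show "deg_below (t \<otimes>\<^bsub>P\<^esub> h) (m + l)"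
      using hP tP by (simp add: P.m_comm add.commute)
  qed
  \<comment> \<open>\<open>s0\<close> may have large degree, but modulo \<open>c\<close> its product
    with the monic \<open>g\<close> equals e - t h, of degree below \<open>m + l\<close>. So its
    coefficients from \<open>l\<close> on are divisible by \<open>c\<close>, and truncating them
    keeps \<open>h\<close> monic of degree \<open>l\<close>.\<close>
  have s0c: "c divides coeff P s0 i" if "l \<le> i" for i
  proof (rule monic_mult_divides_coeff[OF g s0P c_closed _ that])
    fix i assume "l \<le> i"
    have x: "e \<ominus>\<^bsub>P\<^esub> t \<otimes>\<^bsub>P\<^esub> h \<in> carrier P" using eP tP hP by simp
    have "coeff P (e \<ominus>\<^bsub>P\<^esub> t \<otimes>\<^bsub>P\<^esub> h) (i + m) = \<zero>"
      using th \<open>l \<le> i\<close> unfolding deg_below_def by simp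
    then have "coeff P (s0 \<otimes>\<^bsub>P\<^esub> g) (i + m) = \<zero> \<ominus> c \<otimes> coeff P (e \<otimes>\<^bsub>P\<^esub> w) (i + m)"
      unfolding s0g using x eP uvw(3) by (simp add: coeff_minus del: coeff_mult)
    then show "c divides coeff P (s0 \<otimes>\<^bsub>P\<^esub> g) (i + m)"
      using eP uvw(3)
      by (auto intro!: R.divides_minus R.divides_zero R.divides_mult_self simp del: coeff_mult)
  qed
  obtain s where s: "deg_below s l" "\<And>i. coeff P s i = (if i < l then coeff P s0 i else \<zero>)"
    using truncation[OF s0P] by blast
  have sP: "s \<in> carrier P" using s(1) by auto
  have "c divides coeff P (s0 \<ominus>\<^bsub>P\<^esub> s) i" for i
    using s0c[of i] s0P sP by (cases "i < l")
      (auto simp: coeff_minus s(2) R.minus_eq R.r_neg R.divides_zero)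
  then obtain r where r: "r \<in> carrier P" "s0 \<ominus>\<^bsub>P\<^esub> s = ?C \<otimes>\<^bsub>P\<^esub> r"
    using const_divides_iff[of c "s0 \<ominus>\<^bsub>P\<^esub> s"] s0P sP unfolding factor_def by auto
  let ?g = "g \<oplus>\<^bsub>P\<^esub> ?B \<otimes>\<^bsub>P\<^esub> t" and ?h = "h \<oplus>\<^bsub>P\<^esub> ?B \<otimes>\<^bsub>P\<^esub> s"
  \<comment> \<open>Both factors change by multiples of b = c d; this correction of \<open>w\<close>
    restores the Bezout identity exactly.\<close>
  let ?w = "w \<ominus>\<^bsub>P\<^esub> ?D \<otimes>\<^bsub>P\<^esub> (u \<otimes>\<^bsub>P\<^esub> t \<oplus>\<^bsub>P\<^esub> v \<otimes>\<^bsub>P\<^esub> s)"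
  have "e \<ominus>\<^bsub>P\<^esub> g \<otimes>\<^bsub>P\<^esub> s \<ominus>\<^bsub>P\<^esub> t \<otimes>\<^bsub>P\<^esub> h = (e \<ominus>\<^bsub>P\<^esub> t \<otimes>\<^bsub>P\<^esub> h) \<ominus>\<^bsub>P\<^esub> s0 \<otimes>\<^bsub>P\<^esub> g \<oplus>\<^bsub>P\<^esub> (s0 \<ominus>\<^bsub>P\<^esub> s) \<otimes>\<^bsub>P\<^esub> g"
    using eP gP sP tP hP s0P by algebra
  also have "\<dots> = ?C \<otimes>\<^bsub>P\<^esub> (e \<otimes>\<^bsub>P\<^esub> w \<oplus>\<^bsub>P\<^esub> r \<otimes>\<^bsub>P\<^esub> g)"
    unfolding s0g r(2) using eP gP tP hP CP r(1) uvw(3) by algebra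
  finally have lin: "e \<ominus>\<^bsub>P\<^esub> g \<otimes>\<^bsub>P\<^esub> s \<ominus>\<^bsub>P\<^esub> t \<otimes>\<^bsub>P\<^esub> h = ?C \<otimes>\<^bsub>P\<^esub> (e \<otimes>\<^bsub>P\<^esub> w \<oplus>\<^bsub>P\<^esub> r \<otimes>\<^bsub>P\<^esub> g)" .
  have "f \<ominus>\<^bsub>P\<^esub> ?g \<otimes>\<^bsub>P\<^esub> ?h = (f \<ominus>\<^bsub>P\<^esub> g \<otimes>\<^bsub>P\<^esub> h) \<ominus>\<^bsub>P\<^esub> ?B \<otimes>\<^bsub>P\<^esub> (g \<otimes>\<^bsub>P\<^esub> s \<oplus>\<^bsub>P\<^esub> t \<otimes>\<^bsub>P\<^esub> h \<oplus>\<^bsub>P\<^esub> ?B \<otimes>\<^bsub>P\<^esub> (t \<otimes>\<^bsub>P\<^esub> s))"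
    using fP gP hP BP sP tP by algebra
  also have "\<dots> = ?B \<otimes>\<^bsub>P\<^esub> ((e \<ominus>\<^bsub>P\<^esub> g \<otimes>\<^bsub>P\<^esub> s \<ominus>\<^bsub>P\<^esub> t \<otimes>\<^bsub>P\<^esub> h) \<ominus>\<^bsub>P\<^esub> ?B \<otimes>\<^bsub>P\<^esub> (t \<otimes>\<^bsub>P\<^esub> s))"
    unfolding e(2) using eP gP hP BP sP tP by algebra
  also have "\<dots> = ?B \<otimes>\<^bsub>P\<^esub> (?C \<otimes>\<^bsub>P\<^esub> (e \<otimes>\<^bsub>P\<^esub> w \<oplus>\<^bsub>P\<^esub> r \<otimes>\<^bsub>P\<^esub> g) \<ominus>\<^bsub>P\<^esub> (?C \<otimes>\<^bsub>P\<^esub> ?D) \<otimes>\<^bsub>P\<^esub> (t \<otimes>\<^bsub>P\<^esub> s))"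
    unfolding lin by (simp only: B_eq)
  also have "\<dots> = (?B \<otimes>\<^bsub>P\<^esub> ?C) \<otimes>\<^bsub>P\<^esub> (e \<otimes>\<^bsub>P\<^esub> w \<oplus>\<^bsub>P\<^esub> r \<otimes>\<^bsub>P\<^esub> g \<ominus>\<^bsub>P\<^esub> ?D \<otimes>\<^bsub>P\<^esub> (t \<otimes>\<^bsub>P\<^esub> s))"
    using eP gP BP CP DP sP tP r(1) uvw(3) by algebra
  finally have "const (b \<otimes> c) divides\<^bsub>P\<^esub> (f \<ominus>\<^bsub>P\<^esub> ?g \<otimes>\<^bsub>P\<^esub> ?h)"
    using const_mult_const[OF bR c_closed] bR eP gP DP sP tP r(1) uvw(3) BP
    by (simp add: P.divides_mult_self)
  moreover have "monic ?g m" "monic ?h l"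
    using g h t s(1) bR tP sP by (auto intro!: monic_add simp: deg_below_def simp del: coeff_mult)
  moreover have "?g \<ominus>\<^bsub>P\<^esub> g = ?B \<otimes>\<^bsub>P\<^esub> t" "?h \<ominus>\<^bsub>P\<^esub> h = ?B \<otimes>\<^bsub>P\<^esub> s"
    using gP hP BP tP sP by algebra+
  then have "?B divides\<^bsub>P\<^esub> (?g \<ominus>\<^bsub>P\<^esub> g)" "?B divides\<^bsub>P\<^esub> (?h \<ominus>\<^bsub>P\<^esub> h)"
    using BP tP sP by (simp_all add: P.divides_mult_self)
  moreover have "?w \<in> carrier P" using uvw(1-3) DP tP sP by simp
  moreover have "u \<otimes>\<^bsub>P\<^esub> ?g \<oplus>\<^bsub>P\<^esub> (v \<otimes>\<^bsub>P\<^esub> ?h \<oplus>\<^bsub>P\<^esub> ?w \<otimes>\<^bsub>P\<^esub> ?C)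
      = u \<otimes>\<^bsub>P\<^esub> g \<oplus>\<^bsub>P\<^esub> (v \<otimes>\<^bsub>P\<^esub> h \<oplus>\<^bsub>P\<^esub> w \<otimes>\<^bsub>P\<^esub> ?C)"
    unfolding B_eq using uvw(1-3) gP hP CP DP tP sP by algebra
  ultimately show ?thesis using that uvw(4) by metis
qed

end

text \<open>Limits are taken in the form that a Hensel iteration produces: consecutive terms agree
  modulo c^k, and the limit agrees with the k-th term to the same precision.\<close>

locale complete_local_UP = local_UP +
  assumes separated: "x \<in> carrier R \<Longrightarrow> (\<And>k::nat. c [^] k divides x) \<Longrightarrow> x = \<zero>"
    and complete: "(\<And>k. X k \<in> carrier R) \<Longrightarrow> (\<And>k::nat. c [^] k divides (X (Suc k) \<ominus> X k)) \<Longrightarrow>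
      \<exists>y\<in>carrier R. \<forall>k. c [^] k divides (y \<ominus> X k)"
begin

lemma poly_separated:
  assumes "f \<in> carrier P" "\<And>k::nat. const (c [^] k) divides\<^bsub>P\<^esub> f"
  shows "f = \<zero>\<^bsub>P\<^esub>"
proof -
  have "coeff P f i = \<zero>" for i
    using const_divides_coeff[OF _ assms(2)] assms(1) by (intro separated) simp_all
  then show ?thesis using assms(1) by (intro up_eqI) simp_all
qed

lemma monic_limit:
  assumes X: "\<And>k. monic (X k) m"
    and step: "\<And>k::nat. const (c [^] k) divides\<^bsub>P\<^esub> (X (Suc k) \<ominus>\<^bsub>P\<^esub> X k)"
  obtains Y where "monic Y m" "\<forall>k::nat. const (c [^] k) divides\<^bsub>P\<^esub> (Y \<ominus>\<^bsub>P\<^esub> X k)"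
proof -
  have XP: "X k \<in> carrier P" for k using X by auto
  have top: "coeff P (X k) i = (if i = m then \<one> else \<zero>)" if "i \<ge> m" for k i
    using X[of k] that by (auto simp: monic_def deg_below_def)
  have "\<exists>y\<in>carrier R. \<forall>k. c [^] k divides (y \<ominus> coeff P (X k) i)" for i
  proof (rule complete)
    show "c [^] k divides (coeff P (X (Suc k)) i \<ominus> coeff P (X k) i)" for k :: nat
      using const_divides_coeff[OF _ step[of k], of i] XP by (simp add: coeff_minus)
  qed (use XP in simp)
  then obtain y where y: "\<And>i. y i \<in> carrier R" "\<And>i k. c [^] (k::nat) divides (y i \<ominus> coeff P (X k) i)"
    by metis
  \<comment> \<open>Limits are taken only below \<open>m\<close>; the leading 1 and the zeros above
    it are prescribed, so that the limit is again monic of degree \<open>m\<close>.\<close>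
  define a where "a i = (if i < m then y i else if i = m then \<one> else \<zero>)" for i
  obtain Y where Y: "deg_below Y (Suc m)" "\<And>i. coeff P Y i = a i"
    by (rule poly_with_coeffs[of a "Suc m"]) (auto simp: a_def y)
  have YP: "Y \<in> carrier P" using Y by auto
  have "c [^] k divides coeff P (Y \<ominus>\<^bsub>P\<^esub> X k) i" for i and k :: nat
    using YP XP y(2)[of k i] top[of i k]
    by (auto simp: coeff_minus Y(2) a_def R.minus_eq R.r_neg R.divides_zero)
  then have "const (c [^] k) divides\<^bsub>P\<^esub> (Y \<ominus>\<^bsub>P\<^esub> X k)" for k :: nat
    using YP XP by (simp add: const_divides_iff)
  moreover have "monic Y m" using Y by (simp add: monic_def a_def)
  ultimately show ?thesis using that by blast
qed

lemma hensel:
  assumes f: "monic f (m + l)" and g: "monic g m" and h: "monic h l"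
    and dvd: "const c divides\<^bsub>P\<^esub> (f \<ominus>\<^bsub>P\<^esub> g \<otimes>\<^bsub>P\<^esub> h)"
    and one: "\<one>\<^bsub>P\<^esub> \<in> Idl\<^bsub>P\<^esub> {g, h, const c}"
  obtains G H where "monic G m" "monic H l" "f = G \<otimes>\<^bsub>P\<^esub> H" "const c divides\<^bsub>P\<^esub> (G \<ominus>\<^bsub>P\<^esub> g)"
proof -
  have fP: "f \<in> carrier P" and gP: "g \<in> carrier P" and hP: "h \<in> carrier P"
    using f g h by auto
  \<comment> \<open>An approximation is a pair of factors. The exponent is \<open>Suc k\<close>
    because the given factorization holds modulo \<open>c\<close> at stage 0. The Bezout identity is
    carried along for the next step, the congruence with \<open>g\<close> for the last claim about
    \<open>G\<close>.\<close>
  define S where "S k x \<longleftrightarrow> monic (fst x) m \<and> monic (snd x) l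
    \<and> const (c [^] Suc k) divides\<^bsub>P\<^esub> (f \<ominus>\<^bsub>P\<^esub> fst x \<otimes>\<^bsub>P\<^esub> snd x)
    \<and> (\<exists>u\<in>carrier P. \<exists>v\<in>carrier P. \<exists>w\<in>carrier P.
        u \<otimes>\<^bsub>P\<^esub> fst x \<oplus>\<^bsub>P\<^esub> (v \<otimes>\<^bsub>P\<^esub> snd x \<oplus>\<^bsub>P\<^esub> w \<otimes>\<^bsub>P\<^esub> const c) = \<one>\<^bsub>P\<^esub>)
    \<and> const c divides\<^bsub>P\<^esub> (fst x \<ominus>\<^bsub>P\<^esub> g)" for k x
  define T where "T k x y \<longleftrightarrow> const (c [^] Suc k) divides\<^bsub>P\<^esub> (fst y \<ominus>\<^bsub>P\<^esub> fst x)
    \<and> const (c [^] Suc k) divides\<^bsub>P\<^esub> (snd y \<ominus>\<^bsub>P\<^esub> snd x)" for k x y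
  have "S 0 (g, h)"
  proof -
    obtain u v w where "u \<in> carrier P" "v \<in> carrier P" "w \<in> carrier P"
      "\<one>\<^bsub>P\<^esub> = u \<otimes>\<^bsub>P\<^esub> g \<oplus>\<^bsub>P\<^esub> (v \<otimes>\<^bsub>P\<^esub> h \<oplus>\<^bsub>P\<^esub> w \<otimes>\<^bsub>P\<^esub> const c)"
      by (rule P.Idl_tripleE[OF one gP hP const_c_closed])
    moreover have "g \<ominus>\<^bsub>P\<^esub> g = \<zero>\<^bsub>P\<^esub>" using gP by (simp add: P.minus_eq P.r_neg)
    ultimately show ?thesis
      using g h dvd by (auto simp: S_def P.divides_zero)
  qed
  moreover have "\<exists>y. S (Suc k) y \<and> T k x y" if S: "S k x" for k x
  proof -
    obtain u v w where uvw: "u \<in> carrier P" "v \<in> carrier P" "w \<in> carrier P"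
      "u \<otimes>\<^bsub>P\<^esub> fst x \<oplus>\<^bsub>P\<^esub> (v \<otimes>\<^bsub>P\<^esub> snd x \<oplus>\<^bsub>P\<^esub> w \<otimes>\<^bsub>P\<^esub> const c) = \<one>\<^bsub>P\<^esub>"
      using S unfolding S_def by blast
    have x: "monic (fst x) m" "monic (snd x) l"
      "const (c [^] Suc k) divides\<^bsub>P\<^esub> (f \<ominus>\<^bsub>P\<^esub> fst x \<otimes>\<^bsub>P\<^esub> snd x)"
      "const c divides\<^bsub>P\<^esub> (fst x \<ominus>\<^bsub>P\<^esub> g)"
      using S by (simp_all add: S_def)
    have b: "c [^] k \<in> carrier R" "c [^] Suc k = c \<otimes> c [^] k"
      by (simp_all add: R.m_comm)
    obtain g' h' w' where gh: "monic g' m" "monic h' l"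
      "const (c [^] Suc k) divides\<^bsub>P\<^esub> (g' \<ominus>\<^bsub>P\<^esub> fst x)" "const (c [^] Suc k) divides\<^bsub>P\<^esub> (h' \<ominus>\<^bsub>P\<^esub> snd x)"
      "const (c [^] Suc k \<otimes> c) divides\<^bsub>P\<^esub> (f \<ominus>\<^bsub>P\<^esub> g' \<otimes>\<^bsub>P\<^esub> h')" "w' \<in> carrier P"
      "u \<otimes>\<^bsub>P\<^esub> g' \<oplus>\<^bsub>P\<^esub> (v \<otimes>\<^bsub>P\<^esub> h' \<oplus>\<^bsub>P\<^esub> w' \<otimes>\<^bsub>P\<^esub> const c) = \<one>\<^bsub>P\<^esub>"
      by (rule hensel_step[OF f x(1,2) b x(3) uvw])
    have cl: "g' \<in> carrier P" "fst x \<in> carrier P" using gh(1) x(1) by auto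
    have "c divides coeff P (g' \<ominus>\<^bsub>P\<^esub> fst x) i" for i
    proof -
      have "c [^] Suc k divides coeff P (g' \<ominus>\<^bsub>P\<^esub> fst x) i"
        by (rule const_divides_coeff[OF _ gh(3)]) simp
      then obtain z where "z \<in> carrier R" "coeff P (g' \<ominus>\<^bsub>P\<^esub> fst x) i = c \<otimes> (c [^] k \<otimes> z)"
        unfolding factor_def b(2) using b(1) by (auto simp: R.m_assoc)
      then show ?thesis by (simp add: R.divides_mult_self)
    qed
    then have "const c divides\<^bsub>P\<^esub> (g' \<ominus>\<^bsub>P\<^esub> fst x)"
      using cl by (simp add: const_divides_iff)
    then have "const c divides\<^bsub>P\<^esub> ((g' \<ominus>\<^bsub>P\<^esub> fst x) \<oplus>\<^bsub>P\<^esub> (fst x \<ominus>\<^bsub>P\<^esub> g))"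
      using x(4) by (rule P.divides_add) simp
    also have "(g' \<ominus>\<^bsub>P\<^esub> fst x) \<oplus>\<^bsub>P\<^esub> (fst x \<ominus>\<^bsub>P\<^esub> g) = g' \<ominus>\<^bsub>P\<^esub> g"
      using cl gP by algebra
    finally have "S (Suc k) (g', h')"
      unfolding S_def using gh uvw by auto
    moreover have "T k x (g', h')" unfolding T_def using gh by auto
    ultimately show ?thesis by blast
  qed
  ultimately obtain z where z: "\<And>k. S k (z k)" "\<And>k. T k (z k) (z (Suc k))"
    using dependent_nat_choice[of S T] by blast
  have mon: "monic (fst (z k)) m" "monic (snd (z k)) l" for k
    using z(1)[of k] by (simp_all add: S_def)
  have cl: "fst (z k) \<in> carrier P" "snd (z k) \<in> carrier P" for k
    using mon[of k] by auto
  \<comment> \<open>One power of \<open>c\<close> is given up to match the exponent in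
    \<open>monic_limit\<close>; the same happens to the second factor and to the error.\<close>
  have step: "const (c [^] k) divides\<^bsub>P\<^esub> (fst (z (Suc k)) \<ominus>\<^bsub>P\<^esub> fst (z k))" for k
    by (rule const_divides_pow_Suc) (use z(2)[of k] cl in \<open>simp_all only: T_def P.minus_closed c_closed\<close>)
  have step': "const (c [^] k) divides\<^bsub>P\<^esub> (snd (z (Suc k)) \<ominus>\<^bsub>P\<^esub> snd (z k))" for k
    by (rule const_divides_pow_Suc) (use z(2)[of k] cl in \<open>simp_all only: T_def P.minus_closed c_closed\<close>)
  have prod: "const (c [^] k) divides\<^bsub>P\<^esub> (f \<ominus>\<^bsub>P\<^esub> fst (z k) \<otimes>\<^bsub>P\<^esub> snd (z k))" for k
    by (rule const_divides_pow_Suc)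
      (use z(1)[of k] cl fP in \<open>simp_all only: S_def P.minus_closed P.m_closed c_closed\<close>)
  obtain G where G: "monic G m" "\<forall>k::nat. const (c [^] k) divides\<^bsub>P\<^esub> (G \<ominus>\<^bsub>P\<^esub> fst (z k))"
    by (rule monic_limit[of "\<lambda>k. fst (z k)", OF mon(1) step])
  obtain H where H: "monic H l" "\<forall>k::nat. const (c [^] k) divides\<^bsub>P\<^esub> (H \<ominus>\<^bsub>P\<^esub> snd (z k))"
    by (rule monic_limit[of "\<lambda>k. snd (z k)", OF mon(2) step'])
  have GP: "G \<in> carrier P" and HP: "H \<in> carrier P" using G H by auto
  have "f \<ominus>\<^bsub>P\<^esub> G \<otimes>\<^bsub>P\<^esub> H = \<zero>\<^bsub>P\<^esub>"
  proof (rule poly_separated)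
    fix k :: nat
    let ?g = "fst (z k)" and ?h = "snd (z k)"
    have "f \<ominus>\<^bsub>P\<^esub> G \<otimes>\<^bsub>P\<^esub> H = (f \<ominus>\<^bsub>P\<^esub> ?g \<otimes>\<^bsub>P\<^esub> ?h)
        \<ominus>\<^bsub>P\<^esub> ((G \<ominus>\<^bsub>P\<^esub> ?g) \<otimes>\<^bsub>P\<^esub> H \<oplus>\<^bsub>P\<^esub> (H \<ominus>\<^bsub>P\<^esub> ?h) \<otimes>\<^bsub>P\<^esub> ?g)"
      using fP GP HP cl[of k] by algebra
    then show "const (c [^] k) divides\<^bsub>P\<^esub> (f \<ominus>\<^bsub>P\<^esub> G \<otimes>\<^bsub>P\<^esub> H)"
      using prod[of k] G(2)[rule_format, of k] H(2)[rule_format, of k] HP cl[of k]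
      by (simp add: P.divides_minus P.divides_add P.divides_mult_r)
  qed (use fP GP HP in simp)
  then have fGH: "f = G \<otimes>\<^bsub>P\<^esub> H" using fP GP HP by simp
  \<comment> \<open>Stage 1 is used because the limit agrees with stage \<open>k\<close> modulo c^k,
    which says nothing for \<open>k = 0\<close>.\<close>
  have "const c divides\<^bsub>P\<^esub> (fst (z 1) \<ominus>\<^bsub>P\<^esub> g)" using z(1)[of 1] by (simp add: S_def)
  moreover have "const c divides\<^bsub>P\<^esub> (G \<ominus>\<^bsub>P\<^esub> fst (z 1))" using G(2)[rule_format, of 1] by simp
  ultimately have "const c divides\<^bsub>P\<^esub> ((G \<ominus>\<^bsub>P\<^esub> fst (z 1)) \<oplus>\<^bsub>P\<^esub> (fst (z 1) \<ominus>\<^bsub>P\<^esub> g))"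
    by (intro P.divides_add) simp_all
  also have "(G \<ominus>\<^bsub>P\<^esub> fst (z 1)) \<oplus>\<^bsub>P\<^esub> (fst (z 1) \<ominus>\<^bsub>P\<^esub> g) = G \<ominus>\<^bsub>P\<^esub> g"
    using GP gP cl[of 1] by algebra
  finally show ?thesis using that[OF G(1) H(1) fGH] by blast
qed

end

section \<open>Irreducible divisors and maximal ideals\<close>

lemma (in cring) Units_oneI:
  "\<lbrakk>x \<otimes> y = \<one>; x \<in> carrier R; y \<in> carrier R\<rbrakk> \<Longrightarrow> x \<in> Units R"
  using m_comm[of x y] unfolding Units_def by auto

context UP_cring
begin

text \<open>Irreducibility tested on monic factorizations only, where degrees add and Hensel lifting
  applies. For nilpotent nonzero \<open>c\<close> a general factor may be a unit of positive degree,
  so its relation to \<open>ring_irreducible\<close> is proved separately.\<close>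

definition monic_atom :: "(nat \<Rightarrow> 'a) \<Rightarrow> bool" where
  "monic_atom f \<longleftrightarrow> (\<forall>g h m l. monic g m \<longrightarrow> monic h l \<longrightarrow> f = g \<otimes>\<^bsub>P\<^esub> h \<longrightarrow> m = 0 \<or> l = 0)"

lemma monic_atomD:
  "monic_atom f \<Longrightarrow> f = g \<otimes>\<^bsub>P\<^esub> h \<Longrightarrow> monic g m \<Longrightarrow> monic h l \<Longrightarrow> m = 0 \<or> l = 0"
  unfolding monic_atom_def by blast

lemma ex_monic_iff:
  assumes "f \<in> carrier P" "\<one> \<noteq> \<zero>"
  shows "coeff P f (deg R f) = \<one> \<longleftrightarrow> (\<exists>d. monic f d)"
proof
  assume "coeff P f (deg R f) = \<one>"
  then have "monic f (deg R f)"
    using assms by (simp add: monic_def deg_below_def deg_aboveD)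
  then show "\<exists>d. monic f d" ..
next
  assume "\<exists>d. monic f d"
  then obtain d where d: "monic f d" ..
  then have "deg R f \<le> d" "d \<le> deg R f"
    using assms deg_aboveI[of d f] deg_belowI[of d f] by (auto simp: monic_def deg_below_def)
  then have "deg R f = d" by simp
  with d show "coeff P f (deg R f) = \<one>" by (simp add: monic_def)
qed

end

context local_UP
begin

lemma monic_degree_unique: "monic f m \<Longrightarrow> monic f l \<Longrightarrow> m = l"
  using monic_unique one_not_zero by blast

text \<open>In x = r f + s c the part r f vanishes modulo \<open>c\<close> from degree
  \<open>d\<close> on, which forces \<open>c\<close> to divide \<open>r\<close> because
  \<open>f\<close> is monic. Remainders modulo \<open>f\<close> are thus tested for membership in
  (f, c) by their coefficients alone.\<close>

lemma Idl_monic_const_deg_below: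
  assumes f: "monic f d" and x: "x \<in> Idl\<^bsub>P\<^esub> {f, const c}" "deg_below x d"
  shows "const c divides\<^bsub>P\<^esub> x"
proof -
  have fP: "f \<in> carrier P" and xP: "x \<in> carrier P" using f x(2) by auto
  obtain r s where rs: "r \<in> carrier P" "s \<in> carrier P" "x = r \<otimes>\<^bsub>P\<^esub> f \<oplus>\<^bsub>P\<^esub> s \<otimes>\<^bsub>P\<^esub> const c"
    by (rule P.Idl_pairE[OF x(1) fP const_c_closed])
  have s_eq: "s \<otimes>\<^bsub>P\<^esub> const c = const c \<otimes>\<^bsub>P\<^esub> s" using rs(2) by (simp add: P.m_comm)
  have "const c divides\<^bsub>P\<^esub> r"
  proof (rule monic_mult_divides[OF f rs(1) c_closed])
    fix i assume "d \<le> i"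
    then have "coeff P x i = \<zero>" using x(2) by (simp add: deg_below_def)
    then have "coeff P (r \<otimes>\<^bsub>P\<^esub> f) i \<oplus> c \<otimes> coeff P s i = \<zero>"
      using rs fP by (simp add: s_eq del: coeff_mult)
    then have "c divides (coeff P (r \<otimes>\<^bsub>P\<^esub> f) i \<oplus> c \<otimes> coeff P s i)"
      by (simp only: R.divides_zero c_closed)
    then show "c divides coeff P (r \<otimes>\<^bsub>P\<^esub> f) i"
      by (rule divides_diff[rotated 3])
        (use rs fP in \<open>simp_all add: R.divides_mult_self del: coeff_mult\<close>)
  qed
  then show ?thesis
    unfolding rs(3) s_eq using rs fP
    by (intro P.divides_add P.divides_mult_r P.divides_mult_self) simp_all
qed

lemma one_notin_Idl_monic_const:
  assumes "monic f d" "d \<ge> 1"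
  shows "\<one>\<^bsub>P\<^esub> \<notin> Idl\<^bsub>P\<^esub> {f, const c}"
proof
  assume "\<one>\<^bsub>P\<^esub> \<in> Idl\<^bsub>P\<^esub> {f, const c}"
  moreover have "deg_below \<one>\<^bsub>P\<^esub> d" using assms(2) by (simp add: deg_below_def)
  ultimately have "const c divides\<^bsub>P\<^esub> \<one>\<^bsub>P\<^esub>" using Idl_monic_const_deg_below[OF assms(1)] by blast
  then show False using monic_not_const_c_divides[OF monic_one] by simp
qed

lemma Idl_monic_const_ideal:
  assumes "monic f d"
  shows "ideal (Idl\<^bsub>P\<^esub> {f, const c}) P" "f \<in> Idl\<^bsub>P\<^esub> {f, const c}" "const c \<in> Idl\<^bsub>P\<^esub> {f, const c}"
proof -
  have "{f, const c} \<subseteq> carrier P" using assms by auto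
  then show "ideal (Idl\<^bsub>P\<^esub> {f, const c}) P" "f \<in> Idl\<^bsub>P\<^esub> {f, const c}" "const c \<in> Idl\<^bsub>P\<^esub> {f, const c}"
    using P.genideal_ideal P.genideal_self[of "{f, const c}"] by auto
qed

text \<open>For positive \<open>d\<close> the ideal (f, c) is proper, so it contains no unit.
  Monicity matters: 1 + cX is a unit when \<open>c\<close> is nilpotent.\<close>

lemma monic_unit_degree:
  assumes f: "monic f d" and u: "f \<in> Units P"
  shows "d = 0"
proof (rule ccontr)
  assume "d \<noteq> 0"
  interpret I: ideal "Idl\<^bsub>P\<^esub> {f, const c}" P by (rule Idl_monic_const_ideal[OF f])
  have "inv\<^bsub>P\<^esub> f \<otimes>\<^bsub>P\<^esub> f \<in> Idl\<^bsub>P\<^esub> {f, const c}"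
    using u by (intro I.I_l_closed Idl_monic_const_ideal[OF f]) simp
  then show False
    using one_notin_Idl_monic_const[OF f] u \<open>d \<noteq> 0\<close> by simp
qed

text \<open>For f = g h, a proper factor \<open>g\<close> is a unit and so has degree 0. Otherwise g
  = f k = g h k, and cancelling the monic \<open>g\<close> makes \<open>h\<close> a unit.\<close>

lemma irreducible_imp_monic_atom:
  assumes f: "monic f d" and irr: "ring_irreducible\<^bsub>P\<^esub> f"
  shows "d \<ge> 1 \<and> monic_atom f"
proof
  have nu: "f \<notin> Units P" and pf: "\<And>b. b \<in> carrier P \<Longrightarrow> properfactor P b f \<Longrightarrow> b \<in> Units P"
    using irr unfolding ring_irreducible_def Divisibility.irreducible_def by blast+
  have "d \<noteq> 0"
  proof
    assume "d = 0"
    then have "f = \<one>\<^bsub>P\<^esub>" using f by (simp add: monic_0_iff)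
    then show False using nu by simp
  qed
  then show "d \<ge> 1" by simp
  show "monic_atom f"
    unfolding monic_atom_def
  proof (intro allI impI)
    fix g h m l assume g: "monic g m" and h: "monic h l" and eq: "f = g \<otimes>\<^bsub>P\<^esub> h"
    have gP: "g \<in> carrier P" and hP: "h \<in> carrier P" using g h by auto
    show "m = 0 \<or> l = 0"
    proof (cases "f divides\<^bsub>P\<^esub> g")
      case True
      then obtain k where k: "k \<in> carrier P" "g = f \<otimes>\<^bsub>P\<^esub> k" unfolding factor_def by blast
      have "(\<one>\<^bsub>P\<^esub> \<ominus>\<^bsub>P\<^esub> h \<otimes>\<^bsub>P\<^esub> k) \<otimes>\<^bsub>P\<^esub> g = g \<ominus>\<^bsub>P\<^esub> g \<otimes>\<^bsub>P\<^esub> h \<otimes>\<^bsub>P\<^esub> k"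
        using gP hP k(1) by algebra
      also have "g \<otimes>\<^bsub>P\<^esub> h \<otimes>\<^bsub>P\<^esub> k = g" using eq k(2) by simp
      finally have "(\<one>\<^bsub>P\<^esub> \<ominus>\<^bsub>P\<^esub> h \<otimes>\<^bsub>P\<^esub> k) \<otimes>\<^bsub>P\<^esub> g = \<zero>\<^bsub>P\<^esub>"
        using gP by (simp add: P.minus_eq P.r_neg)
      then have "\<one>\<^bsub>P\<^esub> \<ominus>\<^bsub>P\<^esub> h \<otimes>\<^bsub>P\<^esub> k = \<zero>\<^bsub>P\<^esub>"
        using hP k(1) by (intro monic_mult_zero[OF g]) (simp_all add: deg_below_def)
      then have "h \<otimes>\<^bsub>P\<^esub> k = \<one>\<^bsub>P\<^esub>" using hP k(1) by simp
      then have "h \<in> Units P" using hP k(1) by (rule P.Units_oneI)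
      then show ?thesis using monic_unit_degree[OF h] by simp
    next
      case False
      then have "properfactor P g f"
        using hP eq by (auto simp: properfactor_def factor_def)
      then show ?thesis using pf[OF gP] monic_unit_degree[OF g] by simp
    qed
  qed
qed

end

section \<open>Monic divisors of X^n - 1 when n is a unit\<close>

locale cyclic_UP = complete_local_UP +
  fixes n :: nat
  assumes n_pos: "n \<ge> 1" and n_unit: "[n] \<cdot> \<one> \<in> Units R"
begin

text \<open>Write J = (g, c) with \<open>g\<close> monic. Dividing \<open>f\<close> by
  \<open>g\<close> gives f = g q modulo \<open>c\<close>; the factors are coprime modulo
  \<open>c\<close>, so the factorization lifts to f = G H. For an atom either \<open>g\<close> has
  degree 0 and \<open>J\<close> is everything, or \<open>H\<close> is 1 and \<open>f\<close>, equal
  to \<open>G\<close>, agrees with \<open>g\<close> modulo \<open>c\<close>.\<close>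

lemma monic_atom_maximal:
  assumes f: "monic f d" and at: "monic_atom f" and k: "k \<in> carrier P" "xn_minus_one n = f \<otimes>\<^bsub>P\<^esub> k"
    and J: "ideal J P" "f \<in> J" "const c \<in> J"
  shows "J = carrier P \<or> J = Idl\<^bsub>P\<^esub> {f, const c}"
proof -
  interpret J: ideal J P by (rule J)
  have fP: "f \<in> carrier P" using f by auto
  obtain g e where g: "monic g e" "g \<in> J" and J_eq: "J = Idl\<^bsub>P\<^esub> {g, const c}"
    and min: "\<And>h k. h \<in> J \<Longrightarrow> monic h k \<Longrightarrow> e \<le> k"
    using ideal_monic_generator[OF J(1,3,2) monic_not_const_c_divides[OF f]] by blast
  have gP: "g \<in> carrier P" using g by auto
  have "e \<le> d" using min J(2) f by blast
  obtain q where q: "q \<in> carrier P" and r: "deg_below (f \<ominus>\<^bsub>P\<^esub> q \<otimes>\<^bsub>P\<^esub> g) e"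
    using monic_division[OF g(1) fP] by blast
  have mq: "monic q (d - e)" by (rule monic_quotient[OF f g(1) q \<open>e \<le> d\<close> r])
  have "f \<ominus>\<^bsub>P\<^esub> q \<otimes>\<^bsub>P\<^esub> g \<in> J" using J(2) g(2) q by (intro J.minus_mem J.I_l_closed)
  then have "const c divides\<^bsub>P\<^esub> (f \<ominus>\<^bsub>P\<^esub> q \<otimes>\<^bsub>P\<^esub> g)"
    using Idl_monic_const_deg_below[OF g(1) _ r] J_eq by blast
  then have dvd: "const c divides\<^bsub>P\<^esub> (f \<ominus>\<^bsub>P\<^esub> g \<otimes>\<^bsub>P\<^esub> q)" using gP q by (simp add: P.m_comm)
  then obtain w where w: "w \<in> carrier P" "f \<ominus>\<^bsub>P\<^esub> g \<otimes>\<^bsub>P\<^esub> q = const c \<otimes>\<^bsub>P\<^esub> w"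
    unfolding factor_def by blast
  have sub: "{g, q, const c} \<subseteq> carrier P" using gP q by simp
  have one: "\<one>\<^bsub>P\<^esub> \<in> Idl\<^bsub>P\<^esub> {g, q, const c}"
  proof (rule xn_minus_one_coprime_factors[OF P.genideal_ideal[OF sub] _ _ _ k(1) _ c_closed _ n_unit])
    have "f \<otimes>\<^bsub>P\<^esub> k = g \<otimes>\<^bsub>P\<^esub> q \<otimes>\<^bsub>P\<^esub> k \<oplus>\<^bsub>P\<^esub> (f \<ominus>\<^bsub>P\<^esub> g \<otimes>\<^bsub>P\<^esub> q) \<otimes>\<^bsub>P\<^esub> k"
      using fP gP q k(1) by algebra
    also have "(f \<ominus>\<^bsub>P\<^esub> g \<otimes>\<^bsub>P\<^esub> q) \<otimes>\<^bsub>P\<^esub> k = const c \<otimes>\<^bsub>P\<^esub> (w \<otimes>\<^bsub>P\<^esub> k)"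
      unfolding w(2) using w(1) k(1) by (simp add: P.m_assoc)
    finally show "xn_minus_one n = g \<otimes>\<^bsub>P\<^esub> q \<otimes>\<^bsub>P\<^esub> k \<oplus>\<^bsub>P\<^esub> const c \<otimes>\<^bsub>P\<^esub> (w \<otimes>\<^bsub>P\<^esub> k)"
      using k(2) by simp
  qed (use P.genideal_self[OF sub] w k in auto)
  have "monic f (e + (d - e))" using f \<open>e \<le> d\<close> by simp
  then obtain G H where GH: "monic G e" "monic H (d - e)" "f = G \<otimes>\<^bsub>P\<^esub> H"
    "const c divides\<^bsub>P\<^esub> (G \<ominus>\<^bsub>P\<^esub> g)"
    using hensel[OF _ g(1) mq dvd one] by blast
  show ?thesis
  proof (cases "e = 0")
    case True
    then have "\<one>\<^bsub>P\<^esub> \<in> J" using g by (simp add: monic_0_iff)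
    then show ?thesis using J.one_imp_carrier by simp
  next
    case False
    then have "d - e = 0" using monic_atomD[OF at GH(3,1,2)] by simp
    then have "H = \<one>\<^bsub>P\<^esub>" using GH(2) monic_0_iff by metis
    then have "f = G" using GH(1,3) by auto
    then obtain v where v: "v \<in> carrier P" "f \<ominus>\<^bsub>P\<^esub> g = const c \<otimes>\<^bsub>P\<^esub> v"
      using GH(4) unfolding factor_def by blast
    have "g = f \<ominus>\<^bsub>P\<^esub> (f \<ominus>\<^bsub>P\<^esub> g)" using fP gP by algebra
    also have "\<dots> = f \<ominus>\<^bsub>P\<^esub> const c \<otimes>\<^bsub>P\<^esub> v" by (simp only: v(2))
    finally have g_eq: "g = f \<ominus>\<^bsub>P\<^esub> const c \<otimes>\<^bsub>P\<^esub> v" .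
    interpret I: ideal "Idl\<^bsub>P\<^esub> {f, const c}" P by (rule Idl_monic_const_ideal[OF f])
    have "g \<in> Idl\<^bsub>P\<^esub> {f, const c}"
      unfolding g_eq using Idl_monic_const_ideal(2,3)[OF f] v(1)
      by (intro I.minus_mem I.I_r_closed)
    then have "J \<subseteq> Idl\<^bsub>P\<^esub> {f, const c}"
      unfolding J_eq using Idl_monic_const_ideal[OF f] by (intro P.genideal_minimal) auto
    moreover have "Idl\<^bsub>P\<^esub> {f, const c} \<subseteq> J"
      using J by (intro P.genideal_minimal) auto
    ultimately show ?thesis by blast
  qed
qed

text \<open>The working form of maximality: an element outside (f, c) is invertible modulo it, as an
  explicit identity that can be fed to \<open>nakayama\<close>.\<close>

lemma monic_atom_insert:
  assumes f: "monic f d" and at: "monic_atom f" and k: "k \<in> carrier P" "xn_minus_one n = f \<otimes>\<^bsub>P\<^esub> k"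
    and b: "b \<in> carrier P" "b \<notin> Idl\<^bsub>P\<^esub> {f, const c}"
  obtains r s t where "r \<in> carrier P" "s \<in> carrier P" "t \<in> carrier P"
    "\<one>\<^bsub>P\<^esub> = r \<otimes>\<^bsub>P\<^esub> f \<oplus>\<^bsub>P\<^esub> (s \<otimes>\<^bsub>P\<^esub> b \<oplus>\<^bsub>P\<^esub> t \<otimes>\<^bsub>P\<^esub> const c)"
proof -
  have fP: "f \<in> carrier P" using f by auto
  have sub: "{f, b, const c} \<subseteq> carrier P" using fP b by simp
  have mem: "f \<in> Idl\<^bsub>P\<^esub> {f, b, const c}" "const c \<in> Idl\<^bsub>P\<^esub> {f, b, const c}"
    "b \<in> Idl\<^bsub>P\<^esub> {f, b, const c}"
    using P.genideal_self[OF sub] by auto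
  have "Idl\<^bsub>P\<^esub> {f, b, const c} = carrier P"
    using monic_atom_maximal[OF f at k P.genideal_ideal[OF sub] mem(1,2)] mem(3) b(2) by auto
  then have "\<one>\<^bsub>P\<^esub> \<in> Idl\<^bsub>P\<^esub> {f, b, const c}" by simp
  then show ?thesis
    using that by (rule P.Idl_tripleE[OF _ fP b(1) const_c_closed])
qed

lemma maximalideal_monic_atom:
  assumes f: "monic f d" "d \<ge> 1" and at: "monic_atom f" and dvd: "f divides\<^bsub>P\<^esub> xn_minus_one n"
  shows "maximalideal (Idl\<^bsub>P\<^esub> {f, const c}) P"
proof (rule maximalidealI)
  show "ideal (Idl\<^bsub>P\<^esub> {f, const c}) P" by (rule Idl_monic_const_ideal[OF f(1)])
  show "carrier P \<noteq> Idl\<^bsub>P\<^esub> {f, const c}"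
    using one_notin_Idl_monic_const[OF f] P.one_closed by blast
  fix J assume "ideal J P" "Idl\<^bsub>P\<^esub> {f, const c} \<subseteq> J"
  moreover obtain k where "k \<in> carrier P" "xn_minus_one n = f \<otimes>\<^bsub>P\<^esub> k"
    using dvd unfolding factor_def by blast
  ultimately show "J = Idl\<^bsub>P\<^esub> {f, const c} \<or> J = carrier P"
    using monic_atom_maximal[OF f(1) at] Idl_monic_const_ideal(2,3)[OF f(1)] by blast
qed

text \<open>Let f = b v with \<open>b\<close> a proper factor. By maximality \<open>b\<close> either
  lies in (f, c) or is invertible modulo it. In the second case Nakayama makes \<open>b\<close> a
  unit; in the first case it makes \<open>v\<close> a unit, so that \<open>f\<close> would divide
  \<open>b\<close>.\<close>

lemma monic_atom_imp_irreducible: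
  assumes f: "monic f d" "d \<ge> 1" and at: "monic_atom f" and dvd: "f divides\<^bsub>P\<^esub> xn_minus_one n"
  shows "ring_irreducible\<^bsub>P\<^esub> f"
  unfolding ring_irreducible_def Divisibility.irreducible_def
proof (intro conjI ballI impI)
  have fP: "f \<in> carrier P" using f by auto
  obtain k where k: "k \<in> carrier P" "xn_minus_one n = f \<otimes>\<^bsub>P\<^esub> k"
    using dvd unfolding factor_def by blast
  show "f \<noteq> \<zero>\<^bsub>P\<^esub>"
    using monic_not_const_c_divides[OF f(1)] P.divides_zero[OF const_c_closed] by metis
  show "f \<notin> Units P" using monic_unit_degree[OF f(1)] f(2) by auto
  fix b assume bP: "b \<in> carrier P" and "properfactor P b f"
  then obtain v where v: "v \<in> carrier P" "f = b \<otimes>\<^bsub>P\<^esub> v" and nd: "\<not> f divides\<^bsub>P\<^esub> b"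
    unfolding properfactor_def factor_def by blast
  \<comment> \<open>A divisor \<open>x\<close> of \<open>f\<close> that is invertible modulo
    \<open>c\<close> is a unit: its principal ideal contains the monic \<open>f\<close>, so
    \<open>nakayama\<close> applies to it.\<close>
  have unit: "x \<in> Units P" if x: "x \<in> carrier P" "f \<in> Idl\<^bsub>P\<^esub> {x}"
      "s \<in> carrier P" "t \<in> carrier P" "\<one>\<^bsub>P\<^esub> = s \<otimes>\<^bsub>P\<^esub> x \<oplus>\<^bsub>P\<^esub> const c \<otimes>\<^bsub>P\<^esub> t" for x s t
  proof -
    interpret X: ideal "Idl\<^bsub>P\<^esub> {x}" P using x(1) by (intro P.genideal_ideal) simp
    have "x \<in> Idl\<^bsub>P\<^esub> {x}" using x(1) by (rule P.genideal_self')
    then have "s \<otimes>\<^bsub>P\<^esub> x \<in> Idl\<^bsub>P\<^esub> {x}" using x(3) by (rule X.I_l_closed)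
    then have "Idl\<^bsub>P\<^esub> {x} = carrier P" by (rule nakayama[OF f(1) X.is_ideal x(2) _ x(4,5)])
    then have "\<one>\<^bsub>P\<^esub> \<in> Idl\<^bsub>P\<^esub> {x}" by simp
    then obtain y where "y \<in> carrier P" "\<one>\<^bsub>P\<^esub> = y \<otimes>\<^bsub>P\<^esub> x"
      by (rule P.Idl_singletonE[OF _ x(1)])
    then show ?thesis using x(1) P.Units_oneI[of x y] P.m_comm[of x y] by simp
  qed
  have f_mem: "f \<in> Idl\<^bsub>P\<^esub> {x}" if "x \<in> carrier P" "y \<in> carrier P" "f = y \<otimes>\<^bsub>P\<^esub> x" for x y
    unfolding that(3) using P.genideal_ideal[of "{x}"] P.genideal_self'[of x] that(1,2)
    by (simp add: ideal.I_l_closed)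
  show "b \<in> Units P"
  proof (cases "b \<in> Idl\<^bsub>P\<^esub> {f, const c}")
    \<comment> \<open>Multiplying b = r f + w c by \<open>v\<close> gives f = r v f + c w v.
      Cancelling the monic \<open>f\<close> modulo \<open>c\<close> leaves 1 = r v modulo
      \<open>c\<close>.\<close>
    case True
    then obtain r w where rw: "r \<in> carrier P" "w \<in> carrier P" "b = r \<otimes>\<^bsub>P\<^esub> f \<oplus>\<^bsub>P\<^esub> w \<otimes>\<^bsub>P\<^esub> const c"
      by (rule P.Idl_pairE[OF _ fP const_c_closed])
    have "(\<one>\<^bsub>P\<^esub> \<ominus>\<^bsub>P\<^esub> r \<otimes>\<^bsub>P\<^esub> v) \<otimes>\<^bsub>P\<^esub> f
        = f \<ominus>\<^bsub>P\<^esub> (r \<otimes>\<^bsub>P\<^esub> f \<oplus>\<^bsub>P\<^esub> w \<otimes>\<^bsub>P\<^esub> const c) \<otimes>\<^bsub>P\<^esub> v \<oplus>\<^bsub>P\<^esub> const c \<otimes>\<^bsub>P\<^esub> (w \<otimes>\<^bsub>P\<^esub> v)"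
      using rw(1,2) v(1) fP const_c_closed by algebra
    also have "\<dots> = const c \<otimes>\<^bsub>P\<^esub> (w \<otimes>\<^bsub>P\<^esub> v)"
      using fP rw(2) v(1) by (simp add: rw(3)[symmetric] v(2)[symmetric] P.minus_eq P.r_neg)
    finally have "c divides coeff P ((\<one>\<^bsub>P\<^esub> \<ominus>\<^bsub>P\<^esub> r \<otimes>\<^bsub>P\<^esub> v) \<otimes>\<^bsub>P\<^esub> f) i" for i
      using rw(2) v(1) by (simp add: R.divides_mult_self del: coeff_mult)
    then have "const c divides\<^bsub>P\<^esub> (\<one>\<^bsub>P\<^esub> \<ominus>\<^bsub>P\<^esub> r \<otimes>\<^bsub>P\<^esub> v)"
      using rw(1) v(1) by (intro monic_mult_divides[OF f(1)]) simp_all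
    then obtain t where t: "t \<in> carrier P" "\<one>\<^bsub>P\<^esub> \<ominus>\<^bsub>P\<^esub> r \<otimes>\<^bsub>P\<^esub> v = const c \<otimes>\<^bsub>P\<^esub> t"
      unfolding factor_def by blast
    have "\<one>\<^bsub>P\<^esub> = r \<otimes>\<^bsub>P\<^esub> v \<oplus>\<^bsub>P\<^esub> (\<one>\<^bsub>P\<^esub> \<ominus>\<^bsub>P\<^esub> r \<otimes>\<^bsub>P\<^esub> v)"
      using rw(1) v(1) by algebra
    then have "v \<in> Units P" unfolding t(2) using unit f_mem v bP rw(1) t(1) by blast
    then have "b = f \<otimes>\<^bsub>P\<^esub> inv\<^bsub>P\<^esub> v" using v bP by (simp add: P.m_assoc)
    then have "f divides\<^bsub>P\<^esub> b" using \<open>v \<in> Units P\<close> unfolding factor_def by blast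
    then show ?thesis using nd by simp
  next
    case False
    obtain r s t where rst: "r \<in> carrier P" "s \<in> carrier P" "t \<in> carrier P"
      "\<one>\<^bsub>P\<^esub> = r \<otimes>\<^bsub>P\<^esub> f \<oplus>\<^bsub>P\<^esub> (s \<otimes>\<^bsub>P\<^esub> b \<oplus>\<^bsub>P\<^esub> t \<otimes>\<^bsub>P\<^esub> const c)"
      by (rule monic_atom_insert[OF f(1) at k bP False])
    note rst(4)
    also have "r \<otimes>\<^bsub>P\<^esub> f \<oplus>\<^bsub>P\<^esub> (s \<otimes>\<^bsub>P\<^esub> b \<oplus>\<^bsub>P\<^esub> t \<otimes>\<^bsub>P\<^esub> const c)
        = (r \<otimes>\<^bsub>P\<^esub> v \<oplus>\<^bsub>P\<^esub> s) \<otimes>\<^bsub>P\<^esub> b \<oplus>\<^bsub>P\<^esub> const c \<otimes>\<^bsub>P\<^esub> t"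
      unfolding v(2) using rst(1-3) v(1) bP const_c_closed by algebra
    finally have 1: "\<one>\<^bsub>P\<^esub> = (r \<otimes>\<^bsub>P\<^esub> v \<oplus>\<^bsub>P\<^esub> s) \<otimes>\<^bsub>P\<^esub> b \<oplus>\<^bsub>P\<^esub> const c \<otimes>\<^bsub>P\<^esub> t" .
    have "f \<in> Idl\<^bsub>P\<^esub> {b}" using f_mem[OF bP v(1)] v bP by (simp add: P.m_comm)
    then show ?thesis using unit[OF bP _ _ rst(3) 1] rst(1,2) v(1) by simp
  qed
qed

lemma monic_irred_divisor_iff:
  "monic_irred_divisor R n f \<longleftrightarrow>
    (\<exists>d\<ge>1. monic f d \<and> monic_atom f \<and> f divides\<^bsub>P\<^esub> xn_minus_one n)"
proof -
  have "monic_irred_divisor R n f \<longleftrightarrow>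
      (\<exists>d. monic f d) \<and> ring_irreducible\<^bsub>P\<^esub> f \<and> f divides\<^bsub>P\<^esub> xn_minus_one n"
    using ex_monic_iff[of f] one_not_zero
    by (auto simp: monic_irred_divisor_def P_def[symmetric] xn_minus_1_eq)
  then show ?thesis
    using irreducible_imp_monic_atom monic_atom_imp_irreducible by blast
qed

text \<open>The candidates include X^n - 1 itself. If a minimal \<open>f\<close> is a product of
  monic \<open>g\<close> and \<open>h\<close>, both still divide X^n - 1 and one lies in
  \<open>Q\<close>; by minimality that one has the full degree of \<open>f\<close>, so the other has
  degree 0.\<close>

lemma primeideal_contains_irred_divisor:
  assumes Q: "primeideal Q P" and xn: "xn_minus_one n \<in> Q"
  obtains f where "monic_irred_divisor R n f" "f \<in> Q"
proof -
  interpret Q: primeideal Q P by (rule Q)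
  have one: "\<one>\<^bsub>P\<^esub> \<notin> Q" using Q.one_imp_carrier Q.I_notcarr by blast
  define p where "p d \<longleftrightarrow> (\<exists>f\<in>Q. monic f d \<and> f divides\<^bsub>P\<^esub> xn_minus_one n)" for d
  have "xn_minus_one n divides\<^bsub>P\<^esub> xn_minus_one n"
    unfolding factor_def by (rule bexI[of _ "\<one>\<^bsub>P\<^esub>"]) simp_all
  then have "p n" using xn monic_xn_minus_one[OF n_pos] unfolding p_def by blast
  define d where "d = (LEAST d. p d)"
  have "p d" unfolding d_def using \<open>p n\<close> by (rule LeastI)
  then obtain f where f: "f \<in> Q" "monic f d" "f divides\<^bsub>P\<^esub> xn_minus_one n"
    unfolding p_def by blast
  have min: "d \<le> m" if "p m" for m unfolding d_def using that by (rule Least_le)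
  have "d \<noteq> 0" using f(1,2) one monic_0_iff by metis
  moreover have "monic_atom f"
    unfolding monic_atom_def
  proof (intro allI impI)
    fix g h m l assume g: "monic g m" and h: "monic h l" and eq: "f = g \<otimes>\<^bsub>P\<^esub> h"
    have gP: "g \<in> carrier P" and hP: "h \<in> carrier P" using g h by auto
    have "d = m + l" using monic_degree_unique[OF f(2)] monic_mult[OF g h] eq by simp
    have "g divides\<^bsub>P\<^esub> f" "h divides\<^bsub>P\<^esub> f"
      unfolding eq using gP hP P.divides_mult_self[of h g]
      by (simp_all add: P.divides_mult_self P.m_comm)
    then have dvd: "g divides\<^bsub>P\<^esub> xn_minus_one n" "h divides\<^bsub>P\<^esub> xn_minus_one n"
      using P.divides_trans f(3) gP hP by blast+
    have "g \<in> Q \<or> h \<in> Q" using Q.I_prime[OF gP hP] f(1) eq by simp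
    then have "p m \<or> p l" unfolding p_def using g h dvd by blast
    then show "m = 0 \<or> l = 0" using min \<open>d = m + l\<close> by fastforce
  qed
  ultimately have "monic_irred_divisor R n f"
    unfolding monic_irred_divisor_iff using f by (intro exI[of _ d]) auto
  then show ?thesis using that f(1) by blast
qed

lemma maximalideal_irred_divisor:
  "monic_irred_divisor R n f \<Longrightarrow> maximalideal (Idl\<^bsub>P\<^esub> {f, const c}) P"
  unfolding monic_irred_divisor_iff using maximalideal_monic_atom by blast

lemma primeideal_with_const:
  assumes Q: "primeideal Q P" and xn: "xn_minus_one n \<in> Q" and c: "const c \<in> Q"
  shows "\<exists>f. monic_irred_divisor R n f \<and> Q = Idl\<^bsub>P\<^esub> {f, const c}"
proof -
  interpret Q: primeideal Q P by (rule Q)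
  obtain f where f: "monic_irred_divisor R n f" "f \<in> Q"
    by (rule primeideal_contains_irred_divisor[OF Q xn])
  interpret M: maximalideal "Idl\<^bsub>P\<^esub> {f, const c}" P by (rule maximalideal_irred_divisor[OF f(1)])
  have "Idl\<^bsub>P\<^esub> {f, const c} \<subseteq> Q" using f(2) c by (intro P.genideal_minimal Q.is_ideal) simp
  then have "Q = Idl\<^bsub>P\<^esub> {f, const c}"
    using M.I_maximal[OF Q.is_ideal] Q.I_notcarr Q.Icarr by blast
  then show ?thesis using f(1) by blast
qed

end

section \<open>Transfer to the quotient\<close>

text \<open>Surjectivity makes the image of an ideal an ideal, which gives one inclusion; the
  preimage of an ideal being an ideal gives the other.\<close>

lemma (in ring_hom_ring) Idl_image:
  assumes F: "F \<subseteq> carrier R" and surj: "h ` carrier R = carrier S"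
  shows "Idl\<^bsub>S\<^esub> (h ` F) = h ` (Idl\<^bsub>R\<^esub> F)"
proof
  have I: "ideal (Idl\<^bsub>R\<^esub> F) R" by (rule R.genideal_ideal[OF F])
  interpret I: ideal "Idl\<^bsub>R\<^esub> F" R by (rule I)
  have img: "h ` F \<subseteq> carrier S" using F surj by blast
  have "ideal (h ` (Idl\<^bsub>R\<^esub> F)) S"
  proof (rule idealI)
    show "subgroup (h ` (Idl\<^bsub>R\<^esub> F)) (add_monoid S)"
      using img_is_add_subgroup I.a_subgroup by blast
    fix a x assume "a \<in> h ` (Idl\<^bsub>R\<^esub> F)" "x \<in> carrier S"
    then obtain b y where "b \<in> Idl\<^bsub>R\<^esub> F" "a = h b" "y \<in> carrier R" "x = h y"
      using surj by blast
    then show "x \<otimes>\<^bsub>S\<^esub> a \<in> h ` (Idl\<^bsub>R\<^esub> F)" "a \<otimes>\<^bsub>S\<^esub> x \<in> h ` (Idl\<^bsub>R\<^esub> F)"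
      using I.I_l_closed[of b y] I.I_r_closed[of b y] I.Icarr[of b]
      by (metis hom_mult imageI)+
  qed (rule S.ring_axioms)
  then show "Idl\<^bsub>S\<^esub> (h ` F) \<subseteq> h ` (Idl\<^bsub>R\<^esub> F)"
    using R.genideal_self[OF F] by (intro S.genideal_minimal) auto
  have "ideal {r \<in> carrier R. h r \<in> Idl\<^bsub>S\<^esub> (h ` F)} R"
    by (rule ideal_vimage[OF S.genideal_ideal[OF img]])
  then have "Idl\<^bsub>R\<^esub> F \<subseteq> {r \<in> carrier R. h r \<in> Idl\<^bsub>S\<^esub> (h ` F)}"
    using F S.genideal_self[OF img] by (intro R.genideal_minimal) auto
  then show "h ` (Idl\<^bsub>R\<^esub> F) \<subseteq> Idl\<^bsub>S\<^esub> (h ` F)" by auto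
qed

context ideal
begin

lemma rcos_image_carrier: "(+>) I ` carrier R = carrier (R Quot I)"
  unfolding FactRing_def A_RCOSETS_def' by auto

text \<open>Because \<open>I\<close> lies in \<open>Q\<close>, the set \<open>Q\<close> is a union
  of cosets of \<open>I\<close>.\<close>

lemma rcos_image_mem_iff:
  assumes Q: "ideal Q R" "I \<subseteq> Q" and x: "x \<in> carrier R"
  shows "I +> x \<in> (+>) I ` Q \<longleftrightarrow> x \<in> Q"
proof
  interpret Q: ideal Q R by (rule Q)
  assume "I +> x \<in> (+>) I ` Q"
  then obtain y where y: "y \<in> Q" "I +> x = I +> y" by blast
  have "x \<in> I +> y" using a_rcos_self[OF x] y(2) by simp
  then obtain i where "i \<in> I" "x = i \<oplus> y" unfolding a_r_coset_def' by blast
  then show "x \<in> Q" using Q(2) y(1) by auto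
qed simp

lemma primeideal_rcos_image_iff:
  assumes Q: "ideal Q R" "I \<subseteq> Q" and R: "cring R"
  shows "primeideal ((+>) I ` Q) (R Quot I) \<longleftrightarrow> primeideal Q R"
proof
  interpret Q: ideal Q R by (rule Q)
  interpret phi: ring_hom_ring R "R Quot I" "(+>) I" by (rule rcos_ring_hom_ring)
  {
    assume "primeideal ((+>) I ` Q) (R Quot I)"
    then have "primeideal {r \<in> carrier R. I +> r \<in> (+>) I ` Q} R"
      by (rule phi.primeideal_vimage[OF R])
    moreover have "{r \<in> carrier R. I +> r \<in> (+>) I ` Q} = Q"
      using rcos_image_mem_iff[OF Q] Q.Icarr by blast
    ultimately show "primeideal Q R" by simp
  }
  assume "primeideal Q R"
  then interpret Q: primeideal Q R .
  show "primeideal ((+>) I ` Q) (R Quot I)"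
  proof (rule primeidealI)
    show "ideal ((+>) I ` Q) (R Quot I)"
      by (rule ring_ideal_imp_quot_ideal[OF is_ideal Q(1)])
    show "cring (R Quot I)" by (rule quotient_is_cring[OF R])
    have "I +> \<one> \<in> (+>) I ` carrier R" by (rule imageI) simp
    moreover have "\<one> \<notin> Q" using Q.one_imp_carrier Q.I_notcarr by blast
    then have "I +> \<one> \<notin> (+>) I ` Q" using rcos_image_mem_iff[OF Q, of \<one>] by blast
    ultimately show "carrier (R Quot I) \<noteq> (+>) I ` Q" unfolding rcos_image_carrier[symmetric] by blast
    fix a b assume "a \<in> carrier (R Quot I)" "b \<in> carrier (R Quot I)"
      and ab: "a \<otimes>\<^bsub>R Quot I\<^esub> b \<in> (+>) I ` Q"
    then obtain x y where xy: "x \<in> carrier R" "a = I +> x" "y \<in> carrier R" "b = I +> y"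
      unfolding rcos_image_carrier[symmetric] by blast
    then have "I +> (x \<otimes> y) \<in> (+>) I ` Q" using ab by simp
    moreover have "x \<otimes> y \<in> carrier R" using xy by simp
    ultimately have "x \<otimes> y \<in> Q" using rcos_image_mem_iff[OF Q] by blast
    then show "a \<in> (+>) I ` Q \<or> b \<in> (+>) I ` Q"
      using Q.I_prime xy by blast
  qed
qed

end

lemma (in primeideal) pow_memD:
  assumes "x \<in> carrier R" "x [^] (k::nat) \<in> I"
  shows "x \<in> I"
  using assms(2)
proof (induction k)
  case 0
  then show ?case using I_notcarr one_imp_carrier by simp
next
  case (Suc k)
  then show ?case using I_prime[of "x [^] k" x] assms(1) by auto
qed

context UP_cring
begin

lemma const_pow: "z \<in> carrier R \<Longrightarrow> const z [^]\<^bsub>P\<^esub> k = const (z [^] (k::nat))"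
  using monom_pow[of z 0 k] by simp

lemma const_nat_eq: "const_nat R k = const ([k] \<cdot> \<one>)"
proof -
  have "[k] \<cdot>\<^bsub>P\<^esub> \<one>\<^bsub>P\<^esub> = const ([k] \<cdot> \<one>)" for k :: nat
    by (induction k) simp_all
  then show ?thesis by (simp add: const_nat_def P_def)
qed

end

section \<open>Prime ideals of S[X] containing X^n - 1 and their images in the quotient\<close>

context cyclic_UP
begin

abbreviation "I \<equiv> Idl\<^bsub>P\<^esub> {xn_minus_one n}"

text \<open>Separatedness stops the division by \<open>c\<close>: the least exponent that fails is
  positive, and its predecessor is \<open>k\<close>. The degree bound survives, so that
  \<open>Idl_monic_const_deg_below\<close> can be applied to \<open>r'\<close>.\<close>

lemma factor_out_c:
  assumes r: "deg_below r d" and nz: "r \<noteq> \<zero>\<^bsub>P\<^esub>"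
  obtains k r' where "deg_below r' d" "r = const (c [^] (k::nat)) \<otimes>\<^bsub>P\<^esub> r'"
    "\<not> const c divides\<^bsub>P\<^esub> r'"
proof -
  have rP: "r \<in> carrier P" using r by auto
  define q where "q j \<longleftrightarrow> \<not> const (c [^] (j::nat)) divides\<^bsub>P\<^esub> r" for j
  have "\<exists>j. q j" using poly_separated[OF rP] nz unfolding q_def by blast
  then have q: "q (LEAST j. q j)" by (rule LeastI_ex)
  have "\<not> q 0" using rP by (auto simp: q_def factor_def)
  then have "(LEAST j. q j) \<noteq> 0" using q by metis
  then obtain k where k: "(LEAST j. q j) = Suc k" using not0_implies_Suc by blast
  then have "\<not> q k" using not_less_Least[of k q] by simp
  then have dvd: "const (c [^] k) divides\<^bsub>P\<^esub> r" by (simp add: q_def)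
  obtain r' where r': "deg_below r' d" "r = const (c [^] k) \<otimes>\<^bsub>P\<^esub> r'"
    by (rule const_divides_deg_below[OF _ r const_divides_coeff[OF _ dvd]]) simp_all
  have "\<not> const c divides\<^bsub>P\<^esub> r'"
  proof
    assume "const c divides\<^bsub>P\<^esub> r'"
    then obtain s where s: "s \<in> carrier P" "r' = const c \<otimes>\<^bsub>P\<^esub> s" unfolding factor_def by blast
    then have "r = const (c [^] Suc k) \<otimes>\<^bsub>P\<^esub> s"
      unfolding r'(2) by (simp flip: const_mult_const add: P.m_assoc)
    then have "const (c [^] Suc k) divides\<^bsub>P\<^esub> r" using s(1) unfolding factor_def by blast
    then show False using q k by (simp add: q_def)
  qed
  with r' that show ?thesis by blast
qed

lemma Idl_singleton_ideal:
  assumes "f \<in> carrier P"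
  shows "ideal (Idl\<^bsub>P\<^esub> {f}) P" "f \<in> Idl\<^bsub>P\<^esub> {f}"
  using P.genideal_ideal[of "{f}"] P.genideal_self'[OF assms] assms by auto

lemma primeideal_without_const:
  assumes Q: "primeideal Q P" and f: "monic_irred_divisor R n f" "f \<in> Q" and c: "const c \<notin> Q"
  shows "Q = Idl\<^bsub>P\<^esub> {f}"
proof
  interpret Q: primeideal Q P by (rule Q)
  obtain d k where d: "monic f d" "monic_atom f" and k: "k \<in> carrier P" "xn_minus_one n = f \<otimes>\<^bsub>P\<^esub> k"
    using f(1) unfolding monic_irred_divisor_iff factor_def by blast
  have fP: "f \<in> carrier P" using d by auto
  show "Idl\<^bsub>P\<^esub> {f} \<subseteq> Q" using f(2) by (intro P.genideal_minimal Q.is_ideal) simp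
  show "Q \<subseteq> Idl\<^bsub>P\<^esub> {f}"
  proof
    fix h assume h: "h \<in> Q"
    have hP: "h \<in> carrier P" using Q.Icarr h by simp
    obtain q where q: "q \<in> carrier P" "deg_below (h \<ominus>\<^bsub>P\<^esub> q \<otimes>\<^bsub>P\<^esub> f) d"
      using monic_division[OF d(1) hP] by blast
    define r where "r = h \<ominus>\<^bsub>P\<^esub> q \<otimes>\<^bsub>P\<^esub> f"
    have rQ: "r \<in> Q" unfolding r_def using h f(2) q(1) by (intro Q.minus_mem Q.I_l_closed)
    have "r = \<zero>\<^bsub>P\<^esub>"
    proof (rule ccontr)
      assume nz: "r \<noteq> \<zero>\<^bsub>P\<^esub>"
      have rd: "deg_below r d" using q(2) by (simp add: r_def)
      obtain j r' where r': "deg_below r' d" "r = const (c [^] (j::nat)) \<otimes>\<^bsub>P\<^esub> r'"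
        "\<not> const c divides\<^bsub>P\<^esub> r'"
        by (rule factor_out_c[OF rd nz])
      have r'P: "r' \<in> carrier P" using r'(1) by auto
      have "const (c [^] j) \<notin> Q" using Q.pow_memD[of "const c" j] c by (auto simp: const_pow)
      then have r'Q: "r' \<in> Q"
        using Q.I_prime[of "const (c [^] j)" r'] rQ r'(2) r'P by auto
      \<comment> \<open>\<open>r'\<close> is a remainder not divisible by \<open>c\<close>, hence
        outside (f, c). So \<open>f\<close>, \<open>r'\<close> and \<open>c\<close> generate 1, and
        as \<open>f\<close> and \<open>r'\<close> lie in \<open>Q\<close>, Nakayama would make
        \<open>Q\<close> the whole ring.\<close>
      have "r' \<notin> Idl\<^bsub>P\<^esub> {f, const c}"
        using Idl_monic_const_deg_below[OF d(1) _ r'(1)] r'(3) by blast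
      then obtain x y z where xyz: "x \<in> carrier P" "y \<in> carrier P" "z \<in> carrier P"
        "\<one>\<^bsub>P\<^esub> = x \<otimes>\<^bsub>P\<^esub> f \<oplus>\<^bsub>P\<^esub> (y \<otimes>\<^bsub>P\<^esub> r' \<oplus>\<^bsub>P\<^esub> z \<otimes>\<^bsub>P\<^esub> const c)"
        by (rule monic_atom_insert[OF d k r'P])
      note xyz(4)
      also have "x \<otimes>\<^bsub>P\<^esub> f \<oplus>\<^bsub>P\<^esub> (y \<otimes>\<^bsub>P\<^esub> r' \<oplus>\<^bsub>P\<^esub> z \<otimes>\<^bsub>P\<^esub> const c)
          = (x \<otimes>\<^bsub>P\<^esub> f \<oplus>\<^bsub>P\<^esub> y \<otimes>\<^bsub>P\<^esub> r') \<oplus>\<^bsub>P\<^esub> const c \<otimes>\<^bsub>P\<^esub> z"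
        using xyz(1-3) fP r'P const_c_closed by algebra
      finally have one: "\<one>\<^bsub>P\<^esub> = (x \<otimes>\<^bsub>P\<^esub> f \<oplus>\<^bsub>P\<^esub> y \<otimes>\<^bsub>P\<^esub> r') \<oplus>\<^bsub>P\<^esub> const c \<otimes>\<^bsub>P\<^esub> z" .
      have "x \<otimes>\<^bsub>P\<^esub> f \<oplus>\<^bsub>P\<^esub> y \<otimes>\<^bsub>P\<^esub> r' \<in> Q"
        using xyz(1,2) f(2) r'Q by (simp add: Q.I_l_closed)
      from nakayama[OF d(1) Q.is_ideal f(2) this xyz(3) one] show False
        using Q.I_notcarr by simp
    qed
    then have "h = q \<otimes>\<^bsub>P\<^esub> f" using hP q(1) fP by (simp add: r_def)
    then show "h \<in> Idl\<^bsub>P\<^esub> {f}"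
      using Idl_singleton_ideal[OF fP] q(1) by (simp add: ideal.I_l_closed)
  qed
qed

text \<open>A nonzero multiple of the monic \<open>f\<close> has degree at least that of
  \<open>f\<close>, which is positive; so the only constant in (f) is zero.\<close>

lemma const_notin_Idl_irred_divisor:
  assumes f: "monic_irred_divisor R n f" and c: "c \<noteq> \<zero>"
  shows "const c \<notin> Idl\<^bsub>P\<^esub> {f}"
proof
  obtain d where d: "d \<ge> 1" "monic f d" using f unfolding monic_irred_divisor_iff by blast
  have fP: "f \<in> carrier P" using d by auto
  assume "const c \<in> Idl\<^bsub>P\<^esub> {f}"
  then obtain y where y: "y \<in> carrier P" "const c = y \<otimes>\<^bsub>P\<^esub> f"
    by (rule P.Idl_singletonE[OF _ fP])
  have "deg_below (const c) d" using d(1) by (simp add: deg_below_def)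
  then have "y = \<zero>\<^bsub>P\<^esub>" using y by (intro monic_mult_zero[OF d(2)]) simp_all
  then have "const c = \<zero>\<^bsub>P\<^esub>" using y(2) fP by simp
  then have "coeff P (const c) 0 = \<zero>" by simp
  then show False using c by simp
qed

text \<open>Modulo \<open>f\<close>, elements outside (f) are c^k1 r and c^k2 s with
  \<open>r\<close> and \<open>s\<close> remainders not divisible by \<open>c\<close>. If the product
  lies in (f), the powers of \<open>c\<close> cancel and r s lies in (f). But \<open>r\<close> is
  invertible modulo (f, c), so \<open>s\<close> would lie in (f, c) and be divisible by
  \<open>c\<close>.\<close>

lemma primeideal_Idl_irred_divisor:
  assumes f: "monic_irred_divisor R n f" and R: "domain R" and c: "c \<noteq> \<zero>"
  shows "primeideal (Idl\<^bsub>P\<^esub> {f}) P"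
proof (rule primeidealI)
  obtain d k where d: "monic f d" "monic_atom f" and k: "k \<in> carrier P" "xn_minus_one n = f \<otimes>\<^bsub>P\<^esub> k"
    using f unfolding monic_irred_divisor_iff factor_def by blast
  have fP: "f \<in> carrier P" using d by auto
  interpret F: ideal "Idl\<^bsub>P\<^esub> {f}" P by (rule Idl_singleton_ideal[OF fP])
  interpret dom: "domain" R by (rule R)
  show "ideal (Idl\<^bsub>P\<^esub> {f}) P" by (rule F.is_ideal)
  show "cring P" by (rule P.is_cring)
  show "carrier P \<noteq> Idl\<^bsub>P\<^esub> {f}"
    using const_notin_Idl_irred_divisor[OF f c] const_c_closed by blast
  have mult_mem: "y \<otimes>\<^bsub>P\<^esub> f \<in> Idl\<^bsub>P\<^esub> {f}" if "y \<in> carrier P" for y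
    using that Idl_singleton_ideal[OF fP] by (intro F.I_l_closed)
  fix a b assume aP: "a \<in> carrier P" and bP: "b \<in> carrier P" and ab: "a \<otimes>\<^bsub>P\<^esub> b \<in> Idl\<^bsub>P\<^esub> {f}"
  show "a \<in> Idl\<^bsub>P\<^esub> {f} \<or> b \<in> Idl\<^bsub>P\<^esub> {f}"
  proof (rule ccontr)
    assume "\<not> ?thesis"
    then have na: "a \<notin> Idl\<^bsub>P\<^esub> {f}" and nb: "b \<notin> Idl\<^bsub>P\<^esub> {f}" by auto
    have remainder: "\<exists>q k r. q \<in> carrier P \<and> r \<in> carrier P \<and> deg_below r d
        \<and> x = q \<otimes>\<^bsub>P\<^esub> f \<oplus>\<^bsub>P\<^esub> const (c [^] (k::nat)) \<otimes>\<^bsub>P\<^esub> r \<and> \<not> const c divides\<^bsub>P\<^esub> r"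
      if x: "x \<in> carrier P" "x \<notin> Idl\<^bsub>P\<^esub> {f}" for x
    proof -
      obtain q where q: "q \<in> carrier P" "deg_below (x \<ominus>\<^bsub>P\<^esub> q \<otimes>\<^bsub>P\<^esub> f) d"
        using monic_division[OF d(1) x(1)] by blast
      have "x \<ominus>\<^bsub>P\<^esub> q \<otimes>\<^bsub>P\<^esub> f \<noteq> \<zero>\<^bsub>P\<^esub>" using x q(1) fP mult_mem[OF q(1)] by auto
      from q(2) this obtain k r where r: "deg_below r d"
        "x \<ominus>\<^bsub>P\<^esub> q \<otimes>\<^bsub>P\<^esub> f = const (c [^] (k::nat)) \<otimes>\<^bsub>P\<^esub> r" "\<not> const c divides\<^bsub>P\<^esub> r"
        by (rule factor_out_c)
      have "x = q \<otimes>\<^bsub>P\<^esub> f \<oplus>\<^bsub>P\<^esub> (x \<ominus>\<^bsub>P\<^esub> q \<otimes>\<^bsub>P\<^esub> f)" using x(1) q(1) fP by algebra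
      then have "x = q \<otimes>\<^bsub>P\<^esub> f \<oplus>\<^bsub>P\<^esub> const (c [^] k) \<otimes>\<^bsub>P\<^esub> r" by (simp only: r(2))
      then show ?thesis using q(1) r(1,3) by blast
    qed
    obtain q1 k1 r where r: "q1 \<in> carrier P" "r \<in> carrier P" "deg_below r d"
        "a = q1 \<otimes>\<^bsub>P\<^esub> f \<oplus>\<^bsub>P\<^esub> const (c [^] (k1::nat)) \<otimes>\<^bsub>P\<^esub> r" "\<not> const c divides\<^bsub>P\<^esub> r"
      using remainder[OF aP na] by blast
    obtain q2 k2 s where s: "q2 \<in> carrier P" "s \<in> carrier P" "deg_below s d"
        "b = q2 \<otimes>\<^bsub>P\<^esub> f \<oplus>\<^bsub>P\<^esub> const (c [^] (k2::nat)) \<otimes>\<^bsub>P\<^esub> s" "\<not> const c divides\<^bsub>P\<^esub> s"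
      using remainder[OF bP nb] by blast
    let ?r = "const (c [^] k1)" and ?s = "const (c [^] k2)"
    define z where "z = c [^] k1 \<otimes> c [^] k2"
    have zR: "z \<in> carrier R" by (simp add: z_def)
    have "c [^] j \<noteq> \<zero>" for j :: nat
      using c one_not_zero by (induction j) (simp_all add: dom.integral_iff)
    then have z: "z \<noteq> \<zero>" by (simp add: z_def dom.integral_iff)
    have rs: "?r \<in> carrier P" "?s \<in> carrier P" by simp_all
    have rs_z: "?r \<otimes>\<^bsub>P\<^esub> ?s = const z" by (simp add: z_def const_mult_const)
    have "(?r \<otimes>\<^bsub>P\<^esub> ?s) \<otimes>\<^bsub>P\<^esub> (r \<otimes>\<^bsub>P\<^esub> s)
        = a \<otimes>\<^bsub>P\<^esub> b \<ominus>\<^bsub>P\<^esub> (q1 \<otimes>\<^bsub>P\<^esub> (q2 \<otimes>\<^bsub>P\<^esub> f \<oplus>\<^bsub>P\<^esub> ?s \<otimes>\<^bsub>P\<^esub> s) \<oplus>\<^bsub>P\<^esub> ?r \<otimes>\<^bsub>P\<^esub> r \<otimes>\<^bsub>P\<^esub> q2) \<otimes>\<^bsub>P\<^esub> f"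
      unfolding r(4) s(4) using r(1,2) s(1,2) rs fP by algebra
    also have "\<dots> \<in> Idl\<^bsub>P\<^esub> {f}"
      using ab r(1,2) s(1,2) rs fP by (intro F.minus_mem mult_mem) simp_all
    finally have "const z \<otimes>\<^bsub>P\<^esub> (r \<otimes>\<^bsub>P\<^esub> s) \<in> Idl\<^bsub>P\<^esub> {f}" unfolding rs_z .
    then obtain y where y: "y \<in> carrier P" "const z \<otimes>\<^bsub>P\<^esub> (r \<otimes>\<^bsub>P\<^esub> s) = y \<otimes>\<^bsub>P\<^esub> f"
      by (rule P.Idl_singletonE[OF _ fP])
    \<comment> \<open>This replaces Gauss's lemma: since \<open>f\<close> is monic, the constant
      \<open>z\<close> that divides y f already divides \<open>y\<close>, and can then be cancelled
      coefficientwise in the domain \<open>R\<close>.\<close>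
    have "const z divides\<^bsub>P\<^esub> y"
    proof (rule monic_mult_divides[OF d(1) y(1) zR])
      show "z divides coeff P (y \<otimes>\<^bsub>P\<^esub> f) i" for i
        unfolding y(2)[symmetric] using zR r(2) s(2)
        by (simp add: R.divides_mult_self del: coeff_mult)
    qed
    then obtain y' where y': "y' \<in> carrier P" "y = const z \<otimes>\<^bsub>P\<^esub> y'"
      unfolding factor_def by blast
    have "const z \<otimes>\<^bsub>P\<^esub> (r \<otimes>\<^bsub>P\<^esub> s) = const z \<otimes>\<^bsub>P\<^esub> (y' \<otimes>\<^bsub>P\<^esub> f)"
      unfolding y(2) y'(2) using zR y'(1) fP by (simp add: P.m_assoc)
    then have "z \<otimes> coeff P (r \<otimes>\<^bsub>P\<^esub> s) i = z \<otimes> coeff P (y' \<otimes>\<^bsub>P\<^esub> f) i" for i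
      using zR r(2) s(2) y'(1) fP coeff_const_mult[of z "r \<otimes>\<^bsub>P\<^esub> s" i]
        coeff_const_mult[of z "y' \<otimes>\<^bsub>P\<^esub> f" i] by (simp del: coeff_mult coeff_const_mult)
    then have eq: "r \<otimes>\<^bsub>P\<^esub> s = y' \<otimes>\<^bsub>P\<^esub> f"
      using z zR r(2) s(2) y'(1) fP
      by (intro up_eqI) (simp_all add: dom.m_lcancel del: coeff_mult)
    have "r \<notin> Idl\<^bsub>P\<^esub> {f, const c}"
      using Idl_monic_const_deg_below[OF d(1) _ r(3)] r(5) by blast
    then obtain u v w where uvw: "u \<in> carrier P" "v \<in> carrier P" "w \<in> carrier P"
      "\<one>\<^bsub>P\<^esub> = u \<otimes>\<^bsub>P\<^esub> f \<oplus>\<^bsub>P\<^esub> (v \<otimes>\<^bsub>P\<^esub> r \<oplus>\<^bsub>P\<^esub> w \<otimes>\<^bsub>P\<^esub> const c)"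
      by (rule monic_atom_insert[OF d k r(2)])
    \<comment> \<open>The Bezout identity for \<open>r\<close> is multiplied by \<open>s\<close>,
      and r s is replaced by a multiple of \<open>f\<close>.\<close>
    have "s = \<one>\<^bsub>P\<^esub> \<otimes>\<^bsub>P\<^esub> s" using s(2) by simp
    also have "\<dots> = u \<otimes>\<^bsub>P\<^esub> s \<otimes>\<^bsub>P\<^esub> f \<oplus>\<^bsub>P\<^esub> v \<otimes>\<^bsub>P\<^esub> (r \<otimes>\<^bsub>P\<^esub> s) \<oplus>\<^bsub>P\<^esub> w \<otimes>\<^bsub>P\<^esub> s \<otimes>\<^bsub>P\<^esub> const c"
      unfolding uvw(4) using uvw(1-3) r(2) s(2) fP const_c_closed by algebra
    also have "\<dots> = (u \<otimes>\<^bsub>P\<^esub> s \<oplus>\<^bsub>P\<^esub> v \<otimes>\<^bsub>P\<^esub> y') \<otimes>\<^bsub>P\<^esub> f \<oplus>\<^bsub>P\<^esub> (w \<otimes>\<^bsub>P\<^esub> s) \<otimes>\<^bsub>P\<^esub> const c"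
      unfolding eq using uvw(1-3) s(2) y'(1) fP const_c_closed by algebra
    finally have s_eq: "s = (u \<otimes>\<^bsub>P\<^esub> s \<oplus>\<^bsub>P\<^esub> v \<otimes>\<^bsub>P\<^esub> y') \<otimes>\<^bsub>P\<^esub> f \<oplus>\<^bsub>P\<^esub> (w \<otimes>\<^bsub>P\<^esub> s) \<otimes>\<^bsub>P\<^esub> const c" .
    interpret M: ideal "Idl\<^bsub>P\<^esub> {f, const c}" P by (rule Idl_monic_const_ideal[OF d(1)])
    have "s \<in> Idl\<^bsub>P\<^esub> {f, const c}"
      by (subst s_eq) (use Idl_monic_const_ideal(2,3)[OF d(1)] uvw(1-3) s(2) y'(1) in
        \<open>simp add: M.I_l_closed\<close>)
    then show False
      using Idl_monic_const_deg_below[OF d(1) _ s(3)] s(5) by blast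
  qed
qed

lemma I_ideal: "ideal I P" "xn_minus_one n \<in> I"
  by (simp_all add: Idl_singleton_ideal)

lemma I_subset_iff: "ideal Q P \<Longrightarrow> I \<subseteq> Q \<longleftrightarrow> xn_minus_one n \<in> Q"
  using P.genideal_minimal[of Q "{xn_minus_one n}"] I_ideal(2) by auto

lemma cyclic_quot_eq: "cyclic_quot R n = P Quot I"
  by (simp add: cyclic_quot_def xn_minus_1_eq P_def)

lemma cyclic_class_eq: "cyclic_class R n = (+>\<^bsub>P\<^esub>) I"
  by (rule ext) (simp add: cyclic_class_def xn_minus_1_eq P_def)

lemma image_ideal_eq:
  assumes "F \<subseteq> carrier P"
  shows "image_ideal R n F = cyclic_class R n ` (Idl\<^bsub>P\<^esub> F)"
proof -
  interpret I: ideal I P by (rule I_ideal)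
  interpret phi: ring_hom_ring P "P Quot I" "(+>\<^bsub>P\<^esub>) I" by (rule I.rcos_ring_hom_ring)
  show ?thesis
    using phi.Idl_image[OF assms I.rcos_image_carrier]
    by (simp add: image_ideal_def cyclic_quot_eq cyclic_class_eq)
qed

lemma primeideal_image_iff:
  assumes "ideal Q P" "xn_minus_one n \<in> Q"
  shows "primeideal (cyclic_class R n ` Q) (cyclic_quot R n) \<longleftrightarrow> primeideal Q P"
  using ideal.primeideal_rcos_image_iff[OF I_ideal(1) assms(1) _ P.is_cring] assms
  by (simp add: cyclic_quot_eq cyclic_class_eq I_subset_iff)

lemma ideal_cyclic_quot_cases:
  assumes "ideal A (cyclic_quot R n)"
  obtains Q where "ideal Q P" "xn_minus_one n \<in> Q" "A = cyclic_class R n ` Q"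
proof -
  have "A \<in> (\<lambda>J. (+>\<^bsub>P\<^esub>) I ` J) ` {J. ideal J P \<and> I \<subseteq> J}"
    using P.quot_ideal_correspondence[OF I_ideal(1)] assms
    by (simp add: bij_betw_def cyclic_quot_eq)
  then show ?thesis using that by (auto simp: cyclic_class_eq I_subset_iff)
qed

lemma irred_divisor_ideal:
  assumes "monic_irred_divisor R n f"
  shows "f \<in> carrier P" "xn_minus_one n \<in> Idl\<^bsub>P\<^esub> {f}" "xn_minus_one n \<in> Idl\<^bsub>P\<^esub> {f, const c}"
proof -
  obtain k where k: "k \<in> carrier P" "xn_minus_one n = f \<otimes>\<^bsub>P\<^esub> k" and fP: "f \<in> carrier P"
    using assms unfolding monic_irred_divisor_iff factor_def by auto
  show "f \<in> carrier P" by (rule fP)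
  have *: "xn_minus_one n \<in> J" if "ideal J P" "f \<in> J" for J
    unfolding k(2) using that k(1) by (simp add: ideal.I_r_closed)
  show "xn_minus_one n \<in> Idl\<^bsub>P\<^esub> {f}"
    by (rule *) (rule Idl_singleton_ideal[OF fP])+
  show "xn_minus_one n \<in> Idl\<^bsub>P\<^esub> {f, const c}"
    using assms unfolding monic_irred_divisor_iff by (auto intro!: * Idl_monic_const_ideal)
qed

lemma primeideal_image_irred_divisor_const:
  assumes f: "monic_irred_divisor R n f"
  shows "primeideal (image_ideal R n {f, const c}) (cyclic_quot R n)"
proof -
  note M = maximalideal_irred_divisor[OF f]
  have "primeideal (Idl\<^bsub>P\<^esub> {f, const c}) P" by (rule P.maximalideal_prime[OF M])
  moreover have "ideal (Idl\<^bsub>P\<^esub> {f, const c}) P" using M by (rule maximalideal.axioms)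
  ultimately show ?thesis
    using primeideal_image_iff irred_divisor_ideal[OF f] by (simp add: image_ideal_eq)
qed

lemma primeideal_image_irred_divisor:
  assumes f: "monic_irred_divisor R n f" and "domain R" "c \<noteq> \<zero>"
  shows "primeideal (image_ideal R n {f}) (cyclic_quot R n)"
  using primeideal_image_iff[OF Idl_singleton_ideal(1)] irred_divisor_ideal[OF f]
    primeideal_Idl_irred_divisor[OF assms] by (simp add: image_ideal_eq)

text \<open>(f, c) lies strictly between (f) and the whole ring: it contains \<open>const c\<close>,
  which (f) does not, and it omits 1. Both ideals contain \<open>I\<close>, so the inclusions stay
  strict in the quotient.\<close>

lemma not_maximalideal_image_irred_divisor:
  assumes f: "monic_irred_divisor R n f" and c: "c \<noteq> \<zero>"
  shows "\<not> maximalideal (image_ideal R n {f}) (cyclic_quot R n)"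
proof
  interpret I: ideal I P by (rule I_ideal)
  note fP = irred_divisor_ideal(1)[OF f]
  let ?phi = "(+>\<^bsub>P\<^esub>) I"
  have F: "ideal (Idl\<^bsub>P\<^esub> {f}) P" "I \<subseteq> Idl\<^bsub>P\<^esub> {f}"
    using I_subset_iff Idl_singleton_ideal[OF fP] irred_divisor_ideal[OF f] by auto
  interpret M: maximalideal "Idl\<^bsub>P\<^esub> {f, const c}" P by (rule maximalideal_irred_divisor[OF f])
  have MI: "I \<subseteq> Idl\<^bsub>P\<^esub> {f, const c}"
    using I_subset_iff[OF M.is_ideal] irred_divisor_ideal[OF f] by simp
  have mem: "f \<in> Idl\<^bsub>P\<^esub> {f, const c}" "const c \<in> Idl\<^bsub>P\<^esub> {f, const c}"
    using P.genideal_self[of "{f, const c}"] fP by auto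
  assume "maximalideal (image_ideal R n {f}) (cyclic_quot R n)"
  then interpret A: maximalideal "?phi ` (Idl\<^bsub>P\<^esub> {f})" "P Quot I"
    using fP by (simp add: image_ideal_eq cyclic_quot_eq cyclic_class_eq)
  have "Idl\<^bsub>P\<^esub> {f} \<subseteq> Idl\<^bsub>P\<^esub> {f, const c}"
    using mem by (intro P.genideal_minimal M.is_ideal) simp
  then have "?phi ` (Idl\<^bsub>P\<^esub> {f}) \<subseteq> ?phi ` (Idl\<^bsub>P\<^esub> {f, const c})" by (rule image_mono)
  moreover have "?phi ` (Idl\<^bsub>P\<^esub> {f, const c}) \<subseteq> carrier (P Quot I)"
    unfolding I.rcos_image_carrier[symmetric] using M.Icarr by blast
  ultimately have "?phi ` (Idl\<^bsub>P\<^esub> {f, const c}) = ?phi ` (Idl\<^bsub>P\<^esub> {f})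
      \<or> ?phi ` (Idl\<^bsub>P\<^esub> {f, const c}) = carrier (P Quot I)"
    using A.I_maximal P.ring_ideal_imp_quot_ideal[OF I_ideal(1) M.is_ideal] by blast
  then show False
  proof
    assume eq: "?phi ` (Idl\<^bsub>P\<^esub> {f, const c}) = ?phi ` (Idl\<^bsub>P\<^esub> {f})"
    have "?phi (const c) \<in> ?phi ` (Idl\<^bsub>P\<^esub> {f})" unfolding eq[symmetric] using mem(2) by (rule imageI)
    then show False
      using I.rcos_image_mem_iff[OF F] const_notin_Idl_irred_divisor[OF f c] by simp
  next
    assume eq: "?phi ` (Idl\<^bsub>P\<^esub> {f, const c}) = carrier (P Quot I)"
    have "?phi \<one>\<^bsub>P\<^esub> \<in> ?phi ` (Idl\<^bsub>P\<^esub> {f, const c})"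
      unfolding eq I.rcos_image_carrier[symmetric] by simp
    then have "\<one>\<^bsub>P\<^esub> \<in> Idl\<^bsub>P\<^esub> {f, const c}"
      using I.rcos_image_mem_iff[OF M.is_ideal MI] by simp
    then show False using M.one_imp_carrier M.I_notcarr by simp
  qed
qed

text \<open>A prime ideal contains all nilpotent elements, in particular \<open>const c\<close>, so
  \<open>primeideal_with_const\<close> always applies.\<close>

lemma primeideal_cyclic_quot_nilpotent:
  assumes A: "ideal A (cyclic_quot R n)" and nil: "c [^] (a::nat) = \<zero>"
  shows "primeideal A (cyclic_quot R n) \<longleftrightarrow>
    (\<exists>f. monic_irred_divisor R n f \<and> A = image_ideal R n {f, const c})"
proof
  obtain Q where Q: "ideal Q P" "xn_minus_one n \<in> Q" "A = cyclic_class R n ` Q"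
    by (rule ideal_cyclic_quot_cases[OF A])
  assume "primeideal A (cyclic_quot R n)"
  then have prime: "primeideal Q P" using primeideal_image_iff[OF Q(1,2)] Q(3) by simp
  then interpret Q: primeideal Q P .
  have "const c [^]\<^bsub>P\<^esub> a = \<zero>\<^bsub>P\<^esub>" by (simp only: const_pow c_closed nil monom_zero)
  then have "const c [^]\<^bsub>P\<^esub> a \<in> Q" by (simp only: Q.zero_closed)
  then have "const c \<in> Q" by (rule Q.pow_memD[OF const_c_closed])
  then obtain f where "monic_irred_divisor R n f" "Q = Idl\<^bsub>P\<^esub> {f, const c}"
    using primeideal_with_const[OF prime Q(2)] by blast
  then show "\<exists>f. monic_irred_divisor R n f \<and> A = image_ideal R n {f, const c}"
    using Q(3) irred_divisor_ideal(1) by (auto simp: image_ideal_eq)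
qed (use primeideal_image_irred_divisor_const in blast)

text \<open>The two shapes correspond to the preimage of \<open>A\<close> containing
  \<open>const c\<close> or not.\<close>

lemma primeideal_cyclic_quot_domain:
  assumes A: "ideal A (cyclic_quot R n)" and R: "domain R" and c: "c \<noteq> \<zero>"
  shows "primeideal A (cyclic_quot R n) \<longleftrightarrow>
    (\<exists>f. monic_irred_divisor R n f \<and>
      (A = image_ideal R n {f, const c} \<or> A = image_ideal R n {f}))"
proof
  obtain Q where Q: "ideal Q P" "xn_minus_one n \<in> Q" "A = cyclic_class R n ` Q"
    by (rule ideal_cyclic_quot_cases[OF A])
  assume "primeideal A (cyclic_quot R n)"
  then have prime: "primeideal Q P" using primeideal_image_iff[OF Q(1,2)] Q(3) by simp
  have "\<exists>f. monic_irred_divisor R n f \<and> (Q = Idl\<^bsub>P\<^esub> {f, const c} \<or> Q = Idl\<^bsub>P\<^esub> {f})"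
  proof (cases "const c \<in> Q")
    case True
    then show ?thesis using primeideal_with_const[OF prime Q(2)] by blast
  next
    case False
    obtain f where "monic_irred_divisor R n f" "f \<in> Q"
      by (rule primeideal_contains_irred_divisor[OF prime Q(2)])
    then show ?thesis using primeideal_without_const[OF prime _ _ False] by blast
  qed
  then show "\<exists>f. monic_irred_divisor R n f \<and>
      (A = image_ideal R n {f, const c} \<or> A = image_ideal R n {f})"
    using Q(3) irred_divisor_ideal(1) by (auto simp: image_ideal_eq)
qed (use primeideal_image_irred_divisor_const primeideal_image_irred_divisor R c in blast)

end

section \<open>The two coefficient rings\<close>

context cring
begin

lemma divides_pow_telescope:
  assumes c: "c \<in> carrier R" and X: "\<And>k. X k \<in> carrier R"
    and step: "\<And>k::nat. c [^] k divides (X (Suc k) \<ominus> X k)"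
  shows "c [^] k divides (X (k + j) \<ominus> X k)"
proof (induction j)
  case 0
  then show ?case using c X by (simp add: minus_eq r_neg divides_zero)
next
  case (Suc j)
  have "c [^] k divides (X (Suc (k + j)) \<ominus> X (k + j))"
  proof -
    obtain y where y: "y \<in> carrier R" "X (Suc (k + j)) \<ominus> X (k + j) = c [^] (k + j) \<otimes> y"
      using step[of "k + j"] unfolding factor_def by blast
    have "c [^] (k + j) \<otimes> y = c [^] k \<otimes> (c [^] j \<otimes> y)"
      using c y(1) by (simp add: nat_pow_mult[symmetric] m_assoc)
    then show ?thesis using c y by (simp add: divides_mult_self)
  qed
  then have "c [^] k divides ((X (Suc (k + j)) \<ominus> X (k + j)) \<oplus> (X (k + j) \<ominus> X k))"
    using Suc c by (intro divides_add) simp_all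
  also have "(X (Suc (k + j)) \<ominus> X (k + j)) \<oplus> (X (k + j) \<ominus> X k) = X (Suc (k + j)) \<ominus> X k"
    using X[of "Suc (k + j)"] X[of "k + j"] X[of k] by algebra
  finally show ?case by simp
qed

text \<open>From index \<open>a\<close> on the sequence is constant, because c^a = 0 divides the
  later differences; hence \<open>X a\<close> serves as the limit.\<close>

lemma nilpotent_complete:
  assumes c: "c \<in> carrier R" and nil: "c [^] (a::nat) = \<zero>" and X: "\<And>k. X k \<in> carrier R"
    and step: "\<And>k::nat. c [^] k divides (X (Suc k) \<ominus> X k)"
  shows "\<exists>y\<in>carrier R. \<forall>k. c [^] k divides (y \<ominus> X k)"
proof (intro bexI allI)
  fix k :: nat
  show "c [^] k divides (X a \<ominus> X k)"
  proof (cases "k \<le> a")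
    case True
    then show ?thesis using divides_pow_telescope[OF c X step, of k "a - k"] by simp
  next
    case False
    then have "\<zero> divides (X k \<ominus> X a)"
      using divides_pow_telescope[OF c X step, of a "k - a"] nil by simp
    then have "X k \<ominus> X a = \<zero>" using X unfolding factor_def by auto
    then have "X k = X a" using X by simp
    then show ?thesis using c X by (simp add: minus_eq r_neg divides_zero)
  qed
qed (rule X)

end

text \<open>As for a discrete valuation: by separatedness only finitely many powers of
  \<open>c\<close> divide \<open>x\<close>. The cofactor of the largest one is not divisible by
  \<open>c\<close>, hence a unit.\<close>

lemma (in complete_local_UP) unit_times_power:
  assumes x: "x \<in> carrier R" "x \<noteq> \<zero>"
  obtains k u where "u \<in> Units R" "x = c [^] (k::nat) \<otimes> u"
proof -
  have "\<exists>j::nat. \<not> c [^] j divides x" using separated x by blast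
  then have q: "\<not> c [^] (LEAST j::nat. \<not> c [^] j divides x) divides x" by (rule LeastI_ex)
  have "c [^] (0::nat) divides x" using x(1) by (auto simp: factor_def)
  then have "(LEAST j::nat. \<not> c [^] j divides x) \<noteq> 0" using q by metis
  then obtain k where k: "(LEAST j::nat. \<not> c [^] j divides x) = Suc k" using not0_implies_Suc by blast
  then have "c [^] k divides x" using not_less_Least[of k "\<lambda>j. \<not> c [^] j divides x"] by simp
  then obtain u where u: "u \<in> carrier R" "x = c [^] k \<otimes> u" unfolding factor_def by blast
  have "\<not> c divides u"
  proof
    assume "c divides u"
    then obtain v where "v \<in> carrier R" "x = c [^] Suc k \<otimes> v"
      using u by (auto simp: factor_def R.m_assoc)
    then have "c [^] Suc k divides x" unfolding factor_def by blast
    then show False using q k by simp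
  qed
  then show ?thesis using that local u by blast
qed

text \<open>If two nonzero elements had product zero, removing their unit parts would make a power
  of \<open>c\<close> zero.\<close>

lemma (in complete_local_UP) domain_if_not_nilpotent:
  assumes c: "\<And>k::nat. c [^] k \<noteq> \<zero>"
  shows "domain R"
proof (intro domain.intro domain_axioms.intro)
  show "cring R" by (rule R.is_cring)
  show "\<one> \<noteq> \<zero>" by (rule one_not_zero)
  fix x y assume xy: "x \<otimes> y = \<zero>" "x \<in> carrier R" "y \<in> carrier R"
  show "x = \<zero> \<or> y = \<zero>"
  proof (rule ccontr)
    assume "\<not> ?thesis"
    then have "x \<noteq> \<zero>" "y \<noteq> \<zero>" by auto
    then obtain k u j v where u: "u \<in> Units R" "x = c [^] (k::nat) \<otimes> u"
      and v: "v \<in> Units R" "y = c [^] (j::nat) \<otimes> v"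
      using unit_times_power xy(2,3) by metis
    have cl: "u \<in> carrier R" "v \<in> carrier R" "c [^] k \<in> carrier R" "c [^] j \<in> carrier R"
      "inv u \<in> carrier R" "inv v \<in> carrier R"
      using u v by (simp_all add: R.Units_closed)
    have "c [^] (k + j) = c [^] k \<otimes> c [^] j \<otimes> (u \<otimes> inv u) \<otimes> (v \<otimes> inv v)"
      using u v cl by (simp add: R.nat_pow_mult)
    also have "\<dots> = (x \<otimes> y) \<otimes> inv u \<otimes> inv v"
      unfolding u(2) v(2) using cl by algebra
    finally show False using c cl xy(1) by simp
  qed
qed

section \<open>The residue rings of integers modulo p^a\<close>

context residues
begin

lemma nat_mult_one: "[k] \<cdot> \<one> = int k mod m"
  by (induction k) (simp_all add: res_zero_eq res_one_eq res_add_eq mod_simps add.commute)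

end

text \<open>Since p divides the modulus, reduction modulo p^a does not affect divisibility by p, and
  the locale assumptions become statements about integers. For \<open>a = 1\<close> the element
  \<open>c\<close> is 0 and \<open>S\<close> is the prime field. Separatedness is read off at
  exponent \<open>a\<close>, where c^a = 0.\<close>

lemma cyclic_UP_residue_ring:
  fixes p n a :: nat
  assumes p: "prime p" and n: "n \<ge> 1" "coprime n p" and a: "a \<ge> 1"
  defines "S \<equiv> residue_ring (int (p ^ a))"
  shows "cyclic_UP S ([p] \<cdot>\<^bsub>S\<^esub> \<one>\<^bsub>S\<^esub>) n"
    and "([p] \<cdot>\<^bsub>S\<^esub> \<one>\<^bsub>S\<^esub>) [^]\<^bsub>S\<^esub> a = \<zero>\<^bsub>S\<^esub>"
proof -
  let ?m = "int (p ^ a)"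
  have p1: "p > 1" using prime_gt_1_nat[OF p] .
  have m1: "?m > 1"
    using p1 a by (metis of_nat_1 of_nat_less_iff one_less_power zero_less_iff_neq_zero not_one_le_zero)
  interpret S: residues ?m S by unfold_locales (use m1 in \<open>simp_all add: S_def\<close>)
  let ?c = "[p] \<cdot>\<^bsub>S\<^esub> \<one>\<^bsub>S\<^esub>"
  have c: "?c = int p mod ?m" by (rule S.nat_mult_one)
  have cS: "?c \<in> carrier S" by simp
  have pm: "int p dvd ?m" using a by simp
  have pc: "int p dvd ?c" unfolding c using pm by (simp add: dvd_mod)
  have cdvd: "?c divides\<^bsub>S\<^esub> x \<longleftrightarrow> int p dvd x" if x: "x \<in> carrier S" for x
  proof
    assume "?c divides\<^bsub>S\<^esub> x"
    then obtain y where "x = (?c * y) mod ?m" unfolding factor_def by (auto simp: S.res_mult_eq)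
    then show "int p dvd x" using pc pm by (simp add: dvd_mod)
  next
    assume "int p dvd x"
    then obtain y where y: "x = int p * y" by blast
    have "x = (?c * (y mod ?m)) mod ?m"
      using x unfolding c y by (simp add: mod_simps S.res_carrier_eq y)
    then have "x = ?c \<otimes>\<^bsub>S\<^esub> (y mod ?m)" by (simp only: S.res_mult_eq)
    moreover have "y mod ?m \<in> carrier S" by (rule S.mod_in_carrier)
    ultimately show "?c divides\<^bsub>S\<^esub> x" unfolding factor_def by blast
  qed
  have unit: "x \<in> Units S" if "x \<in> carrier S" "\<not> int p dvd x" for x
  proof -
    have "coprime (int p) x" using that(2) p by (simp add: prime_imp_coprime)
    then have "coprime x ?m" by (simp add: coprime_commute)
    moreover have "x \<noteq> 0" using that(2) by auto
    ultimately show ?thesis using that(1) by (auto simp: S.res_units_eq S.res_carrier_eq)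
  qed
  show nil: "?c [^]\<^bsub>S\<^esub> a = \<zero>\<^bsub>S\<^esub>"
    unfolding c S.pow_cong by (simp add: S.res_zero_eq)
  show "cyclic_UP S ?c n"
  proof (unfold_locales)
    show "?c \<in> carrier S" by (rule cS)
    show "?c \<notin> Units S"
    proof
      assume "?c \<in> Units S"
      then have "coprime ?c ?m" by (simp add: S.res_units_eq)
      then have "is_unit (int p)" using pc pm coprime_common_divisor by blast
      then show False using p1 by simp
    qed
    show "x \<in> Units S" if "x \<in> carrier S" "\<not> ?c divides\<^bsub>S\<^esub> x" for x
      using that unit cdvd by blast
    show "x = \<zero>\<^bsub>S\<^esub>" if x: "x \<in> carrier S" "\<And>k::nat. ?c [^]\<^bsub>S\<^esub> k divides\<^bsub>S\<^esub> x" for x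
      using x(2)[of a] unfolding nil factor_def by auto
    show "\<exists>y\<in>carrier S. \<forall>k. ?c [^]\<^bsub>S\<^esub> k divides\<^bsub>S\<^esub> (y \<ominus>\<^bsub>S\<^esub> X k)"
      if "\<And>k. X k \<in> carrier S" "\<And>k::nat. ?c [^]\<^bsub>S\<^esub> k divides\<^bsub>S\<^esub> (X (Suc k) \<ominus>\<^bsub>S\<^esub> X k)" for X
      by (rule S.nilpotent_complete[OF cS nil that])
    show "n \<ge> 1" by (rule n)
    have "\<not> p dvd n"
      using n(2) p1 by (metis coprime_absorb_right coprime_commute nat_dvd_1_iff_1 less_irrefl)
    then have "\<not> int p dvd int n mod ?m" using pm by (simp add: dvd_mod_iff)
    then show "[n] \<cdot>\<^bsub>S\<^esub> \<one>\<^bsub>S\<^esub> \<in> Units S"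
      by (intro unit) (simp_all only: S.nat_mult_one S.mod_in_carrier not_False_eq_True)
  qed
qed

section \<open>The ring of p-adic integers\<close>

context
  fixes p :: nat and S :: "(nat \<Rightarrow> int) ring"
  assumes p: "prime p"
  defines "S \<equiv> padic_int_ring p"
begin

lemma padic_pos: "int p ^ k > 0"
  using prime_gt_0_nat[OF p] by simp

lemma padic_cring: "cring S"
  unfolding S_def using p by (intro padic_int_ring_cring prime_gt_0_nat)

interpretation S: cring S by (rule padic_cring)

lemma padic_carrier:
  "x \<in> carrier S \<longleftrightarrow> (\<forall>k. 0 \<le> x k \<and> x k < int p ^ k \<and> x (Suc k) mod int p ^ k = x k)"
  by (auto simp: S_def padic_int_ring_def)

lemma padic_simps:
  "(x \<otimes>\<^bsub>S\<^esub> y) k = (x k * y k) mod int p ^ k"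
  "(x \<oplus>\<^bsub>S\<^esub> y) k = (x k + y k) mod int p ^ k"
  "\<one>\<^bsub>S\<^esub> k = 1 mod int p ^ k"
  "\<zero>\<^bsub>S\<^esub> k = 0"
  by (simp_all add: S_def padic_int_ring_def)

lemma padic_range:
  assumes "x \<in> carrier S"
  shows "0 \<le> x k" "x k < int p ^ k" "x k mod int p ^ k = x k"
  using assms by (simp_all add: padic_carrier)

lemma padic_coherent:
  assumes "x \<in> carrier S"
  shows "x (k + j) mod int p ^ k = x k"
proof (induction j)
  case (Suc j)
  have "int p ^ k dvd int p ^ (k + j)" by (simp add: power_add)
  then have "x (Suc (k + j)) mod int p ^ k = (x (Suc (k + j)) mod int p ^ (k + j)) mod int p ^ k"
    by (simp add: mod_mod_cancel)
  also have "x (Suc (k + j)) mod int p ^ (k + j) = x (k + j)" using assms by (simp add: padic_carrier)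
  finally show ?case using Suc by simp
qed (use assms padic_range in simp)

lemma padic_carrierI:
  assumes "\<And>k. [f (Suc k) = f k] (mod int p ^ k)"
  shows "(\<lambda>k. f k mod int p ^ k) \<in> carrier S"
  unfolding padic_carrier
proof (intro allI conjI)
  fix k
  have "int p ^ k dvd int p ^ Suc k" by simp
  then have "f (Suc k) mod int p ^ Suc k mod int p ^ k = f (Suc k) mod int p ^ k"
    by (rule mod_mod_cancel)
  then show "f (Suc k) mod int p ^ Suc k mod int p ^ k = f k mod int p ^ k"
    using assms[of k] by (simp add: cong_def)
qed (use padic_pos in simp_all)

lemma padic_nat_mult_one: "([j] \<cdot>\<^bsub>S\<^esub> \<one>\<^bsub>S\<^esub>) k = int j mod int p ^ k"
  by (induction j) (simp_all add: padic_simps mod_simps add.commute)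

lemma padic_pow: "(x [^]\<^bsub>S\<^esub> j) k = x k ^ j mod int p ^ k"
  by (induction j) (simp_all add: padic_simps mod_simps mult.commute)

lemma padic_p_pow: "(([p] \<cdot>\<^bsub>S\<^esub> \<one>\<^bsub>S\<^esub>) [^]\<^bsub>S\<^esub> j) k = int p ^ j mod int p ^ k"
  by (simp add: padic_pow padic_nat_mult_one power_mod)

text \<open>Reduces divisibility by a power of p to the vanishing of a single residue, so that
  locality, separatedness and completeness become statements about coordinates.\<close>

lemma padic_p_pow_divides_iff:
  assumes x: "x \<in> carrier S"
  shows "([p] \<cdot>\<^bsub>S\<^esub> \<one>\<^bsub>S\<^esub>) [^]\<^bsub>S\<^esub> j divides\<^bsub>S\<^esub> x \<longleftrightarrow> x j = 0"
proof
  assume "([p] \<cdot>\<^bsub>S\<^esub> \<one>\<^bsub>S\<^esub>) [^]\<^bsub>S\<^esub> j divides\<^bsub>S\<^esub> x"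
  then obtain y where "x = ([p] \<cdot>\<^bsub>S\<^esub> \<one>\<^bsub>S\<^esub>) [^]\<^bsub>S\<^esub> j \<otimes>\<^bsub>S\<^esub> y" unfolding factor_def by blast
  then show "x j = 0" by (simp add: padic_simps padic_p_pow)
next
  assume x0: "x j = 0"
  \<comment> \<open>The index is shifted by \<open>j\<close>, because dividing by p^j costs
    \<open>j\<close> digits of precision: the quotient modulo p^k is determined by \<open>x\<close>
    modulo p^(j + k).\<close>
  define y where "y k = x (j + k) div int p ^ j" for k
  have y: "y (Suc k) mod int p ^ k = y k" for k
  proof -
    have "x (j + k) = x (j + k + 1) mod (int p ^ j * int p ^ k)"
      using padic_coherent[OF x, of "j + k" 1] by (simp add: power_add)
    also have "\<dots> = int p ^ j * (x (j + k + 1) div int p ^ j mod int p ^ k) + x (j + k + 1) mod int p ^ j"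
      using padic_pos[of k] by (intro zmod_zmult2_eq) simp
    also have "x (j + k + 1) mod int p ^ j = 0"
      using padic_coherent[OF x, of j "k + 1"] x0 by (simp add: add.assoc)
    finally show ?thesis using padic_pos[of j] by (simp add: y_def)
  qed
  have "y k < int p ^ k" for k
  proof -
    have "int p ^ j * y k \<le> x (j + k)"
      using mult_div_mod_eq[of "int p ^ j" "x (j + k)"] padic_pos[of j]
      by (simp add: y_def minus_mod_eq_mult_div[symmetric])
    also have "\<dots> < int p ^ j * int p ^ k"
      using padic_range(2)[OF x, of "j + k"] by (simp add: power_add)
    finally show ?thesis using mult_less_cancel_left_pos[OF padic_pos] by blast
  qed
  then have yS: "y \<in> carrier S"
    unfolding padic_carrier using y padic_range(1)[OF x] padic_pos
    by (auto simp: y_def pos_imp_zdiv_nonneg_iff)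
  have "x k = (([p] \<cdot>\<^bsub>S\<^esub> \<one>\<^bsub>S\<^esub>) [^]\<^bsub>S\<^esub> j \<otimes>\<^bsub>S\<^esub> y) k" for k
  proof -
    have "int p ^ j dvd x (j + k)" using padic_coherent[OF x, of j k] x0 by auto
    then have "int p ^ j * y k = x (j + k)" by (simp add: y_def)
    then show ?thesis
      using padic_coherent[OF x, of k j]
      by (simp add: padic_simps padic_p_pow mod_simps add.commute)
  qed
  then show "([p] \<cdot>\<^bsub>S\<^esub> \<one>\<^bsub>S\<^esub>) [^]\<^bsub>S\<^esub> j divides\<^bsub>S\<^esub> x" using yS unfolding factor_def by blast
qed

text \<open>The additive inverse is given only abstractly by the ring structure, so the coordinates
  of the difference are recovered from (x - y) + y = x.\<close>

lemma padic_minus_eq_0_iff: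
  assumes x: "x \<in> carrier S" and y: "y \<in> carrier S"
  shows "(x \<ominus>\<^bsub>S\<^esub> y) k = 0 \<longleftrightarrow> x k = y k"
proof -
  let ?d = "x \<ominus>\<^bsub>S\<^esub> y"
  have d: "?d \<in> carrier S" using x y by simp
  have "?d \<oplus>\<^bsub>S\<^esub> y = x" using x y by algebra
  then have eq: "x k = (?d k + y k) mod int p ^ k" using padic_simps(2)[of ?d y k] by simp
  show ?thesis
  proof
    assume "?d k = 0"
    then show "x k = y k" using eq padic_range(3)[OF y, of k] by simp
  next
    assume "x k = y k"
    then have "(?d k + y k) mod int p ^ k = (0 + y k) mod int p ^ k"
      using eq padic_range(3)[OF y, of k] by simp
    then have "?d k mod int p ^ k = 0 mod int p ^ k"
      by (metis cong_add_rcancel cong_def)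
    then show "?d k = 0" using padic_range(3)[OF d, of k] by simp
  qed
qed

text \<open>The coordinate 1 is the residue modulo p, so every \<open>x k\<close> is prime to p.
  Inverses are chosen independently at each level; they are coherent because an inverse modulo p^k
  is unique modulo p^k.\<close>

lemma padic_unit:
  assumes x: "x \<in> carrier S" and x1: "x 1 \<noteq> 0"
  shows "x \<in> Units S"
proof -
  have cop: "coprime (x k) (int p ^ k)" for k
  proof (cases k)
    case (Suc i)
    have "\<not> int p dvd x (1 + i)"
      using padic_coherent[OF x, of 1 i] x1 by auto
    then have "coprime (int p) (x k)" using Suc p by (simp add: prime_imp_coprime)
    then show ?thesis by (simp add: coprime_commute)
  qed simp
  have "\<exists>z. [x k * z = 1] (mod int p ^ k)" for k
    using cop cong_solve_coprime_int by blast
  then obtain z where z: "\<And>k. [x k * z k = 1] (mod int p ^ k)" by metis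
  have "(\<lambda>k. z k mod int p ^ k) \<in> carrier S"
  proof (rule padic_carrierI)
    fix k
    have "[x (Suc k) * z (Suc k) = 1] (mod int p ^ k)"
      using z[of "Suc k"] by (rule cong_dvd_modulus) simp
    moreover have "[x (Suc k) = x k] (mod int p ^ k)"
      using padic_coherent[OF x, of k 1] by (simp add: cong_def padic_range[OF x])
    ultimately have "[x k * z (Suc k) = 1] (mod int p ^ k)"
      by (metis cong_scalar_right cong_sym cong_trans)
    then have "[x k * z (Suc k) = x k * z k] (mod int p ^ k)"
      using z[of k] cong_sym cong_trans by blast
    then show "[z (Suc k) = z k] (mod int p ^ k)"
      using cong_mult_lcancel[OF cop] by blast
  qed
  moreover have "x \<otimes>\<^bsub>S\<^esub> (\<lambda>k. z k mod int p ^ k) = \<one>\<^bsub>S\<^esub>"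
    using z by (intro ext) (simp add: padic_simps mod_simps cong_def)
  ultimately show ?thesis using S.Units_oneI x by blast
qed

lemma cyclic_UP_padic:
  assumes n: "n \<ge> 1" "coprime n p"
  shows "cyclic_UP S ([p] \<cdot>\<^bsub>S\<^esub> \<one>\<^bsub>S\<^esub>) n"
proof unfold_locales
  let ?c = "[p] \<cdot>\<^bsub>S\<^esub> \<one>\<^bsub>S\<^esub>"
  have p1: "int p > 1" using prime_gt_1_nat[OF p] by simp
  have cdvd: "?c divides\<^bsub>S\<^esub> x \<longleftrightarrow> x 1 = 0" if "x \<in> carrier S" for x
    using padic_p_pow_divides_iff[OF that, of 1] by simp
  show cS: "?c \<in> carrier S" by simp
  show "?c \<notin> Units S"
  proof
    assume "?c \<in> Units S"
    then have "?c divides\<^bsub>S\<^esub> \<one>\<^bsub>S\<^esub>"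
      unfolding factor_def using S.Units_r_inv S.Units_inv_closed by metis
    then show False using cdvd[of "\<one>\<^bsub>S\<^esub>"] p1 by (simp add: padic_simps)
  qed
  show "x \<in> Units S" if "x \<in> carrier S" "\<not> ?c divides\<^bsub>S\<^esub> x" for x
    using that cdvd padic_unit by blast
  show "x = \<zero>\<^bsub>S\<^esub>" if "x \<in> carrier S" "\<And>k::nat. ?c [^]\<^bsub>S\<^esub> k divides\<^bsub>S\<^esub> x" for x
    using that padic_p_pow_divides_iff by (intro ext) (simp add: padic_simps)
  show "\<exists>y\<in>carrier S. \<forall>k. ?c [^]\<^bsub>S\<^esub> k divides\<^bsub>S\<^esub> (y \<ominus>\<^bsub>S\<^esub> X k)"
    if X: "\<And>k. X k \<in> carrier S" and step: "\<And>k::nat. ?c [^]\<^bsub>S\<^esub> k divides\<^bsub>S\<^esub> (X (Suc k) \<ominus>\<^bsub>S\<^esub> X k)" for X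
  proof
    have eq: "X (Suc k) k = X k k" for k
      using step[of k] X by (simp add: padic_p_pow_divides_iff padic_minus_eq_0_iff)
    \<comment> \<open>The limit is the diagonal sequence: the residue modulo p^k no longer changes
      from the k-th term on, by \<open>eq\<close>, so the k-th term supplies it.\<close>
    show diag: "(\<lambda>k. X k k) \<in> carrier S"
      unfolding padic_carrier
    proof (intro allI conjI)
      fix k
      show "X (Suc k) (Suc k) mod int p ^ k = X k k"
        using padic_coherent[OF X, of "Suc k" k 1] eq[of k] by simp
    qed (use X padic_range in simp_all)
    show "\<forall>k. ?c [^]\<^bsub>S\<^esub> k divides\<^bsub>S\<^esub> ((\<lambda>k. X k k) \<ominus>\<^bsub>S\<^esub> X k)"
      using X diag by (simp add: padic_p_pow_divides_iff padic_minus_eq_0_iff)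
  qed
  show "n \<ge> 1" by (rule n)
  have "\<not> p dvd n"
    using n(2) p1 by (metis coprime_absorb_right coprime_commute nat_dvd_1_iff_1 of_nat_1 less_irrefl)
  then have "\<not> int p dvd int n" by simp
  then have "int n mod int p \<noteq> 0" by auto
  then show "[n] \<cdot>\<^bsub>S\<^esub> \<one>\<^bsub>S\<^esub> \<in> Units S"
    by (intro padic_unit) (simp_all add: padic_nat_mult_one)
qed

lemma padic_p_pow_nonzero: "([p] \<cdot>\<^bsub>S\<^esub> \<one>\<^bsub>S\<^esub>) [^]\<^bsub>S\<^esub> (j::nat) \<noteq> \<zero>\<^bsub>S\<^esub>"
proof
  assume "([p] \<cdot>\<^bsub>S\<^esub> \<one>\<^bsub>S\<^esub>) [^]\<^bsub>S\<^esub> j = \<zero>\<^bsub>S\<^esub>"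
  then have "int p ^ j mod int p ^ Suc j = 0"
    using padic_p_pow[of j "Suc j"] by (simp add: padic_simps)
  then have "int p dvd 1" using padic_pos[of j] by auto
  then show False using prime_gt_1_nat[OF p] by simp
qed

end

theorem theorem2:
  fixes p n :: nat
  assumes "prime p" and "n \<ge> 1" and "coprime n p"
  shows
    "(\<forall>a::nat. \<forall>A. a \<ge> 1 \<longrightarrow>
        ideal A (cyclic_quot (residue_ring (int (p ^ a))) n) \<longrightarrow>
        A \<noteq> {\<zero>\<^bsub>cyclic_quot (residue_ring (int (p ^ a))) n\<^esub>} \<longrightarrow>
        A \<noteq> carrier (cyclic_quot (residue_ring (int (p ^ a))) n) \<longrightarrow>
        (primeideal A (cyclic_quot (residue_ring (int (p ^ a))) n) \<longleftrightarrow>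
          (\<exists>f. monic_irred_divisor (residue_ring (int (p ^ a))) n f \<and>
            A = image_ideal (residue_ring (int (p ^ a))) n
                  {f, const_nat (residue_ring (int (p ^ a))) p}))) \<and>
     (\<forall>A. ideal A (cyclic_quot (padic_int_ring p) n) \<longrightarrow>
        A \<noteq> {\<zero>\<^bsub>cyclic_quot (padic_int_ring p) n\<^esub>} \<longrightarrow>
        A \<noteq> carrier (cyclic_quot (padic_int_ring p) n) \<longrightarrow>
        (primeideal A (cyclic_quot (padic_int_ring p) n) \<longleftrightarrow>
          (\<exists>f. monic_irred_divisor (padic_int_ring p) n f \<and>
            (A = image_ideal (padic_int_ring p) n {f, const_nat (padic_int_ring p) p} \<or>
             A = image_ideal (padic_int_ring p) n {f})))) \<and>
     (\<forall>f. monic_irred_divisor (padic_int_ring p) n f \<longrightarrow>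
        primeideal (image_ideal (padic_int_ring p) n {f}) (cyclic_quot (padic_int_ring p) n) \<and>
        \<not> maximalideal (image_ideal (padic_int_ring p) n {f}) (cyclic_quot (padic_int_ring p) n))"
proof (intro conjI allI impI)
  fix a :: nat and A
  assume a: "a \<ge> 1" and A: "ideal A (cyclic_quot (residue_ring (int (p ^ a))) n)"
  let ?S = "residue_ring (int (p ^ a))"
  \<comment> \<open>The locale parameter \<open>c\<close> is p times one;
    \<open>const_nat_eq\<close> identifies the generator \<open>const_nat ?S p\<close> with the
    corresponding constant polynomial.\<close>
  interpret cyclic_UP ?S "UP ?S" "[p] \<cdot>\<^bsub>?S\<^esub> \<one>\<^bsub>?S\<^esub>" n
    by (rule cyclic_UP_residue_ring[OF assms a])
  show "primeideal A (cyclic_quot ?S n) \<longleftrightarrow>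
      (\<exists>f. monic_irred_divisor ?S n f \<and> A = image_ideal ?S n {f, const_nat ?S p})"
    unfolding const_nat_eq
    by (rule primeideal_cyclic_quot_nilpotent[OF A cyclic_UP_residue_ring(2)[OF assms a]])
next
  let ?S = "padic_int_ring p"
  interpret cyclic_UP ?S "UP ?S" "[p] \<cdot>\<^bsub>?S\<^esub> \<one>\<^bsub>?S\<^esub>" n
    by (rule cyclic_UP_padic[OF assms])
  have dom: "domain ?S"
    by (rule domain_if_not_nilpotent) (rule padic_p_pow_nonzero[OF assms(1)])
  have c: "[p] \<cdot>\<^bsub>?S\<^esub> \<one>\<^bsub>?S\<^esub> \<noteq> \<zero>\<^bsub>?S\<^esub>"
    using padic_p_pow_nonzero[OF assms(1), of 1] by simp
  {
    fix A assume "ideal A (cyclic_quot ?S n)"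
    then show "primeideal A (cyclic_quot ?S n) \<longleftrightarrow>
        (\<exists>f. monic_irred_divisor ?S n f \<and>
          (A = image_ideal ?S n {f, const_nat ?S p} \<or> A = image_ideal ?S n {f}))"
      unfolding const_nat_eq by (rule primeideal_cyclic_quot_domain[OF _ dom c])
  }
  fix f assume f: "monic_irred_divisor ?S n f"
  show "primeideal (image_ideal ?S n {f}) (cyclic_quot ?S n)"
    by (rule primeideal_image_irred_divisor[OF f dom c])
  show "\<not> maximalideal (image_ideal ?S n {f}) (cyclic_quot ?S n)"
    by (rule not_maximalideal_image_irred_divisor[OF f c])
qed

end
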